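(* Let $r\ge2$ be an integer and let $G$ be a $K_{r+1}$-free connected graph of order $n$. (1) If $n\ge 2r+1$ is odd, then $$\lambda_2(G)\le\rho\big(T_{\frac{n-1}{2},r}\big),$$ with equality if and only if $G\in\mathcal I\big(T_{\frac{n-1}{2},r},T_{\frac{n-1}{2},r}\big)$ and $G$ is $K_{r+1}$-free. (2) If $n\ge 10r$ is even, then $$\lambda_2(G)\le\lambda_2\big(T_{\frac n2,r}\,uv\,T_{\frac n2,r}\big),$$ where $u$ (respectively $v$) is a vertex of (the respective copy of) $T_{\frac n2,r}$ in a partition set of $\lceil\frac{n}{2r}\rceil$ vertices. Equality holds if and only if $G=T_{\frac n2,r}\,uv\,T_{\frac n2,r}$ (up to isomorphism).
   Context: Graphs are finite and simple. $\lambda_1(G)\ge\lambda_2(G)\ge\cdots$ are the adjacency eigenvalues of $G$, and $\rho(G)=\lambda_1(G)$. $G$ is $F$-free if it contains no copy of $F$ as a subgraph. $T_{m,r}$ is the $r$-partite Turán graph on $m$ vertices (complete $r$-partite, with every part of size $\lfloor m/r\rfloor$ or $\lceil m/r\rceil$). For disjoint graphs $A,B$: $\mathcal I(A,B)$ is the family of connected graphs obtained from the disjoint union of $A$ and $B$ by adding one new vertex and joining it to some vertices of $A$ and some vertices of $B$; for $u\in V(A)$, $v\in V(B)$, $A\,uv\,B$ is the graph obtained from the disjoint union of $A$ and $B$ by adding the edge $uv$. *)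

theory Defs
  imports
    "Graph_Theory.Graph_Theory"
    "Jordan_Normal_Form.Char_Poly"
begin

text \<open>
  A finite simple graph is a \<open>pair_graph\<close> of the library: a finite vertex set with a symmetric,
  irreflexive set of arcs, so that an edge \<open>{x, y}\<close> is the pair of arcs \<open>(x, y)\<close>, \<open>(y, x)\<close>.
\<close>

section \<open>Adjacency eigenvalues\<close>

definition adjacency_mat :: "'a list \<Rightarrow> 'a pair_pre_digraph \<Rightarrow> real mat" where
  "adjacency_mat vs G =
    mat (length vs) (length vs) (\<lambda>(i, j). if (vs ! i, vs ! j) \<in> parcs G then 1 else 0)"

text \<open>
  The characteristic polynomial does not depend on the vertex enumeration chosen here
  (see \<open>char_poly_adjacency_mat_enum\<close> below).
\<close>

definition adjacency_char_poly :: "'a pair_pre_digraph \<Rightarrow> real poly" where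
  "adjacency_char_poly G =
    char_poly (adjacency_mat (SOME vs. distinct vs \<and> set vs = pverts G) G)"

text \<open>
  The eigenvalues with multiplicity in weakly decreasing order. An adjacency matrix is real
  symmetric, so its characteristic polynomial splits over the reals and the list has as many
  entries as the graph has vertices.
\<close>

definition eigenvalue_list :: "'a pair_pre_digraph \<Rightarrow> real list" where
  "eigenvalue_list G = rev (sorted_list_of_multiset (proots (adjacency_char_poly G)))"

text \<open>The index is 1-based: \<open>graph_eigenvalue 1 G\<close> is the largest eigenvalue.\<close>

definition graph_eigenvalue :: "nat \<Rightarrow> 'a pair_pre_digraph \<Rightarrow> real" where
  "graph_eigenvalue k G = eigenvalue_list G ! (k - 1)"

abbreviation lambda2 :: "'a pair_pre_digraph \<Rightarrow> real" where
  "lambda2 G \<equiv> graph_eigenvalue 2 G"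

abbreviation rho :: "'a pair_pre_digraph \<Rightarrow> real" where
  "rho G \<equiv> graph_eigenvalue 1 G"

lemma char_poly_adjacency_mat_enum:
  assumes vs: "distinct vs" "set vs = V" and ws: "distinct ws" "set ws = V"
  shows "char_poly (adjacency_mat vs G) = char_poly (adjacency_mat ws G)"
proof -
  define n where "n = length vs"
  have len: "length vs = n" "length ws = n"
    unfolding n_def using vs ws by (metis distinct_card)+
  define A where "A = adjacency_mat vs G"
  define B where "B = adjacency_mat ws G"
  define P where "P = (\<lambda>xs ys :: 'a list. mat n n (\<lambda>(i, j). if xs ! i = ys ! j then 1 else 0 :: real))"
  have ex: "\<exists>k<n. \<forall>l<n. (xs ! l = ys ! i) = (l = k)"
    if a: "distinct xs" "length xs = n" "length ys = n" "set xs = set ys" "i < n" for xs ys :: "'a list" and i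
  proof -
    have "ys ! i \<in> set xs" using a by simp
    then obtain k where "k < n" "xs ! k = ys ! i"
      using a(2) by (auto simp: in_set_conv_nth)
    moreover have "\<forall>l<n. (xs ! l = xs ! k) = (l = k)"
      using a(1,2) \<open>k < n\<close> by (simp add: nth_eq_iff_index_eq)
    ultimately show ?thesis by auto
  qed
  have inv: "P xs ys * P ys xs = 1\<^sub>m n"
    if xs: "distinct xs" "length xs = n" and ys: "distinct ys" "length ys = n"
      and eq: "set xs = set ys" for xs ys :: "'a list"
  proof (rule eq_matI)
    fix i j assume "i < dim_row (1\<^sub>m n :: real mat)" "j < dim_col (1\<^sub>m n :: real mat)"
    then have ij: "i < n" "j < n" by auto
    obtain k where k: "k < n" "\<forall>l<n. (ys ! l = xs ! i) = (l = k)"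
      using ex[OF ys xs(2) eq[symmetric] ij(1)] by blast
    have "(P xs ys * P ys xs) $$ (i, j) = (\<Sum>l = 0..<n.
        (if ys ! l = xs ! i then 1 else 0) * (if ys ! l = xs ! j then 1 else 0))"
      using ij by (auto simp: P_def scalar_prod_def intro!: sum.cong)
    also have "\<dots> = (\<Sum>l = 0..<n. if l = k then (if ys ! k = xs ! j then 1 else 0) else 0)"
      using k by (intro sum.cong) auto
    also have "\<dots> = (if xs ! i = xs ! j then 1 else 0)"
    proof -
      have "ys ! k = xs ! i" using k by blast
      then show ?thesis using k(1) by simp
    qed
    finally show "(P xs ys * P ys xs) $$ (i, j) = 1\<^sub>m n $$ (i, j)"
      using ij xs by (simp add: nth_eq_iff_index_eq)
  qed (auto simp: P_def)
  have comm: "A * P vs ws = P vs ws * B"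
  proof (rule eq_matI)
    fix i j assume "i < dim_row (P vs ws * B)" "j < dim_col (P vs ws * B)"
    then have ij: "i < n" "j < n" by (auto simp: P_def B_def adjacency_mat_def len)
    obtain k where k: "k < n" "\<forall>l<n. (vs ! l = ws ! j) = (l = k)"
      using ex[OF vs(1) len _ ij(2)] vs ws by blast
    obtain m where m: "m < n" "\<forall>l<n. (ws ! l = vs ! i) = (l = m)"
      using ex[OF ws(1) len(2,1) _ ij(1)] vs ws by blast
    have eqs: "vs ! k = ws ! j" "ws ! m = vs ! i" using k m by blast+
    have "(A * P vs ws) $$ (i, j) = (\<Sum>l = 0..<n.
        (if (vs ! i, vs ! l) \<in> parcs G then 1 else 0) * (if vs ! l = ws ! j then 1 else 0))"
      using ij by (simp add: A_def P_def adjacency_mat_def len scalar_prod_def)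
    also have "\<dots> = (\<Sum>l = 0..<n.
        if l = k then (if (vs ! i, ws ! j) \<in> parcs G then 1 else 0) else 0)"
      by (rule sum.cong) (use k eqs in auto)
    also have "\<dots> = (\<Sum>l = 0..<n.
        if l = m then (if (vs ! i, ws ! j) \<in> parcs G then 1 else 0) else 0)"
      using k m by (simp add: sum.delta)
    also have "\<dots> = (\<Sum>l = 0..<n.
        (if vs ! i = ws ! l then 1 else 0) * (if (ws ! l, ws ! j) \<in> parcs G then 1 else 0))"
      by (rule sum.cong) (use m eqs in \<open>auto simp: eq_commute[of "vs ! i"]\<close>)
    also have "\<dots> = (P vs ws * B) $$ (i, j)"
      using ij by (simp add: B_def P_def adjacency_mat_def len scalar_prod_def)
    finally show "(A * P vs ws) $$ (i, j) = (P vs ws * B) $$ (i, j)" .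
  qed (auto simp: A_def B_def P_def adjacency_mat_def len)
  have car: "A \<in> carrier_mat n n" "B \<in> carrier_mat n n" "P vs ws \<in> carrier_mat n n" "P ws vs \<in> carrier_mat n n"
    by (auto simp: A_def B_def P_def adjacency_mat_def len)
  have PQ: "P vs ws * P ws vs = 1\<^sub>m n" "P ws vs * P vs ws = 1\<^sub>m n"
    using inv vs ws len by auto
  have "P vs ws * B * P ws vs = A * (P vs ws * P ws vs)"
    unfolding comm[symmetric] using car by (intro assoc_mult_mat) auto
  then have "A = P vs ws * B * P ws vs"
    using PQ(1) car(1) by simp
  then have "similar_mat A B"
    using car PQ by (intro similar_matI[of A B "P vs ws" "P ws vs" n]) blast+
  then show ?thesis
    unfolding A_def B_def by (rule char_poly_similar)
qed

section \<open>Graphs occurring in the statement\<close>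

definition clique_free :: "nat \<Rightarrow> 'a pair_pre_digraph \<Rightarrow> bool" where
  "clique_free k G \<longleftrightarrow> \<not> (\<exists>H. subgraph H (with_proj G) \<and> complete_digraph k H)"

text \<open>
  The partition sets of the Turan graph are the residue classes modulo \<open>r\<close>, which are as equal in
  size as possible (see \<open>card_turan_part\<close> below).
\<close>

definition turan_part :: "nat \<Rightarrow> nat \<Rightarrow> nat \<Rightarrow> nat set" where
  "turan_part m r i = {x. x < m \<and> x mod r = i}"

definition turan_graph :: "nat \<Rightarrow> nat \<Rightarrow> nat pair_pre_digraph" where
  "turan_graph m r =
    \<lparr> pverts = {..<m}, parcs = {(x, y). x < m \<and> y < m \<and> x mod r \<noteq> y mod r} \<rparr>"

definition disjoint_union ::
  "'a pair_pre_digraph \<Rightarrow> 'b pair_pre_digraph \<Rightarrow> ('a + 'b) pair_pre_digraph" where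
  "disjoint_union A B =
    \<lparr> pverts = pverts A <+> pverts B,
      parcs = map_prod Inl Inl ` parcs A \<union> map_prod Inr Inr ` parcs B \<rparr>"

definition add_edge :: "'a \<Rightarrow> 'a \<Rightarrow> 'a pair_pre_digraph \<Rightarrow> 'a pair_pre_digraph" where
  "add_edge x y G = G\<lparr> parcs := parcs G \<union> {(x, y), (y, x)} \<rparr>"

text \<open>The new vertex is \<open>None\<close>; its neighbourhood is \<open>S\<close>.\<close>

definition add_vertex :: "'a set \<Rightarrow> 'a pair_pre_digraph \<Rightarrow> 'a option pair_pre_digraph" where
  "add_vertex S G =
    \<lparr> pverts = insert None (Some ` pverts G),
      parcs = map_prod Some Some ` parcs G \<union> {None} \<times> Some ` S \<union> Some ` S \<times> {None} \<rparr>"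

text \<open>The graph \<open>A uv B\<close>.\<close>

definition edge_join ::
  "'a pair_pre_digraph \<Rightarrow> 'a \<Rightarrow> 'b \<Rightarrow> 'b pair_pre_digraph \<Rightarrow> ('a + 'b) pair_pre_digraph" where
  "edge_join A u v B = add_edge (Inl u) (Inr v) (disjoint_union A B)"

text \<open>
  The family \<open>\<I>(A, B)\<close>. Membership of a graph on other vertices is to be read up to isomorphism.
\<close>

definition vertex_joins ::
  "'a pair_pre_digraph \<Rightarrow> 'b pair_pre_digraph \<Rightarrow> ('a + 'b) option pair_pre_digraph set" where
  "vertex_joins A B =
    {H. \<exists>S T. S \<subseteq> pverts A \<and> S \<noteq> {} \<and> T \<subseteq> pverts B \<and> T \<noteq> {} \<and>
      H = add_vertex (S <+> T) (disjoint_union A B) \<and> Digraph_Component.connected (with_proj H)}"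

abbreviation isomorphic :: "'a pair_pre_digraph \<Rightarrow> 'b pair_pre_digraph \<Rightarrow> bool" where
  "isomorphic G H \<equiv> digraph_iso (with_proj G) (with_proj H)"

lemma Union_turan_part: "0 < r \<Longrightarrow> (\<Union>i<r. turan_part m r i) = pverts (turan_graph m r)"
  by (auto simp: turan_part_def turan_graph_def)

lemma card_turan_part:
  assumes "i < r"
  shows "card (turan_part m r i) = (if i < m mod r then m div r + 1 else m div r)"
proof (induction m)
  case 0
  then show ?case by (simp add: turan_part_def)
next
  case (Suc m)
  have "finite (turan_part m r i)" "m \<notin> turan_part m r i"
    by (auto simp: turan_part_def)
  moreover have "turan_part (Suc m) r i =
      (if m mod r = i then insert m (turan_part m r i) else turan_part m r i)"
    by (auto simp: turan_part_def less_Suc_eq)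
  ultimately have "card (turan_part (Suc m) r i) =
      (if i < m mod r then m div r + 1 else m div r) + (if m mod r = i then 1 else 0)"
    using Suc.IH by simp
  moreover have "m mod r < r" using assms by simp
  ultimately show ?case
    using assms by (auto simp: mod_Suc div_Suc)
qed

end

theory Submission
  imports Defs "Jordan_Normal_Form.Spectral_Radius" "HOL-Combinatorics.Permutations"
begin

text \<open>
  Let \<open>x\<close> be an eigenvector with entries of both signs for an eigenvalue \<open>\<mu> \<ge> lambda2 G\<close>, and let
  \<open>P\<close> and \<open>N\<close> be the vertex sets where \<open>x\<close> is positive and negative. The arcs between \<open>P\<close> and \<open>N\<close> only
  raise the quadratic form of \<open>x\<close> on either side, so the subgraphs induced on \<open>P\<close> and on \<open>N\<close> both have
  a Rayleigh quotient of at least \<open>\<mu>\<close>, and one of them has at most half of the vertices. For odd \<open>n\<close>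
  the spectral Turan theorem then bounds \<open>\<mu>\<close>. For even \<open>n\<close> the critical case is \<open>|P| = |N| = n/2\<close>; then an
  arc \<open>(u, v)\<close> from \<open>P\<close> to \<open>N\<close> contributes at least \<open>(x u)\<^sup>2\<close> or at least \<open>(x v)\<^sup>2\<close>, and what is needed is
  a spectral Turan theorem for the form \<open>\<langle>x, A x\<rangle> - (x u)\<^sup>2\<close>, where \<open>u\<close> is a marked vertex.

  Both Turan theorems are proved together. For a fixed positive \<open>x\<close>, Zykov symmetrization reduces
  the problem to complete \<open>r\<close>-partite graphs. There the Cauchy-Schwarz inequality shows that the form is
  at most \<open>\<lambda> \<langle>x, x\<rangle>\<close> as soon as the sum of \<open>s / (\<lambda> + s)\<close> over the part sizes \<open>s\<close> is at most \<open>1\<close>, where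
  a marked vertex counts \<open>1 - 1/(\<lambda> + 1)\<close> instead of \<open>1\<close>. By concavity this sum is largest exactly for
  balanced parts with the marked vertex in a larger part.
\<close>

text \<open>No eigenvalue of an extremal graph is computed. A number \<open>lam\<close> is fixed by
  requiring that the sum over balanced part sizes equals 1. Explicit test vectors show that
  \<open>lam\<close> is at most the eigenvalue of the extremal graph, and the sign argument shows
  \<open>lambda2 G \<le> lam\<close>. This second bound is not separate from the equality case:
  \<open>lam \<le> \<mu>\<close> already forces \<open>\<mu> = lam\<close> and the structure of the
  graph. The subtracted square comes from the join of two Turan graphs. A vector that is positive on
  one copy and negative on the other loses twice the product of its absolute values on the edge
  \<open>uv\<close>, which is one square per copy if they agree at both ends. Each half thus behaves
  like a graph with a loop of weight -1 at the marked vertex. Vertices where the eigenvector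
  vanishes lie in neither sign set; in the odd extremal case there is exactly one, and it becomes
  the new vertex of the family. Only \<open>lambda2 G \<le> \<mu>\<close> is required, because an
  eigenvector for \<open>lambda2\<close> is not known in advance to change sign.\<close>

section \<open>Spectral decomposition of a symmetric real matrix and of a graph\<close>

text \<open>A complex eigenvector exists because the complex spectrum is nonempty. The form
  \<open>q\<close> of a symmetric matrix is real, so the eigenvalue is real, and then the real and
  imaginary parts of the vector separately satisfy the eigenvector equation; one of them is
  nonzero.\<close>

lemma real_symmetric_eigenvector:
  fixes A :: "real mat"
  assumes A: "A \<in> carrier_mat n n" and sym: "A\<^sup>T = A" and n: "0 < n"
  obtains v k where "v \<in> carrier_vec n" "v \<noteq> 0\<^sub>v n" "A *\<^sub>v v = k \<cdot>\<^sub>v v"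
proof -
  note witness = that
  let ?C = "map_mat complex_of_real A"
  have C: "?C \<in> carrier_mat n n" using A by auto
  have dim: "dim_row A = n" "dim_col A = n" using A by auto
  from spectrum_non_empty[OF C n] obtain k z where "eigenvector ?C z k"
    by (auto simp: spectrum_def eigenvalue_def)
  then have z: "z \<in> carrier_vec n" "z \<noteq> 0\<^sub>v n" "?C *\<^sub>v z = k \<cdot>\<^sub>v z"
    using A by (auto simp: eigenvector_def)
  have eq: "(\<Sum>j<n. of_real (A $$ (i, j)) * z $ j) = k * z $ i" if i: "i < n" for i
  proof -
    have "(?C *\<^sub>v z) $ i = (k \<cdot>\<^sub>v z) $ i" using z by simp
    then show ?thesis
      using i z(1) A by (simp add: scalar_prod_def dim lessThan_atLeast0)
  qed
  have As: "A $$ (i, j) = A $$ (j, i)" if "i < n" "j < n" for i j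
    using sym that A by (metis carrier_matD index_transpose_mat(1))
  define q where "q = (\<Sum>i<n. cnj (z $ i) * (\<Sum>j<n. of_real (A $$ (i, j)) * z $ j))"
  define s where "s = (\<Sum>i<n. (norm (z $ i))\<^sup>2)"
  have "q = (\<Sum>i<n. cnj (z $ i) * (k * z $ i))"
    by (simp add: q_def eq)
  then have q1: "q = k * of_real s"
    by (simp add: s_def sum_distrib_left complex_norm_square algebra_simps del: of_real_power)
  have "cnj q = (\<Sum>i<n. \<Sum>j<n. z $ i * of_real (A $$ (i, j)) * cnj (z $ j))"
    by (simp add: q_def sum_distrib_left algebra_simps)
  also have "\<dots> = (\<Sum>j<n. \<Sum>i<n. z $ i * of_real (A $$ (i, j)) * cnj (z $ j))"
    by (rule sum.swap)
  also have "\<dots> = (\<Sum>j<n. \<Sum>i<n. z $ i * of_real (A $$ (j, i)) * cnj (z $ j))"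
    by (intro sum.cong refl) (simp add: As)
  also have "\<dots> = q"
    by (simp add: q_def sum_distrib_left algebra_simps)
  finally have "Im q = 0" by (simp add: complex_eq_iff)
  obtain i0 where i0: "i0 < n" "z $ i0 \<noteq> 0"
    using z by (metis carrier_vecD eq_vecI index_zero_vec)
  have "s > 0"
    unfolding s_def by (rule sum_pos2[of _ i0]) (use i0 in auto)
  then have "Im k = 0" using \<open>Im q = 0\<close> q1 by simp
  have re: "(\<Sum>j<n. A $$ (i, j) * Re (z $ j)) = Re k * Re (z $ i)" if "i < n" for i
    using arg_cong[OF eq[OF that], of Re] \<open>Im k = 0\<close> by simp
  have im: "(\<Sum>j<n. A $$ (i, j) * Im (z $ j)) = Re k * Im (z $ i)" if "i < n" for i
    using arg_cong[OF eq[OF that], of Im] \<open>Im k = 0\<close> by simp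
  have ex: thesis if "f i0 \<noteq> 0" and "\<And>i. i < n \<Longrightarrow> (\<Sum>j<n. A $$ (i, j) * f j) = Re k * f i" for f
  proof (rule witness[of "vec n f" "Re k"])
    show "A *\<^sub>v vec n f = Re k \<cdot>\<^sub>v vec n f"
      by (rule eq_vecI) (use that(2) A in \<open>auto simp: scalar_prod_def lessThan_atLeast0\<close>)
    show "vec n f \<noteq> 0\<^sub>v n" using i0 that(1) by (metis index_vec index_zero_vec(1))
  qed simp
  from i0 consider "Re (z $ i0) \<noteq> 0" | "Im (z $ i0) \<noteq> 0" by (auto simp: complex_eq_iff)
  then show thesis
    by cases (use ex[of "\<lambda>j. Re (z $ j)"] ex[of "\<lambda>j. Im (z $ j)"] re im in auto)
qed

text \<open>Reflection in the hyperplane orthogonal to \<open>w\<close>, the difference of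
  \<open>v\<close> and the first unit vector, which exchanges these two. If
  \<open>v $ 0 = 1\<close>, then \<open>w\<close> vanishes and the identity serves. The number
  \<open>s\<close> is the squared length of \<open>w\<close>.\<close>

lemma householder_reflection:
  fixes v :: "real vec"
  assumes v: "v \<in> carrier_vec n" "v \<bullet> v = 1" and n: "0 < n"
  obtains H where "H \<in> carrier_mat n n" "H\<^sup>T = H" "H * H = 1\<^sub>m n" "H *\<^sub>v unit_vec n 0 = v"
proof (cases "v $ 0 = 1")
  case True
  have "v \<bullet> v = (\<Sum>i<n. (v $ i)\<^sup>2)"
    using v by (simp add: scalar_prod_def lessThan_atLeast0 power2_eq_square)
  also have "\<dots> = (v $ 0)\<^sup>2 + (\<Sum>i\<in>{..<n} - {0}. (v $ i)\<^sup>2)"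
    using n by (subst sum.remove[of _ 0]) auto
  finally have "(\<Sum>i\<in>{..<n} - {0}. (v $ i)\<^sup>2) = 0" using v True by simp
  then have "\<forall>i\<in>{..<n} - {0}. v $ i = 0"
    by (subst (asm) sum_nonneg_eq_0_iff) auto
  then have "v = unit_vec n 0"
    using v True by (intro eq_vecI) (auto simp: unit_vec_def)
  then show thesis by (intro that[of "1\<^sub>m n"]) auto
next
  case False
  define w where "w i = v $ i - (if i = 0 then 1 else 0)" for i
  define s where "s = 2 - 2 * v $ 0"
  have s0: "s \<noteq> 0" using False by (simp add: s_def)
  have "(\<Sum>i<n. w i * w i) = (\<Sum>i<n. v $ i * v $ i + (if i = 0 then 1 - 2 * v $ 0 else 0))"
    by (intro sum.cong) (auto simp: w_def algebra_simps)
  also have "\<dots> = v \<bullet> v + (1 - 2 * v $ 0)"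
    using v n by (simp add: sum.distrib scalar_prod_def lessThan_atLeast0)
  finally have ww: "(\<Sum>i<n. w i * w i) = s" using v by (simp add: s_def)
  define H where "H = mat n n (\<lambda>(i, j). (if i = j then 1 else 0) - 2 / s * w i * w j)"
  have H: "H \<in> carrier_mat n n" by (simp add: H_def)
  show thesis
  proof (rule that[OF H])
    show "H\<^sup>T = H" by (rule eq_matI) (auto simp: H_def)
    show "H * H = 1\<^sub>m n"
    proof (rule eq_matI)
      fix i j assume ij: "i < dim_row (1\<^sub>m n :: real mat)" "j < dim_col (1\<^sub>m n :: real mat)"
      then have "(H * H) $$ (i, j) = (\<Sum>l<n. ((if i = l then 1 else 0) - 2 / s * w i * w l) *
          ((if l = j then 1 else 0) - 2 / s * w l * w j))"
        by (simp add: H_def scalar_prod_def lessThan_atLeast0)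
      also have "\<dots> = (\<Sum>l<n. (if l = i then (if i = j then 1 else 0) - 2 / s * w i * w j else 0)
           - (if l = j then 2 / s * w i * w j else 0) + (4 / (s * s) * w i * w j) * (w l * w l))"
        using s0 by (intro sum.cong) (auto simp: field_simps)
      also have "\<dots> = (if i = j then 1 else 0) - 4 / s * w i * w j + (4 / (s * s) * w i * w j) * s"
        using ij by (simp add: sum.distrib sum_subtractf ww[symmetric] sum_distrib_left)
      also have "\<dots> = (if i = j then 1 else 0)" using s0 by simp
      finally show "(H * H) $$ (i, j) = 1\<^sub>m n $$ (i, j)" using ij by simp
    qed (auto simp: H_def)
    show "H *\<^sub>v unit_vec n 0 = v"
    proof (rule eq_vecI)
      fix i assume i: "i < dim_vec v"
      have "(H *\<^sub>v unit_vec n 0) $ i = H $$ (i, 0)"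
        using i v n H by (simp add: scalar_prod_right_unit)
      also have "\<dots> = v $ i"
        using i v n s0 by (auto simp: H_def w_def s_def field_simps)
      finally show "(H *\<^sub>v unit_vec n 0) $ i = v $ i" .
    qed (use H v in auto)
  qed
qed

text \<open>Induction on the dimension: a reflection \<open>H\<close> moves a unit eigenvector to
  the first coordinate. By symmetry \<open>C = H * A * H\<close> then has zero first row and column
  outside the corner, and the induction hypothesis applies to the remaining block.\<close>

lemma real_symmetric_diagonalization:
  fixes A :: "real mat"
  assumes "A \<in> carrier_mat n n" "A\<^sup>T = A"
  shows "\<exists>P B. P \<in> carrier_mat n n \<and> B \<in> carrier_mat n n \<and> P * P\<^sup>T = 1\<^sub>m n \<and> P\<^sup>T * P = 1\<^sub>m n \<and>
    diagonal_mat B \<and> A = P * B * P\<^sup>T"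
  using assms
proof (induction n arbitrary: A)
  case 0
  then show ?case
    by (intro exI[of _ "1\<^sub>m 0"]) (auto simp: diagonal_mat_def)
next
  case (Suc n A)
  let ?n = "Suc n"
  note A = Suc.prems(1)
  obtain u k where u: "u \<in> carrier_vec ?n" "u \<noteq> 0\<^sub>v ?n" "A *\<^sub>v u = k \<cdot>\<^sub>v u"
    using real_symmetric_eigenvector[OF Suc.prems] by blast
  have upos: "u \<bullet> u > 0"
    using u conjugate_square_greater_0_vec[of u ?n] by simp
  define v where "v = (1 / sqrt (u \<bullet> u)) \<cdot>\<^sub>v u"
  have v: "v \<in> carrier_vec ?n" "v \<bullet> v = 1" "A *\<^sub>v v = k \<cdot>\<^sub>v v"
  proof -
    show "v \<in> carrier_vec ?n" using u by (simp add: v_def)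
    have "v \<bullet> v = (1 / sqrt (u \<bullet> u)) * ((1 / sqrt (u \<bullet> u)) * (u \<bullet> u))"
      using u by (simp add: v_def)
    also have "\<dots> = 1" using upos by (simp add: field_simps)
    finally show "v \<bullet> v = 1" .
    show "A *\<^sub>v v = k \<cdot>\<^sub>v v"
      using u A by (simp add: v_def mult_mat_vec[of _ ?n ?n] smult_smult_assoc mult.commute)
  qed
  obtain H where H: "H \<in> carrier_mat ?n ?n" "H\<^sup>T = H" "H * H = 1\<^sub>m ?n" "H *\<^sub>v unit_vec ?n 0 = v"
    using householder_reflection[OF v(1,2)] by auto
  define C where "C = H * A * H"
  have C: "C \<in> carrier_mat ?n ?n" using H A by (simp add: C_def)
  have "C\<^sup>T = H\<^sup>T * (A\<^sup>T * H\<^sup>T)"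
    unfolding C_def using H(1) A by (simp add: transpose_mult[of _ ?n ?n _ ?n])
  then have Csym: "C\<^sup>T = C"
    using H A Suc.prems(2) by (simp add: C_def)
  have "C *\<^sub>v unit_vec ?n 0 = H *\<^sub>v (A *\<^sub>v (H *\<^sub>v unit_vec ?n 0))"
    unfolding C_def using H(1) A by (simp add: assoc_mult_mat_vec[of _ ?n ?n _ ?n])
  also have "\<dots> = k \<cdot>\<^sub>v (H *\<^sub>v v)"
    using H v by (simp add: mult_mat_vec[of _ ?n ?n])
  also have "H *\<^sub>v v = (H * H) *\<^sub>v unit_vec ?n 0"
    using H(1,4) by (metis assoc_mult_mat_vec unit_vec_carrier)
  finally have Ce: "C *\<^sub>v unit_vec ?n 0 = k \<cdot>\<^sub>v unit_vec ?n 0" using H by simp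
  have C0: "C $$ (i, 0) = (if i = 0 then k else 0)" if "i < ?n" for i
  proof -
    have "(C *\<^sub>v unit_vec ?n 0) $ i = C $$ (i, 0)"
      using that C by (simp add: scalar_prod_right_unit)
    then show ?thesis using Ce that by (auto simp: unit_vec_def)
  qed
  have Cs: "C $$ (i, j) = C $$ (j, i)" if "i < ?n" "j < ?n" for i j
    using Csym that C by (metis carrier_matD index_transpose_mat(1))
  define C' where "C' = mat n n (\<lambda>(i, j). C $$ (Suc i, Suc j))"
  have C': "C' \<in> carrier_mat n n" by (simp add: C'_def)
  have "C'\<^sup>T = C'" by (rule eq_matI) (auto simp: C'_def Cs)
  from Suc.IH[OF C' this] obtain P' B' where P': "P' \<in> carrier_mat n n" "B' \<in> carrier_mat n n"
    "P' * P'\<^sup>T = 1\<^sub>m n" "P'\<^sup>T * P' = 1\<^sub>m n" "diagonal_mat B'" "C' = P' * B' * P'\<^sup>T" by blast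
  let ?blk = "\<lambda>a M. four_block_mat (a :: real mat) (0\<^sub>m 1 n) (0\<^sub>m n 1) M"
  define K where "K = mat 1 1 (\<lambda>_. k)"
  have K: "K \<in> carrier_mat 1 1" by (simp add: K_def)
  define R where "R = ?blk (1\<^sub>m 1) P'"
  define B where "B = ?blk K B'"
  have R: "R \<in> carrier_mat ?n ?n" and B: "B \<in> carrier_mat ?n ?n"
    using P' K by (auto simp: R_def B_def)
  have RT: "R\<^sup>T = ?blk (1\<^sub>m 1) (P'\<^sup>T)"
    using P' unfolding R_def by (subst transpose_four_block_mat[of _ 1 1 _ n _ n]) auto
  have blk: "?blk a M * ?blk b N = ?blk (a * b) (M * N)"
    if "a \<in> carrier_mat 1 1" "b \<in> carrier_mat 1 1" "M \<in> carrier_mat n n" "N \<in> carrier_mat n n" for a b M N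
    using that by (subst mult_four_block_mat[of _ 1 1 _ n _ n _ _ 1 _ n]) auto
  have blk1: "?blk (1\<^sub>m 1) (1\<^sub>m n) = 1\<^sub>m ?n"
    by (metis four_block_one_mat plus_1_eq_Suc)
  have RR: "R * R\<^sup>T = 1\<^sub>m ?n" "R\<^sup>T * R = 1\<^sub>m ?n"
    unfolding RT using P' blk1 by (simp_all add: R_def blk del: One_nat_def)
  have CR: "C = R * B * R\<^sup>T"
  proof -
    have "R * B * R\<^sup>T = ?blk K C'"
      unfolding RT using P' K by (simp add: R_def B_def blk del: One_nat_def)
    also have "\<dots> = C"
    proof (rule eq_matI)
      fix i j assume "i < dim_row C" "j < dim_col C"
      then have "i < ?n" "j < ?n" using C by auto
      then show "?blk K C' $$ (i, j) = C $$ (i, j)"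
        using C0[of i] C0[of j] Cs[of i j] C' K
        by (cases i; cases j) (auto simp: K_def C'_def)
    qed (use C C' K in auto)
    finally show ?thesis by simp
  qed
  define P where "P = H * R"
  have P: "P \<in> carrier_mat ?n ?n" using H R by (simp add: P_def)
  have PT: "P\<^sup>T = R\<^sup>T * H"
    using H R by (simp add: P_def transpose_mult[of _ ?n ?n _ ?n])
  have RTc: "R\<^sup>T \<in> carrier_mat ?n ?n" using R by simp
  have "P * P\<^sup>T = H * (R * R\<^sup>T) * H"
    unfolding PT using H(1) R RTc by (simp add: P_def assoc_mult_mat[of _ ?n ?n _ ?n _ ?n])
  then have 1: "P * P\<^sup>T = 1\<^sub>m ?n" using RR H by simp
  have "P\<^sup>T * P = R\<^sup>T * (H * H) * R"
    unfolding PT using H(1) R RTc by (simp add: P_def assoc_mult_mat[of _ ?n ?n _ ?n _ ?n])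
  then have 2: "P\<^sup>T * P = 1\<^sub>m ?n" using RR RTc H by simp
  have "P * B * P\<^sup>T = H * (R * B * R\<^sup>T) * H"
    unfolding PT using H(1) R RTc B by (simp add: P_def assoc_mult_mat[of _ ?n ?n _ ?n _ ?n])
  also have "\<dots> = (H * H) * A * (H * H)"
    using H(1) A by (simp flip: CR add: C_def assoc_mult_mat[of _ ?n ?n _ ?n _ ?n])
  also have "\<dots> = A" using H A by simp
  finally have 3: "A = P * B * P\<^sup>T" by simp
  have 4: "diagonal_mat B"
    using P'(2,5) K by (auto simp: B_def diagonal_mat_def)
  show ?case using P B 1 2 3 4 by blast
qed

text \<open>The form <x, A x> of the subgraph induced on \<open>V\<close>, so every edge counts in
  both directions. Vertex set and arc relation are separate arguments in order to cover sign sets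
  and relations such as \<open>part_rel\<close> that are not confined to \<open>V\<close>.\<close>

definition edge_weight :: "'a set \<Rightarrow> ('a \<times> 'a) set \<Rightarrow> ('a \<Rightarrow> real) \<Rightarrow> real" where
  "edge_weight V E x = (\<Sum>a\<in>V. \<Sum>b\<in>V. of_bool ((a, b) \<in> E) * x a * x b)"

section \<open>Orthonormal eigenbases of a graph\<close>

lemma proots_prod_linear: "proots (\<Prod>a\<leftarrow>as. [:- a, 1:]) = mset (as :: real list)"
proof (induction as)
  case (Cons a as)
  have "(\<Prod>a\<leftarrow>as. [:- a, 1:]) \<noteq> (0 :: real poly)"
    by (auto simp: prod_list_zero_iff)
  then show ?case using Cons by (simp add: proots_mult del: mult_pCons_left)
qed simp

text \<open>Everything that the variational arguments take from the diagonalization, stated for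
  functions on the vertices so that they can ignore the vertex enumeration. Index \<open>i\<close>
  of \<open>\<phi>\<close> starts at 0 and belongs to the eigenvalue numbered
  \<open>Suc i\<close>.\<close>

definition spectral_basis :: "'a pair_pre_digraph \<Rightarrow> (nat \<Rightarrow> 'a \<Rightarrow> real) \<Rightarrow> bool" where
  "spectral_basis G \<phi> \<longleftrightarrow>
    (\<forall>i<card (pverts G). \<forall>j<card (pverts G). (\<Sum>a\<in>pverts G. \<phi> i a * \<phi> j a) = of_bool (i = j)) \<and>
    (\<forall>i<card (pverts G). \<forall>a\<in>pverts G.
      (\<Sum>b\<in>pverts G. of_bool ((a, b) \<in> parcs G) * \<phi> i b) = graph_eigenvalue (Suc i) G * \<phi> i a) \<and>
    (\<forall>x. (\<Sum>a\<in>pverts G. (x a)\<^sup>2) = (\<Sum>i<card (pverts G). (\<Sum>a\<in>pverts G. \<phi> i a * x a)\<^sup>2)) \<and>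
    (\<forall>x. edge_weight (pverts G) (parcs G) x =
      (\<Sum>i<card (pverts G). graph_eigenvalue (Suc i) G * (\<Sum>a\<in>pverts G. \<phi> i a * x a)\<^sup>2)) \<and>
    (\<forall>i j. i \<le> j \<longrightarrow> j < card (pverts G) \<longrightarrow> graph_eigenvalue (Suc j) G \<le> graph_eigenvalue (Suc i) G)"

lemma spectral_basisD:
  assumes "spectral_basis G \<phi>"
  shows "i < card (pverts G) \<Longrightarrow> j < card (pverts G) \<Longrightarrow>
      (\<Sum>a\<in>pverts G. \<phi> i a * \<phi> j a) = of_bool (i = j)"
    and "i < card (pverts G) \<Longrightarrow> a \<in> pverts G \<Longrightarrow>
      (\<Sum>b\<in>pverts G. of_bool ((a, b) \<in> parcs G) * \<phi> i b) = graph_eigenvalue (Suc i) G * \<phi> i a"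
    and "(\<Sum>a\<in>pverts G. (x a)\<^sup>2) = (\<Sum>i<card (pverts G). (\<Sum>a\<in>pverts G. \<phi> i a * x a)\<^sup>2)"
    and "edge_weight (pverts G) (parcs G) x =
      (\<Sum>i<card (pverts G). graph_eigenvalue (Suc i) G * (\<Sum>a\<in>pverts G. \<phi> i a * x a)\<^sup>2)"
    and "i \<le> j \<Longrightarrow> j < card (pverts G) \<Longrightarrow> graph_eigenvalue (Suc j) G \<le> graph_eigenvalue (Suc i) G"
  using assms unfolding spectral_basis_def by blast+

lemma spectral_basis_exists:
  fixes G :: "'a pair_pre_digraph"
  assumes G: "pair_graph G"
  obtains \<phi> where "spectral_basis G \<phi>"
proof -
  define n where "n = card (pverts G)"
  interpret pair_graph G by fact
  let ?V = "pverts G"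
  define vs where "vs = (SOME vs. distinct vs \<and> set vs = ?V)"
  have "\<exists>vs. distinct vs \<and> set vs = ?V"
    using finite_distinct_list[OF pair_finite_verts] by blast
  then have "distinct vs \<and> set vs = ?V"
    unfolding vs_def by (rule someI_ex)
  then have vs: "distinct vs" "set vs = ?V" by auto
  have len: "length vs = n" using distinct_card[OF vs(1)] vs(2) n_def by simp
  define A where "A = adjacency_mat vs G"
  have A: "A \<in> carrier_mat n n" by (simp add: A_def adjacency_mat_def len)
  have Ae: "A $$ (i, j) = of_bool ((vs ! i, vs ! j) \<in> parcs G)" if "i < n" "j < n" for i j
    using that by (simp add: A_def adjacency_mat_def len)
  have symE: "(a, b) \<in> parcs G \<longleftrightarrow> (b, a) \<in> parcs G" for a b
    using pair_sym_arcs unfolding symmetric_def with_proj_simps by (blast dest: symD)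
  have "A\<^sup>T = A" by (rule eq_matI) (use A Ae symE in auto)
  from real_symmetric_diagonalization[OF A this] obtain P B where
    P: "P \<in> carrier_mat n n" and B: "B \<in> carrier_mat n n" and PP: "P * P\<^sup>T = 1\<^sub>m n" "P\<^sup>T * P = 1\<^sub>m n"
    and Bd: "diagonal_mat B" and AB: "A = P * B * P\<^sup>T" by blast
  have PT: "P\<^sup>T \<in> carrier_mat n n" using P by simp
  have "upper_triangular B" using Bd B by (auto simp: diagonal_mat_def upper_triangular_def)
  moreover have "similar_mat A B"
    using A B P PP AB by (intro similar_matI[of A B P "P\<^sup>T" n]) auto
  ultimately have "char_poly A = (\<Prod>a\<leftarrow>diag_mat B. [:- a, 1:])"
    using char_poly_similar[of A B] char_poly_upper_triangular[OF B] by simp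
  then have el: "eigenvalue_list G = rev (sort (diag_mat B))"
    unfolding eigenvalue_list_def adjacency_char_poly_def vs_def[symmetric] A_def[symmetric]
    by (simp add: proots_prod_linear)
  have lenB: "length (diag_mat B) = n" using B by (simp add: diag_mat_def)
  \<comment> \<open>The diagonal of \<open>B\<close> is in no particular order; \<open>\<pi>\<close>
    matches it with the decreasing list, so that column \<open>\<pi> i\<close> of \<open>P\<close>
    belongs to the eigenvalue numbered \<open>Suc i\<close>.\<close>
  have "mset (eigenvalue_list G) = mset (diag_mat B)" by (simp add: el)
  then obtain \<pi> where "\<pi> permutes {..<length (diag_mat B)}"
    and \<pi>2: "permute_list \<pi> (diag_mat B) = eigenvalue_list G"
    by (rule mset_eq_permutation)
  then have \<pi>: "\<pi> permutes {..<n}" by (simp add: lenB)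
  have \<pi>n: "\<pi> i < n" if "i < n" for i using permutes_in_image[OF \<pi>, of i] that by simp
  have ev: "graph_eigenvalue (Suc i) G = B $$ (\<pi> i, \<pi> i)" if "i < n" for i
    unfolding graph_eigenvalue_def \<pi>2[symmetric]
    using that \<pi> lenB \<pi>n[OF that] B by (subst permute_list_nth) (simp_all add: diag_mat_def)
  have bij: "bij_betw ((!) vs) {..<n} ?V"
    using bij_betw_nth[OF vs(1)] vs(2) len by auto
  define ix where "ix = inv_into {..<n} ((!) vs)"
  have ix: "ix (vs ! k) = k" if "k < n" for k
    unfolding ix_def using bij that by (simp add: bij_betw_def inv_into_f_f)
  have reidx: "(\<Sum>a\<in>?V. f a) = (\<Sum>k<n. f (vs ! k))" for f :: "'a \<Rightarrow> real"
    by (rule sum.reindex_bij_betw[OF bij, symmetric])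
  have inV: "\<exists>k<n. a = vs ! k" if "a \<in> ?V" for a
    using that vs(2) len by (metis in_set_conv_nth)
  define \<phi> where "\<phi> i a = P $$ (ix a, \<pi> i)" for i a
  have orth: "(\<Sum>a\<in>?V. \<phi> i a * \<phi> j a) = of_bool (i = j)" if ij: "i < n" "j < n" for i j
  proof -
    have "(\<Sum>a\<in>?V. \<phi> i a * \<phi> j a) = (P\<^sup>T * P) $$ (\<pi> i, \<pi> j)"
      using P \<pi>n ij by (simp add: reidx \<phi>_def ix scalar_prod_def lessThan_atLeast0)
    also have "\<dots> = of_bool (\<pi> i = \<pi> j)"
      using PP \<pi>n ij by simp
    finally show ?thesis using permutes_inj[OF \<pi>] by (simp add: inj_eq)
  qed
  \<comment> \<open>Orthonormality of the rows of \<open>P\<close> makes the basis complete, which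
    yields the expansion \<open>expand\<close>.\<close>
  have compl: "(\<Sum>i<n. \<phi> i a * \<phi> i b) = of_bool (a = b)" if ab: "a \<in> ?V" "b \<in> ?V" for a b
  proof -
    obtain k l where kl: "k < n" "a = vs ! k" "l < n" "b = vs ! l" using ab inV by metis
    have "(\<Sum>i<n. \<phi> i a * \<phi> i b) = (\<Sum>i<n. P $$ (k, \<pi> i) * P $$ (l, \<pi> i))"
      using kl by (simp add: \<phi>_def ix)
    also have "\<dots> = (\<Sum>i<n. P $$ (k, i) * P $$ (l, i))"
      using sum.permute[OF \<pi>, of "\<lambda>i. P $$ (k, i) * P $$ (l, i)"] by (simp add: o_def)
    also have "\<dots> = (P * P\<^sup>T) $$ (k, l)"
      using P kl by (simp add: scalar_prod_def lessThan_atLeast0)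
    also have "\<dots> = of_bool (k = l)" using PP kl by simp
    finally show ?thesis using kl vs(1) len by (simp add: nth_eq_iff_index_eq)
  qed
  have eig: "(\<Sum>b\<in>?V. of_bool ((a, b) \<in> parcs G) * \<phi> i b) = graph_eigenvalue (Suc i) G * \<phi> i a"
    if i: "i < n" and a: "a \<in> ?V" for i a
  proof -
    obtain k where k: "k < n" "a = vs ! k" using a inV by metis
    have "A * P = P * B * (P\<^sup>T * P)"
      unfolding AB using P B PT by (simp add: assoc_mult_mat[of _ n n _ n _ n])
    then have APB: "A * P = P * B" using PP P B by simp
    have "(\<Sum>b\<in>?V. of_bool ((a, b) \<in> parcs G) * \<phi> i b) = (A * P) $$ (k, \<pi> i)"
      using P A k \<pi>n[OF i] by (simp add: reidx \<phi>_def ix Ae scalar_prod_def lessThan_atLeast0)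
    also have "\<dots> = (\<Sum>l<n. P $$ (k, l) * B $$ (l, \<pi> i))"
      using P B k \<pi>n[OF i] by (simp add: APB scalar_prod_def lessThan_atLeast0)
    also have "\<dots> = (\<Sum>l<n. if l = \<pi> i then P $$ (k, \<pi> i) * B $$ (\<pi> i, \<pi> i) else 0)"
      using Bd B \<pi>n[OF i] by (intro sum.cong) (auto simp: diagonal_mat_def)
    also have "\<dots> = P $$ (k, \<pi> i) * B $$ (\<pi> i, \<pi> i)" using \<pi>n[OF i] by simp
    finally show ?thesis using k i by (simp add: ev \<phi>_def ix)
  qed
  define c where "c x i = (\<Sum>a\<in>?V. \<phi> i a * x a)" for x i
  have expand: "x a = (\<Sum>i<n. c x i * \<phi> i a)" if a: "a \<in> ?V" for x a
  proof -
    have "(\<Sum>i<n. c x i * \<phi> i a) = (\<Sum>i<n. \<Sum>b\<in>?V. x b * (\<phi> i a * \<phi> i b))"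
      by (simp add: c_def sum_distrib_left sum_distrib_right algebra_simps)
    also have "\<dots> = (\<Sum>b\<in>?V. x b * (\<Sum>i<n. \<phi> i a * \<phi> i b))"
      by (subst sum.swap) (simp add: sum_distrib_left)
    also have "\<dots> = (\<Sum>b\<in>?V. if b = a then x a else 0)"
      by (intro sum.cong) (auto simp: compl a)
    also have "\<dots> = x a" using a pair_finite_verts by simp
    finally show ?thesis by simp
  qed
  have norm: "(\<Sum>a\<in>?V. (x a)\<^sup>2) = (\<Sum>i<n. (c x i)\<^sup>2)" for x
  proof -
    have "(\<Sum>a\<in>?V. (x a)\<^sup>2) = (\<Sum>a\<in>?V. x a * (\<Sum>i<n. c x i * \<phi> i a))"
      by (intro sum.cong) (auto simp: power2_eq_square simp flip: expand)
    also have "\<dots> = (\<Sum>i<n. \<Sum>a\<in>?V. c x i * (\<phi> i a * x a))"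
      by (subst sum.swap) (simp add: sum_distrib_left algebra_simps)
    also have "\<dots> = (\<Sum>i<n. (c x i)\<^sup>2)"
      by (simp add: c_def power2_eq_square sum_distrib_left)
    finally show ?thesis .
  qed
  have qf: "edge_weight (pverts G) (parcs G) x = (\<Sum>i<n. graph_eigenvalue (Suc i) G * (c x i)\<^sup>2)" for x
  proof -
    have nb: "(\<Sum>b\<in>?V. of_bool ((a, b) \<in> parcs G) * x b) =
        (\<Sum>i<n. c x i * (graph_eigenvalue (Suc i) G * \<phi> i a))" if a: "a \<in> ?V" for a
    proof -
      have "(\<Sum>b\<in>?V. of_bool ((a, b) \<in> parcs G) * x b) =
          (\<Sum>b\<in>?V. of_bool ((a, b) \<in> parcs G) * (\<Sum>i<n. c x i * \<phi> i b))"
        by (intro sum.cong refl) (simp flip: expand)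
      also have "\<dots> = (\<Sum>i<n. c x i * (\<Sum>b\<in>?V. of_bool ((a, b) \<in> parcs G) * \<phi> i b))"
        unfolding sum_distrib_left by (subst sum.swap) (simp add: algebra_simps)
      also have "\<dots> = (\<Sum>i<n. c x i * (graph_eigenvalue (Suc i) G * \<phi> i a))"
        by (intro sum.cong refl, subst eig) (use a in auto)
      finally show ?thesis .
    qed
    have "edge_weight (pverts G) (parcs G) x = (\<Sum>a\<in>?V. x a * (\<Sum>b\<in>?V. of_bool ((a, b) \<in> parcs G) * x b))"
      unfolding edge_weight_def sum_distrib_left by (intro sum.cong refl) simp
    also have "\<dots> = (\<Sum>a\<in>?V. x a * (\<Sum>i<n. c x i * (graph_eigenvalue (Suc i) G * \<phi> i a)))"
      by (intro sum.cong refl, subst nb) simp_all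
    also have "\<dots> = (\<Sum>i<n. \<Sum>a\<in>?V. graph_eigenvalue (Suc i) G * c x i * (\<phi> i a * x a))"
      by (subst sum.swap) (simp add: sum_distrib_left algebra_simps)
    also have "\<dots> = (\<Sum>i<n. graph_eigenvalue (Suc i) G * (c x i)\<^sup>2)"
      by (simp add: c_def power2_eq_square sum_distrib_left algebra_simps)
    finally show ?thesis .
  qed
  have ord: "graph_eigenvalue (Suc j) G \<le> graph_eigenvalue (Suc i) G" if "i \<le> j" "j < n" for i j
  proof -
    have "n - Suc j \<le> n - Suc i" using that by simp
    then have "sort (diag_mat B) ! (n - Suc j) \<le> sort (diag_mat B) ! (n - Suc i)"
      using that lenB by (intro sorted_nth_mono) auto
    then show ?thesis
      using that lenB by (simp add: graph_eigenvalue_def el rev_nth)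
  qed
  show thesis
    by (rule that[of \<phi>], unfold spectral_basis_def n_def[symmetric])
      (use orth eig norm qf ord in \<open>auto simp: c_def\<close>)
qed

section \<open>Zykov symmetrization and complete multipartite graphs\<close>

abbreviation part_rel :: "('a \<Rightarrow> nat) \<Rightarrow> ('a \<times> 'a) set" where
  "part_rel p \<equiv> {(a, b). p a \<noteq> p b}"

text \<open>The degree-majorization form of symmetrization, due to Erdos. Take \<open>w\<close> of
  largest weighted degree. A clique in its neighbourhood \<open>N\<close> extends by
  \<open>w\<close>, so induction partitions \<open>N\<close> into one part less; the vertices
  outside \<open>N\<close> become one new part joined to all of \<open>N\<close>, as if each were a
  copy of \<open>w\<close>. Positivity of \<open>x\<close> turns equality of weights into equality
  of arcs.\<close>

lemma zykov_symmetrization: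
  fixes x :: "'a \<Rightarrow> real"
  assumes "finite V" "\<And>a. a \<in> V \<Longrightarrow> 0 < x a" "sym E" "irrefl E"
    and "\<And>K. K \<subseteq> V \<Longrightarrow> card K = Suc r \<Longrightarrow> \<exists>a\<in>K. \<exists>b\<in>K. a \<noteq> b \<and> (a, b) \<notin> E"
  shows "\<exists>p. (\<forall>a\<in>V. p a < r) \<and> edge_weight V E x \<le> edge_weight V (part_rel p) x \<and>
    (edge_weight V E x = edge_weight V (part_rel p) x \<longrightarrow>
      (\<forall>a\<in>V. \<forall>b\<in>V. (a, b) \<in> E \<longleftrightarrow> p a \<noteq> p b))"
  using assms
proof (induction r arbitrary: V)
  case 0
  have "v \<notin> V" for v using "0.prems"(5)[of "{v}"] by auto
  then have "V = {}" by auto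
  then show ?case by (simp add: edge_weight_def)
next
  case (Suc r)
  note fin = Suc.prems(1) and pos = Suc.prems(2)
  have E: "(a, b) \<in> E \<longleftrightarrow> (b, a) \<in> E" "(a, a) \<notin> E" for a b
    using Suc.prems(3,4) by (auto dest: symD simp: irrefl_def)
  show ?case
  proof (cases "V = {}")
    case True
    then show ?thesis by (simp add: edge_weight_def)
  next
    case False
    define d where "d a = (\<Sum>b\<in>V. of_bool ((a, b) \<in> E) * x b)" for a
    have "Max (d ` V) \<in> d ` V" using fin False by (intro Max_in) auto
    then obtain w where "w \<in> V" "Max (d ` V) = d w" by auto
    then have w: "w \<in> V" "\<And>a. a \<in> V \<Longrightarrow> d a \<le> d w"
      using fin Max_ge[of "d ` V"] by auto
    define N where "N = {b \<in> V. (w, b) \<in> E}"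
    define M where "M = V - N"
    have NM: "N \<subseteq> V" "M \<subseteq> V" "N \<inter> M = {}" "V = N \<union> M" "finite N" "finite M" "w \<in> M"
      using fin w E by (auto simp: N_def M_def)
    have "\<exists>a\<in>K. \<exists>b\<in>K. a \<noteq> b \<and> (a, b) \<notin> E" if K: "K \<subseteq> N" "card K = Suc r" for K
    proof -
      have "w \<notin> K" "finite K" using K NM finite_subset by auto
      then have "card (insert w K) = Suc (Suc r)" using K by simp
      moreover have "insert w K \<subseteq> V" using K NM w by auto
      ultimately obtain a b where ab: "a \<in> insert w K" "b \<in> insert w K" "a \<noteq> b" "(a, b) \<notin> E"
        using Suc.prems(5)[of "insert w K"] by blast
      then have "a \<noteq> w" "b \<noteq> w" using K E by (auto simp: N_def)
      then show ?thesis using ab by blast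
    qed
    then have "\<exists>p. (\<forall>a\<in>N. p a < r) \<and> edge_weight N E x \<le> edge_weight N (part_rel p) x \<and>
      (edge_weight N E x = edge_weight N (part_rel p) x \<longrightarrow>
        (\<forall>a\<in>N. \<forall>b\<in>N. (a, b) \<in> E \<longleftrightarrow> p a \<noteq> p b))"
      using NM pos Suc.prems(3,4) by (intro Suc.IH) auto
    then obtain p where p: "\<And>a. a \<in> N \<Longrightarrow> p a < r"
      "edge_weight N E x \<le> edge_weight N (part_rel p) x"
      "edge_weight N E x = edge_weight N (part_rel p) x \<Longrightarrow>
        \<forall>a\<in>N. \<forall>b\<in>N. (a, b) \<in> E \<longleftrightarrow> p a \<noteq> p b"
      by blast
    define p' where "p' a = (if a \<in> N then p a else r)" for a
    define W where "W R X Y = (\<Sum>a\<in>X. \<Sum>b\<in>Y. of_bool ((a, b) \<in> R) * x a * x b)" for R X Y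
    have split: "edge_weight V R x = W R N N + W R N M + W R M N + W R M M" for R
      unfolding edge_weight_def W_def
      using NM by (simp add: sum.union_disjoint sum.distrib del: sum_mult_of_bool_eq sum_of_bool_mult_eq)
    have sw: "W R N M = W R M N" if "\<And>a b. (a, b) \<in> R \<longleftrightarrow> (b, a) \<in> R" for R
      unfolding W_def by (subst sum.swap) (intro sum.cong refl, use that in auto)
    define xM xN where "xM = (\<Sum>a\<in>M. x a)" and "xN = (\<Sum>b\<in>N. x b)"
    have Md: "(\<Sum>a\<in>M. x a * d a) = W E M N + W E M M"
    proof -
      have "(\<Sum>a\<in>M. x a * d a) = (\<Sum>a\<in>M. \<Sum>b\<in>V. of_bool ((a, b) \<in> E) * x a * x b)"
        unfolding d_def sum_distrib_left by (intro sum.cong refl) simp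
      then show ?thesis
        unfolding W_def NM(4) using NM
        by (simp add: sum.union_disjoint sum.distrib del: sum_mult_of_bool_eq sum_of_bool_mult_eq)
    qed
    have dw: "d w = xN"
      unfolding d_def xN_def N_def using fin by (simp add: sum.If_cases Int_def)
    have Mdw: "(\<Sum>a\<in>M. x a * d a) \<le> xM * d w"
      unfolding xM_def sum_distrib_right
      by (intro sum_mono mult_left_mono) (use w pos NM in \<open>auto simp: less_imp_le\<close>)
    have WM: "0 \<le> W E M M"
      unfolding W_def by (intro sum_nonneg) (use pos NM in \<open>auto simp: less_imp_le\<close>)
    have "W (part_rel p') N N = edge_weight N (part_rel p) x"
      unfolding W_def edge_weight_def by (intro sum.cong refl) (auto simp: p'_def)
    moreover have "W (part_rel p') M M = 0"
      unfolding W_def by (intro sum.neutral ballI) (use NM in \<open>auto simp: p'_def\<close>)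
    moreover have "W (part_rel p') M N = (\<Sum>a\<in>M. \<Sum>b\<in>N. x a * x b)"
      unfolding W_def
      by (intro sum.cong refl) (use NM p(1) in \<open>auto simp: p'_def dest: p(1)\<close>)
    moreover have "(\<Sum>a\<in>M. \<Sum>b\<in>N. x a * x b) = xM * xN"
      by (simp add: xM_def xN_def sum_product)
    moreover have "W (part_rel p') N M = W (part_rel p') M N" by (rule sw) auto
    ultimately have new: "edge_weight V (part_rel p') x = edge_weight N (part_rel p) x + 2 * (xM * xN)"
      by (simp add: split)
    \<comment> \<open>Twice the sum of \<open>x a * d a\<close> over \<open>M\<close> covers the
      arcs between \<open>M\<close> and \<open>N\<close> in both directions, but counts those inside
      \<open>M\<close> once too often.\<close>
    have old: "edge_weight V E x = edge_weight N E x + 2 * (\<Sum>a\<in>M. x a * d a) - W E M M"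
      using split[of E] sw[of E] E(1) Md by (simp add: W_def edge_weight_def)
    have "(\<forall>a\<in>V. p' a < Suc r)"
      using p(1) NM by (auto simp: p'_def less_Suc_eq)
    moreover have "edge_weight V E x \<le> edge_weight V (part_rel p') x"
      using new old p(2) Mdw WM dw by simp
    moreover have "(a, b) \<in> E \<longleftrightarrow> p' a \<noteq> p' b"
      if eq: "edge_weight V E x = edge_weight V (part_rel p') x" and ab: "a \<in> V" "b \<in> V" for a b
    proof -
      note facts = eq new old p(2) Mdw[unfolded dw] WM
      have eqs: "edge_weight N E x = edge_weight N (part_rel p) x" using facts by linarith
      have MM0: "W E M M = 0" using facts by linarith
      have Md_eq: "(\<Sum>a\<in>M. x a * d a) = xM * d w" unfolding dw using facts by linarith
      have MM: "(a, b) \<notin> E" if "a \<in> M" "b \<in> M" for a b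
      proof -
        have "(\<Sum>b\<in>M. of_bool ((a, b) \<in> E) * x a * x b) = 0"
          using MM0 that NM pos unfolding W_def
          by (subst (asm) sum_nonneg_eq_0_iff) (auto simp: less_imp_le intro!: sum_nonneg)
        then have "of_bool ((a, b) \<in> E) * x a * x b = 0"
          using that NM pos
          by (subst (asm) sum_nonneg_eq_0_iff) (auto simp: less_imp_le)
        then show ?thesis using pos[of a] pos[of b] that NM by auto
      qed
      \<comment> \<open>All of \<open>M\<close> attains the maximal degree \<open>xN\<close> and has
        no inner arcs, so each of its vertices sees the full mass of \<open>N\<close>; positive
        weights leave no missing neighbour.\<close>
      have MN: "(a, b) \<in> E" if a: "a \<in> M" and b: "b \<in> N" for a b
      proof -
        have "(\<Sum>a\<in>M. x a * (d w - d a)) = 0"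
          using Md_eq by (simp add: right_diff_distrib sum_subtractf xM_def sum_distrib_right)
        then have "x a * (d w - d a) = 0"
          using a w pos NM
          by (subst (asm) sum_nonneg_eq_0_iff) (auto simp: less_imp_le intro!: mult_nonneg_nonneg)
        then have "d a = xN" using pos[of a] a NM dw by auto
        moreover have "d a = (\<Sum>b\<in>N. of_bool ((a, b) \<in> E) * x b) + (\<Sum>b\<in>M. of_bool ((a, b) \<in> E) * x b)"
          unfolding d_def NM(4) using NM by (simp add: sum.union_disjoint del: sum_mult_of_bool_eq sum_of_bool_mult_eq)
        moreover have "(\<Sum>b\<in>M. of_bool ((a, b) \<in> E) * x b) = 0"
          by (intro sum.neutral) (use a MM in auto)
        ultimately have "(\<Sum>b\<in>N. x b - of_bool ((a, b) \<in> E) * x b) = 0"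
          by (simp add: sum_subtractf xN_def)
        then have "x b - of_bool ((a, b) \<in> E) * x b = 0"
          using b pos NM
          by (subst (asm) sum_nonneg_eq_0_iff) (auto simp: less_imp_le of_bool_def)
        then show ?thesis using pos[of b] b NM by auto
      qed
      consider "a \<in> M" "b \<in> M" | "a \<in> M" "b \<in> N" | "a \<in> N" "b \<in> M" | "a \<in> N" "b \<in> N"
        using ab NM by auto
      then show ?thesis
      proof cases
        case 1
        then show ?thesis using MM NM by (auto simp: p'_def)
      next
        case 2
        then show ?thesis using MN NM p(1)[of b] by (auto simp: p'_def)
      next
        case 3
        then show ?thesis using MN E(1)[of a b] NM p(1)[of a] by (auto simp: p'_def)
      next
        case 4
        then show ?thesis using p(3)[OF eqs] by (auto simp: p'_def)
      qed
    qed
    ultimately show ?thesis by blast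
  qed
qed

section \<open>Cauchy-Schwarz on complete multipartite graphs\<close>

lemma sum_power2_le_sum_times_sum:
  fixes a g z :: "'i \<Rightarrow> real"
  assumes "\<And>i. i \<in> I \<Longrightarrow> 0 \<le> g i" "\<And>i. i \<in> I \<Longrightarrow> 0 \<le> z i" "\<And>i. i \<in> I \<Longrightarrow> (a i)\<^sup>2 \<le> g i * z i"
  shows "(\<Sum>i\<in>I. a i)\<^sup>2 \<le> (\<Sum>i\<in>I. g i) * (\<Sum>i\<in>I. z i)"
  using assms
proof (induction I rule: infinite_finite_induct)
  case (insert j I)
  define A G Z where "A = (\<Sum>i\<in>I. a i)" and "G = (\<Sum>i\<in>I. g i)" and "Z = (\<Sum>i\<in>I. z i)"
  have IH: "A\<^sup>2 \<le> G * Z" and j: "(a j)\<^sup>2 \<le> g j * z j" "0 \<le> g j" "0 \<le> z j"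
    and nonneg: "0 \<le> G" "0 \<le> Z"
    using insert by (auto simp: A_def G_def Z_def intro: sum_nonneg)
  \<comment> \<open>The mixed term: its square is at most \<open>4 * (G * Z) * (g j * z j)\<close>,
    and by the inequality of arithmetic and geometric means this is at most the square of
    \<open>G * z j + g j * Z\<close>.\<close>
  have "(2 * (A * a j))\<^sup>2 = 4 * (A\<^sup>2 * (a j)\<^sup>2)" by (simp add: power_mult_distrib)
  also have "\<dots> \<le> 4 * ((G * Z) * (g j * z j))"
    using IH j nonneg by (intro mult_left_mono mult_mono) auto
  also have "\<dots> = (G * z j + g j * Z)\<^sup>2 - (G * z j - g j * Z)\<^sup>2"
    by (simp add: power2_eq_square algebra_simps)
  also have "\<dots> \<le> (G * z j + g j * Z)\<^sup>2" by simp
  finally have "2 * (A * a j) \<le> G * z j + g j * Z"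
    by (rule power2_le_imp_le) (use j nonneg in auto)
  then have "(a j + A)\<^sup>2 \<le> (g j + G) * (z j + Z)"
    using IH j by (simp add: power2_eq_square algebra_simps)
  then show ?case using insert.hyps by (simp add: A_def G_def Z_def)
qed auto

definition part_mass :: "'a set \<Rightarrow> ('a \<Rightarrow> nat) \<Rightarrow> ('a \<Rightarrow> real) \<Rightarrow> nat \<Rightarrow> real" where
  "part_mass V p D i = (\<Sum>a\<in>{a \<in> V. p a = i}. 1 / D a)"

text \<open>Solving \<open>D a * y a = S - S_i\<close> on a complete multipartite graph, where
  \<open>S\<close> is the total of \<open>y\<close> and \<open>S_i\<close> its total on part
  \<open>i\<close>, gives \<open>S_i = S * t / (1 + t)\<close> with \<open>t\<close> the part mass.
  Summing over the parts, a solution with nonzero \<open>S\<close> needs \<open>char_sum\<close> to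
  be 1. For constant \<open>D = lam\<close> a part of size \<open>s\<close> has mass
  \<open>s / lam\<close> and contributes \<open>s / (lam + s)\<close>.\<close>

definition char_sum :: "'a set \<Rightarrow> ('a \<Rightarrow> nat) \<Rightarrow> ('a \<Rightarrow> real) \<Rightarrow> nat \<Rightarrow> real" where
  "char_sum V p D r = (\<Sum>i<r. part_mass V p D i / (1 + part_mass V p D i))"

lemma sum_by_parts:
  fixes p :: "'a \<Rightarrow> nat"
  assumes "finite V" "\<And>a. a \<in> V \<Longrightarrow> p a < r"
  shows "(\<Sum>i<r. \<Sum>a\<in>{a \<in> V. p a = i}. f a) = (\<Sum>a\<in>V. f a :: real)"
  by (rule sum.group) (use assms in auto)

lemma edge_weight_part_rel:
  assumes V: "finite V" "\<And>a. a \<in> V \<Longrightarrow> p a < r"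
  shows "edge_weight V (part_rel p) x = (\<Sum>a\<in>V. x a)\<^sup>2 - (\<Sum>i<r. (\<Sum>a\<in>{a \<in> V. p a = i}. x a)\<^sup>2)"
proof -
  have "(\<Sum>i<r. (\<Sum>a\<in>{a \<in> V. p a = i}. x a)\<^sup>2) =
      (\<Sum>i<r. \<Sum>a\<in>{a \<in> V. p a = i}. \<Sum>b\<in>{b \<in> V. p b = p a}. x a * x b)"
    by (intro sum.cong refl) (simp add: power2_eq_square sum_product)
  also have "\<dots> = (\<Sum>a\<in>V. \<Sum>b\<in>{b \<in> V. p b = p a}. x a * x b)"
    by (rule sum_by_parts[where p = p, OF assms])
  also have "\<dots> = (\<Sum>a\<in>V. \<Sum>b\<in>V. of_bool (p b = p a) * (x a * x b))"
    by (rule sum.cong[OF refl]) (simp add: V(1) Collect_conj_eq)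
  finally have parts: "(\<Sum>i<r. (\<Sum>a\<in>{a \<in> V. p a = i}. x a)\<^sup>2) =
      (\<Sum>a\<in>V. \<Sum>b\<in>V. of_bool (p b = p a) * (x a * x b))" .
  have "(\<Sum>a\<in>V. x a)\<^sup>2 = (\<Sum>a\<in>V. \<Sum>b\<in>V. x a * x b)"
    by (simp add: power2_eq_square sum_product)
  also have "\<dots> = (\<Sum>a\<in>V. \<Sum>b\<in>V. of_bool ((a, b) \<in> part_rel p) * x a * x b + of_bool (p b = p a) * (x a * x b))"
    by (intro sum.cong refl) auto
  finally show ?thesis
    unfolding parts edge_weight_def sum.distrib by simp
qed

text \<open>Cauchy-Schwarz is nested. Inside a part it bounds the square of the part sum by
  \<open>t\<close> times the weighted square sum; adding \<open>t\<close> times the squared part sum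
  to both sides produces the factor \<open>t / (1 + t)\<close> and the hypothesis for its use across
  the parts. The squared part sums on the right are exactly what the form of a complete multipartite
  graph lacks from the square of the total.\<close>

lemma multipartite_weight_bound:
  assumes V: "finite V" "\<And>a. a \<in> V \<Longrightarrow> p a < r" and D: "\<And>a. a \<in> V \<Longrightarrow> 0 < D a"
  shows "(\<Sum>a\<in>V. x a)\<^sup>2 \<le> char_sum V p D r *
    ((\<Sum>i<r. (\<Sum>a\<in>{a \<in> V. p a = i}. x a)\<^sup>2) + (\<Sum>a\<in>V. D a * (x a)\<^sup>2))"
proof -
  let ?t = "part_mass V p D"
  let ?S = "\<lambda>i. \<Sum>a\<in>{a \<in> V. p a = i}. x a"
  let ?Y = "\<lambda>i. \<Sum>a\<in>{a \<in> V. p a = i}. D a * (x a)\<^sup>2"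
  have t0: "0 \<le> ?t i" for i
    unfolding part_mass_def by (intro sum_nonneg) (use D in \<open>auto simp: less_imp_le\<close>)
  have Y0: "0 \<le> ?Y i" for i
    by (intro sum_nonneg) (use D in \<open>auto simp: less_imp_le\<close>)
  have SY: "(?S i)\<^sup>2 \<le> ?t i * ?Y i" for i
    unfolding part_mass_def
  proof (rule sum_power2_le_sum_times_sum)
    fix a assume "a \<in> {a \<in> V. p a = i}"
    then have "0 < D a" using D by auto
    then show "0 \<le> 1 / D a" "0 \<le> D a * (x a)\<^sup>2" "(x a)\<^sup>2 \<le> 1 / D a * (D a * (x a)\<^sup>2)" by auto
  qed
  have "(\<Sum>i<r. ?S i)\<^sup>2 \<le> (\<Sum>i<r. ?t i / (1 + ?t i)) * (\<Sum>i<r. (?S i)\<^sup>2 + ?Y i)"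
  proof (rule sum_power2_le_sum_times_sum)
    fix i
    show "0 \<le> ?t i / (1 + ?t i)" "0 \<le> (?S i)\<^sup>2 + ?Y i" using t0[of i] Y0[of i] by auto
    have "(1 + ?t i) * (?S i)\<^sup>2 \<le> ?t i * ((?S i)\<^sup>2 + ?Y i)"
      using SY[of i] by (simp add: algebra_simps)
    then show "(?S i)\<^sup>2 \<le> ?t i / (1 + ?t i) * ((?S i)\<^sup>2 + ?Y i)"
      using t0[of i] by (simp add: pos_le_divide_eq mult.commute)
  qed
  then show ?thesis
    by (simp add: char_sum_def sum.distrib sum_by_parts[where p = p, OF V])
qed

lemma char_sum_ge_1:
  assumes V: "finite V" "\<And>a. a \<in> V \<Longrightarrow> p a < r" and D: "\<And>a. a \<in> V \<Longrightarrow> 0 < D a"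
    and x: "v \<in> V" "x v \<noteq> 0"
    and W: "(\<Sum>a\<in>V. D a * (x a)\<^sup>2) \<le> edge_weight V (part_rel p) x"
  shows "1 \<le> char_sum V p D r"
proof -
  define s where "s = (\<Sum>i<r. (\<Sum>a\<in>{a \<in> V. p a = i}. x a)\<^sup>2)"
  define z where "z = (\<Sum>a\<in>V. D a * (x a)\<^sup>2)"
  have "0 < z"
    unfolding z_def by (rule sum_pos2[OF V(1) x(1)]) (use x D in \<open>auto simp: less_imp_le\<close>)
  moreover have "0 \<le> s" unfolding s_def by (intro sum_nonneg) auto
  ultimately have "0 < s + z" by simp
  moreover have "1 * (s + z) \<le> char_sum V p D r * (s + z)"
    using multipartite_weight_bound[where p = p and D = D and x = x, OF V D] W
      edge_weight_part_rel[where p = p and x = x, OF V] unfolding s_def z_def by simp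
  ultimately show ?thesis by (simp only: mult_le_cancel_right)
qed

lemma edge_weight_le_if_char_sum_eq_1:
  assumes V: "finite V" "\<And>a. a \<in> V \<Longrightarrow> p a < r" and D: "\<And>a. a \<in> V \<Longrightarrow> 0 < D a"
    and "char_sum V p D r = 1"
  shows "edge_weight V (part_rel p) x \<le> (\<Sum>a\<in>V. D a * (x a)\<^sup>2)"
  using multipartite_weight_bound[where p = p and D = D and x = x, OF V D] assms(4)
    edge_weight_part_rel[where p = p and x = x, OF V] by simp

lemma edge_weight_attained:
  assumes V: "finite V" "\<And>a. a \<in> V \<Longrightarrow> p a < r" and D: "\<And>a. a \<in> V \<Longrightarrow> 0 < D a"
    and F: "char_sum V p D r = 1"
  shows "\<exists>y. (\<forall>a\<in>V. 0 < y a) \<and> edge_weight V (part_rel p) y = (\<Sum>a\<in>V. D a * (y a)\<^sup>2)"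
proof -
  let ?t = "part_mass V p D"
  have t0: "0 \<le> ?t i" for i
    unfolding part_mass_def by (intro sum_nonneg) (use D in \<open>auto simp: less_imp_le\<close>)
  have t1: "1 + ?t i \<noteq> 0" "0 < 1 + ?t i" for i using t0[of i] by auto
  \<comment> \<open>The solution of \<open>D a * y a = S - S_i\<close> normalized by
    \<open>S = 1\<close>: the right-hand side is then
    \<open>1 - t / (1 + t) = 1 / (1 + t)\<close>.\<close>
  define y where "y a = 1 / (D a * (1 + ?t (p a)))" for a
  have S: "(\<Sum>a\<in>{a \<in> V. p a = i}. y a) = ?t i / (1 + ?t i)" for i
  proof -
    have "(\<Sum>a\<in>{a \<in> V. p a = i}. y a) = (\<Sum>a\<in>{a \<in> V. p a = i}. 1 / D a * (1 / (1 + ?t i)))"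
      by (intro sum.cong refl) (auto simp: y_def)
    also have "\<dots> = ?t i * (1 / (1 + ?t i))"
      by (simp only: part_mass_def sum_distrib_right)
    finally show ?thesis by simp
  qed
  have tot: "(\<Sum>a\<in>V. y a) = 1"
    using sum_by_parts[where p = p and f = y, OF V] F unfolding char_sum_def S by simp
  have "edge_weight V (part_rel p) y = 1 - (\<Sum>i<r. (?t i / (1 + ?t i))\<^sup>2)"
    using edge_weight_part_rel[where p = p and x = y, OF V] by (simp add: tot S)
  also have "\<dots> = (\<Sum>i<r. ?t i / (1 + ?t i) - (?t i / (1 + ?t i))\<^sup>2)"
    using F by (simp add: char_sum_def sum_subtractf)
  also have "\<dots> = (\<Sum>i<r. \<Sum>a\<in>{a \<in> V. p a = i}. D a * (y a)\<^sup>2)"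
  proof (rule sum.cong[OF refl])
    fix i
    have "?t i / (1 + ?t i) - (?t i / (1 + ?t i))\<^sup>2 = ?t i * (1 / (1 + ?t i)\<^sup>2)"
    proof -
      have e: "?t i / (1 + ?t i) = ?t i * (1 + ?t i) / (1 + ?t i)\<^sup>2"
        using t1[of i] by (simp add: power2_eq_square)
      have "?t i / (1 + ?t i) - (?t i / (1 + ?t i))\<^sup>2 =
          (?t i * (1 + ?t i) - (?t i)\<^sup>2) / (1 + ?t i)\<^sup>2"
        unfolding diff_divide_distrib using e power_divide[of "?t i" "1 + ?t i" 2] by linarith
      also have "?t i * (1 + ?t i) - (?t i)\<^sup>2 = ?t i" by (simp add: power2_eq_square algebra_simps)
      finally show ?thesis by simp
    qed
    also have "\<dots> = (\<Sum>a\<in>{a \<in> V. p a = i}. 1 / D a * (1 / (1 + ?t i)\<^sup>2))"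
      by (simp only: part_mass_def sum_distrib_right)
    also have "\<dots> = (\<Sum>a\<in>{a \<in> V. p a = i}. D a * (y a)\<^sup>2)"
    proof (rule sum.cong[OF refl])
      fix a assume "a \<in> {a \<in> V. p a = i}"
      then have "D a \<noteq> 0" "p a = i" using D by force+
      then show "1 / D a * (1 / (1 + ?t i)\<^sup>2) = D a * (y a)\<^sup>2"
        by (simp add: y_def power2_eq_square)
    qed
    finally show "?t i / (1 + ?t i) - (?t i / (1 + ?t i))\<^sup>2 = (\<Sum>a\<in>{a \<in> V. p a = i}. D a * (y a)\<^sup>2)" .
  qed
  also have "\<dots> = (\<Sum>a\<in>V. D a * (y a)\<^sup>2)" by (rule sum_by_parts[where p = p, OF V])
  finally show ?thesis
    using D t1 by (intro exI[of _ y]) (auto simp: y_def)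
qed

section \<open>Balanced partitions\<close>

text \<open>The function \<open>s / (lam + s)\<close> is replaced by its chord over
  \<open>[q, q + 1]\<close>. Being affine, the chord summed over \<open>r\<close> parts depends only
  on the total size \<open>k\<close>, not on the partition.\<close>

definition chord_bound :: "real \<Rightarrow> nat \<Rightarrow> nat \<Rightarrow> nat \<Rightarrow> real" where
  "chord_bound lam q r k = real r * (real q / (lam + real q)) +
    (real k - real r * real q) * (lam / ((lam + real q) * (lam + real q + 1)))"

text \<open>A marked vertex has diagonal weight \<open>lam + 1\<close>, and
  \<open>1 / (lam + 1) = (1 - 1 / (lam + 1)) / lam\<close>, so it counts as
  \<open>1 - 1 / (lam + 1)\<close> of a vertex. This is the resulting change in the term of a part
  of size \<open>q + 1\<close>.\<close>

definition mark_correction :: "real \<Rightarrow> nat \<Rightarrow> real" where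
  "mark_correction lam q =
    (real q + 1 - 1 / (lam + 1)) / (lam + (real q + 1 - 1 / (lam + 1))) - (real q + 1) / (lam + (real q + 1))"

abbreviation marked_weight :: "real \<Rightarrow> 'a set \<Rightarrow> 'a \<Rightarrow> real" where
  "marked_weight lam U \<equiv> \<lambda>a. lam + of_bool (a \<in> U)"

lemma chord_gap:
  fixes lam n q :: real
  assumes "lam + n \<noteq> 0" "lam + q \<noteq> 0" "lam + q + 1 \<noteq> 0"
  shows "q / (lam + q) + (n - q) * (lam / ((lam + q) * (lam + q + 1))) - n / (lam + n) =
    lam * ((n - q) * (n - q - 1)) / ((lam + q) * (lam + q + 1) * (lam + n))"
  using assms by (simp add: divide_simps) (simp add: algebra_simps)

text \<open>The gap is a positive multiple of \<open>(n - q) * (n - q - 1)\<close>, a product of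
  consecutive integers, which is never negative and vanishes only at \<open>q\<close> and
  \<open>q + 1\<close>. Strictly between these sizes the chord lies below the function, so
  integrality is essential.\<close>

lemma chord_inequality:
  assumes lam: "0 < lam"
  shows "real n / (lam + real n) \<le>
      real q / (lam + real q) + (real n - real q) * (lam / ((lam + real q) * (lam + real q + 1)))"
    and "real n / (lam + real n) =
      real q / (lam + real q) + (real n - real q) * (lam / ((lam + real q) * (lam + real q + 1)))
      \<longleftrightarrow> n = q \<or> n = q + 1"
proof -
  have pos: "0 < lam + real n" "0 < lam + real q" "0 < lam + real q + 1" using lam by auto
  have "0 \<le> (int n - int q) * (int n - int q - 1)"
    by (cases "int n \<le> int q") (auto simp: mult_nonpos_nonpos)
  then have "0 \<le> real_of_int ((int n - int q) * (int n - int q - 1))" by linarith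
  then have nn: "0 \<le> (real n - real q) * (real n - real q - 1)" by simp
  have gap: "real q / (lam + real q) + (real n - real q) * (lam / ((lam + real q) * (lam + real q + 1)))
      - real n / (lam + real n) = lam * ((real n - real q) * (real n - real q - 1)) /
      ((lam + real q) * (lam + real q + 1) * (lam + real n))"
    by (rule chord_gap) (use pos in auto)
  have "0 \<le> lam * ((real n - real q) * (real n - real q - 1)) /
      ((lam + real q) * (lam + real q + 1) * (lam + real n))"
    using pos by (intro divide_nonneg_pos mult_nonneg_nonneg[OF less_imp_le[OF lam] nn] mult_pos_pos)
  then show "real n / (lam + real n) \<le>
      real q / (lam + real q) + (real n - real q) * (lam / ((lam + real q) * (lam + real q + 1)))"
    using gap by linarith
  have "real n / (lam + real n) =
      real q / (lam + real q) + (real n - real q) * (lam / ((lam + real q) * (lam + real q + 1)))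
      \<longleftrightarrow> lam * ((real n - real q) * (real n - real q - 1)) /
      ((lam + real q) * (lam + real q + 1) * (lam + real n)) = 0"
    using gap by linarith
  also have "\<dots> \<longleftrightarrow> n = q \<or> n = q + 1"
    using lam pos by auto
  finally show "real n / (lam + real n) =
      real q / (lam + real q) + (real n - real q) * (lam / ((lam + real q) * (lam + real q + 1)))
      \<longleftrightarrow> n = q \<or> n = q + 1" .
qed

text \<open>
  Marking a vertex replaces the size \<open>n\<close> of its part by \<open>n - e\<close> with \<open>0 < e < 1\<close>. The slope of the
  chord over \<open>[q, q + 1]\<close> then lies strictly between those over \<open>[q - e, q + 1 - e]\<close> and
  \<open>[q + 1 - e, q + 2 - e]\<close>, which leaves \<open>n = q + 1\<close> as the only optimal size.
\<close>

lemma marked_chord_inequality: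
  fixes lam :: real and n q :: nat
  assumes lam: "0 < lam" and n: "1 \<le> n"
  defines "N \<equiv> real n - 1 / (lam + 1)"
  defines "R \<equiv> real q / (lam + real q) + (real n - real q) * (lam / ((lam + real q) * (lam + real q + 1)))
      + mark_correction lam q"
  shows "N / (lam + N) \<le> R" and "N / (lam + N) = R \<longleftrightarrow> n = q + 1"
proof -
  define e where "e = 1 / (lam + 1)"
  have e: "0 < e" "e < 1" using lam by (auto simp: e_def)
  define Q where "Q = real q + 1 - e"
  have N: "N = real n - e" by (simp add: N_def e_def)
  have pos: "0 < lam + N" "0 < lam + real q" "0 < lam + real q + 1" "0 < lam + Q"
    using lam n e by (auto simp: N Q_def)
  have mc: "mark_correction lam q = Q / (lam + Q) - (real q + 1) / (lam + real q + 1)"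
    by (simp add: mark_correction_def Q_def e_def add.assoc)
  have step: "real q / (lam + real q) + lam / ((lam + real q) * (lam + real q + 1)) =
      (real q + 1) / (lam + real q + 1)"
    using pos(2,3) by (simp add: divide_simps) (simp add: algebra_simps)
  define s where "s = lam / ((lam + real q) * (lam + real q + 1))"
  define t where "t = lam / ((lam + N) * (lam + Q))"
  have NQ: "N / (lam + N) - Q / (lam + Q) = (real n - real q - 1) * t"
    using pos(1,4) by (simp add: t_def divide_simps) (simp add: N Q_def algebra_simps)
  have R: "R = Q / (lam + Q) + (real n - real q - 1) * s"
    using step unfolding R_def mc s_def[symmetric] by (simp add: algebra_simps)
  have gap: "R - N / (lam + N) = (real n - real q - 1) * (s - t)"
    using NQ R by (simp add: algebra_simps)
  consider "n = q + 1" | "n \<ge> q + 2" | "n \<le> q" by linarith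
  then have "N / (lam + N) \<le> R \<and> (N / (lam + N) = R \<longleftrightarrow> n = q + 1)"
  proof cases
    case 1
    then show ?thesis using gap by simp
  next
    case 2
    have "(lam + real q) * (lam + real q + 1) < (lam + Q) * (lam + N)"
      by (rule mult_strict_mono) (use 2 e lam pos in \<open>auto simp: Q_def N\<close>)
    then have "t < s" unfolding s_def t_def using lam pos
      by (intro divide_strict_left_mono mult_pos_pos) (auto simp: mult.commute)
    then have "0 < (real n - real q - 1) * (s - t)" using 2 by (intro mult_pos_pos) auto
    then show ?thesis using gap 2 by auto
  next
    case 3
    have "(lam + N) * (lam + Q) < (lam + real q) * (lam + real q + 1)"
      by (rule mult_strict_mono) (use 3 e lam pos in \<open>auto simp: Q_def N\<close>)
    then have "s < t" unfolding s_def t_def using lam pos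
      by (intro divide_strict_left_mono mult_pos_pos) auto
    then have "0 < (real n - real q - 1) * (s - t)" using 3 by (intro mult_neg_neg) auto
    then show ?thesis using gap 3 by auto
  qed
  then show "N / (lam + N) \<le> R" "N / (lam + N) = R \<longleftrightarrow> n = q + 1" by auto
qed

text \<open>A part of size \<open>q + 1\<close> with a marked vertex still counts for more than
  \<open>q\<close> vertices, so marking costs less than removing a vertex. Because of this, the
  unmarked bound alone excludes sign sets with fewer than \<open>m\<close> vertices, even when
  \<open>lam\<close> solves the marked equation.\<close>

lemma mark_correction_lower:
  assumes "0 < lam"
  shows "- (lam / ((lam + real q) * (lam + real q + 1))) < mark_correction lam q"
proof -
  define Q where "Q = real q + 1 - 1 / (lam + 1)"
  have Q: "real q < Q" using assms by (simp add: Q_def)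
  have pos: "0 < lam + real q" "0 < lam + real q + 1" "0 < lam + Q" using Q assms by auto
  have step: "real q / (lam + real q) + lam / ((lam + real q) * (lam + real q + 1)) =
      (real q + 1) / (lam + real q + 1)"
    using pos(1,2) by (simp add: divide_simps) (simp add: algebra_simps)
  have "real q / (lam + real q) < Q / (lam + Q)"
    using Q pos assms by (simp add: divide_simps) (simp add: algebra_simps)
  then show ?thesis
    using step unfolding mark_correction_def Q_def[symmetric] by (simp add: add.assoc)
qed

lemma part_mass_marked:
  fixes p :: "'a \<Rightarrow> nat" and U V :: "'a set" and i :: nat and lam :: real
  assumes V: "finite V" and lam: "0 < lam" and U: "U = {} \<or> (\<exists>u\<in>V. U = {u})"
  defines "n \<equiv> card {a \<in> V. p a = i}"
  defines "N \<equiv> real n - (if \<exists>u\<in>U. p u = i then 1 / (lam + 1) else 0)"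
  shows "part_mass V p (marked_weight lam U) i / (1 + part_mass V p (marked_weight lam U) i) = N / (lam + N)"
proof -
  let ?t = "part_mass V p (marked_weight lam U) i"
  have t: "?t = N / lam"
  proof (cases "\<exists>u\<in>U. p u = i")
    case True
    then obtain u where u: "U = {u}" "u \<in> V" "p u = i" using U by auto
    have "?t = 1 / (lam + 1) + (\<Sum>a\<in>{a \<in> V. p a = i} - {u}. 1 / lam)"
      unfolding part_mass_def using u V
      by (subst sum.remove[of _ u]) (auto intro!: sum.cong)
    also have "(\<Sum>a\<in>{a \<in> V. p a = i} - {u}. 1 / lam) = (real n - 1) / lam"
    proof -
      have "u \<in> {a \<in> V. p a = i}" using u by simp
      then have "card ({a \<in> V. p a = i} - {u}) = n - 1" "n \<noteq> 0"
        using V by (auto simp: n_def)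
      then show ?thesis by (simp add: of_nat_diff)
    qed
    finally show ?thesis
      using u lam by (simp add: N_def divide_simps) (simp add: algebra_simps)
  next
    case False
    then have "?t = (\<Sum>a\<in>{a \<in> V. p a = i}. 1 / lam)"
      unfolding part_mass_def by (intro sum.cong refl) auto
    then show ?thesis using False by (simp add: N_def n_def)
  qed
  have "0 \<le> ?t" unfolding part_mass_def using lam by (intro sum_nonneg) auto
  then show ?thesis using lam unfolding t by (simp add: divide_simps add.commute)
qed

text \<open>The chord inequalities are summed over the parts. Their right-hand sides add up to a
  number independent of the partition, and as all of them point the same way, equality of the sums
  means equality in each part.\<close>

lemma char_sum_chord:
  fixes p :: "'a \<Rightarrow> nat" and U V :: "'a set" and lam :: real and q r :: nat
  assumes V: "finite V" "\<And>a. a \<in> V \<Longrightarrow> p a < r" and lam: "0 < lam"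
    and U: "U = {} \<or> (\<exists>u\<in>V. U = {u})"
  defines "n \<equiv> \<lambda>i. card {a \<in> V. p a = i}"
  defines "bound \<equiv> chord_bound lam q r (card V) + of_bool (U \<noteq> {}) * mark_correction lam q"
  shows "char_sum V p (marked_weight lam U) r \<le> bound"
    and "char_sum V p (marked_weight lam U) r = bound \<longleftrightarrow>
      (\<forall>i<r. n i = q \<or> n i = q + 1) \<and> (\<forall>u\<in>U. n (p u) = q + 1)"
proof -
  define F where "F i = part_mass V p (marked_weight lam U) i / (1 + part_mass V p (marked_weight lam U) i)" for i
  define B where "B i = real q / (lam + real q) +
    (real (n i) - real q) * (lam / ((lam + real q) * (lam + real q + 1))) +
    of_bool (\<exists>u\<in>U. p u = i) * mark_correction lam q" for i
  define C where "C i \<longleftrightarrow> (if \<exists>u\<in>U. p u = i then n i = q + 1 else n i = q \<or> n i = q + 1)" for i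
  have FB: "F i \<le> B i \<and> (F i = B i \<longleftrightarrow> C i)" for i
  proof (cases "\<exists>u\<in>U. p u = i")
    case True
    then obtain u where "u \<in> V" "p u = i" using U by auto
    then have "0 < card {a \<in> V. p a = i}" using V(1) by (auto simp: card_gt_0_iff)
    then have "1 \<le> n i" by (simp add: n_def)
    moreover have "F i = (real (n i) - 1 / (lam + 1)) / (lam + (real (n i) - 1 / (lam + 1)))"
      unfolding F_def n_def part_mass_marked[OF V(1) lam U] using True by simp
    ultimately show ?thesis
      using marked_chord_inequality[OF lam, of "n i" q] True by (simp add: B_def C_def)
  next
    case False
    then have "F i = real (n i) / (lam + real (n i))"
      unfolding F_def n_def part_mass_marked[OF V(1) lam U] by simp
    then show ?thesis
      using chord_inequality[OF lam, of "n i" q] False by (simp add: B_def C_def)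
  qed
  have "(\<Sum>i<r. real (n i)) = (\<Sum>a\<in>V. 1)"
    using sum_by_parts[where p = p and f = "\<lambda>_. 1", OF V] by (simp add: n_def)
  then have nV: "(\<Sum>i<r. real (n i)) = real (card V)" by simp
  have mark: "(\<Sum>i<r. of_bool (\<exists>u\<in>U. p u = i)) = (of_bool (U \<noteq> {}) :: real)"
  proof (cases "U = {}")
    case False
    then obtain u where u: "U = {u}" "p u < r" using U V by auto
    then have "{..<r} \<inter> {i. p u = i} = {p u}" by auto
    then show ?thesis using u by simp
  qed simp
  have "(\<Sum>i<r. B i) = bound"
    unfolding B_def sum.distrib bound_def chord_bound_def sum_distrib_right[symmetric] mark
    by (simp add: nV sum_subtractf)
  moreover have "char_sum V p (marked_weight lam U) r = (\<Sum>i<r. F i)"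
    by (simp add: char_sum_def F_def)
  ultimately have gap: "bound - char_sum V p (marked_weight lam U) r = (\<Sum>i<r. B i - F i)"
    by (simp add: sum_subtractf)
  have "0 \<le> (\<Sum>i<r. B i - F i)" using FB by (intro sum_nonneg) auto
  then show "char_sum V p (marked_weight lam U) r \<le> bound" using gap by simp
  have "char_sum V p (marked_weight lam U) r = bound \<longleftrightarrow> (\<Sum>i<r. B i - F i) = 0"
    using gap by linarith
  also have "\<dots> \<longleftrightarrow> (\<forall>i<r. B i - F i = 0)"
    using FB by (subst sum_nonneg_eq_0_iff) auto
  also have "\<dots> \<longleftrightarrow> (\<forall>i<r. C i)"
  proof -
    have "B i - F i = 0 \<longleftrightarrow> C i" for i using FB[of i] by (auto simp: eq_commute[of "B i"])
    then show ?thesis by simp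
  qed
  also have "\<dots> \<longleftrightarrow> (\<forall>i<r. n i = q \<or> n i = q + 1) \<and> (\<forall>u\<in>U. n (p u) = q + 1)"
    using U
  proof
    assume "U = {}"
    then show ?thesis by (simp add: C_def)
  next
    assume "\<exists>u\<in>V. U = {u}"
    then obtain u where u: "U = {u}" "p u < r" using V(2) by auto
    show ?thesis
    proof
      assume C: "\<forall>i<r. C i"
      have "n (p u) = q + 1" using C u by (auto simp: C_def)
      moreover have "n i = q \<or> n i = q + 1" if "i < r" for i
        using C that unfolding C_def by meson
      ultimately show "(\<forall>i<r. n i = q \<or> n i = q + 1) \<and> (\<forall>u\<in>U. n (p u) = q + 1)"
        using u by simp
    next
      assume "(\<forall>i<r. n i = q \<or> n i = q + 1) \<and> (\<forall>u\<in>U. n (p u) = q + 1)"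
      then show "\<forall>i<r. C i" using u by (simp add: C_def)
    qed
  qed
  finally show "char_sum V p (marked_weight lam U) r = bound \<longleftrightarrow>
      (\<forall>i<r. n i = q \<or> n i = q + 1) \<and> (\<forall>u\<in>U. n (p u) = q + 1)" .
qed

definition balanced_partition :: "'a set \<Rightarrow> ('a \<times> 'a) set \<Rightarrow> nat \<Rightarrow> nat \<Rightarrow> ('a \<Rightarrow> nat) \<Rightarrow> bool" where
  "balanced_partition V E q r p \<longleftrightarrow> (\<forall>a\<in>V. p a < r) \<and>
    (\<forall>i<r. card {a \<in> V. p a = i} = q \<or> card {a \<in> V. p a = i} = q + 1) \<and>
    (\<forall>a\<in>V. \<forall>b\<in>V. (a, b) \<in> E \<longleftrightarrow> p a \<noteq> p b)"

text \<open>Phrased as a constraint on the size of \<open>V\<close>: if the form reaches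
  \<open>lam\<close>, the bound cannot drop below 1. Symmetrization and the chords enclose
  \<open>char_sum\<close> between 1 and \<open>bound\<close>; if \<open>bound = 1\<close>, both
  steps are tight, which recovers the arcs and the part sizes.\<close>

lemma weighted_turan:
  fixes x :: "'a \<Rightarrow> real" and U V :: "'a set" and lam :: real and q r :: nat
  assumes V: "finite V" "V \<noteq> {}" and x: "\<And>a. a \<in> V \<Longrightarrow> 0 < x a" and E: "sym E" "irrefl E"
    and clique: "\<And>K. K \<subseteq> V \<Longrightarrow> card K = Suc r \<Longrightarrow> \<exists>a\<in>K. \<exists>b\<in>K. a \<noteq> b \<and> (a, b) \<notin> E"
    and lam: "0 < lam" and U: "U = {} \<or> (\<exists>u\<in>V. U = {u})"
    and W: "lam * (\<Sum>a\<in>V. (x a)\<^sup>2) + (\<Sum>a\<in>U. (x a)\<^sup>2) \<le> edge_weight V E x"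
  defines "bound \<equiv> chord_bound lam q r (card V) + of_bool (U \<noteq> {}) * mark_correction lam q"
  shows "1 \<le> bound"
    and "bound = 1 \<Longrightarrow> edge_weight V E x = lam * (\<Sum>a\<in>V. (x a)\<^sup>2) + (\<Sum>a\<in>U. (x a)\<^sup>2) \<and>
      (\<exists>p. balanced_partition V E q r p \<and> (\<forall>u\<in>U. card {a \<in> V. p a = p u} = q + 1))"
proof -
  obtain p where p: "\<And>a. a \<in> V \<Longrightarrow> p a < r" "edge_weight V E x \<le> edge_weight V (part_rel p) x"
    "edge_weight V E x = edge_weight V (part_rel p) x \<Longrightarrow> \<forall>a\<in>V. \<forall>b\<in>V. (a, b) \<in> E \<longleftrightarrow> p a \<noteq> p b"
  proof -
    have "\<exists>p. (\<forall>a\<in>V. p a < r) \<and> edge_weight V E x \<le> edge_weight V (part_rel p) x \<and>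
      (edge_weight V E x = edge_weight V (part_rel p) x \<longrightarrow>
        (\<forall>a\<in>V. \<forall>b\<in>V. (a, b) \<in> E \<longleftrightarrow> p a \<noteq> p b))"
      by (intro zykov_symmetrization V(1) x E clique)
    then show thesis using that by blast
  qed
  have "(\<Sum>a\<in>V. marked_weight lam U a * (x a)\<^sup>2) =
      lam * (\<Sum>a\<in>V. (x a)\<^sup>2) + (\<Sum>a\<in>V \<inter> U. (x a)\<^sup>2)"
    unfolding distrib_right sum.distrib sum_distrib_left using V(1) by simp
  moreover have "V \<inter> U = U" using U by auto
  ultimately have D: "(\<Sum>a\<in>V. marked_weight lam U a * (x a)\<^sup>2) =
      lam * (\<Sum>a\<in>V. (x a)\<^sup>2) + (\<Sum>a\<in>U. (x a)\<^sup>2)" by simp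
  have Dpos: "0 < marked_weight lam U a" if "a \<in> V" for a using lam by simp
  obtain v where v: "v \<in> V" using V by auto
  have xv: "x v \<noteq> 0" using x[OF v] by simp
  have ge: "1 \<le> char_sum V p (marked_weight lam U) r"
  proof (rule char_sum_ge_1[where x = x and p = p and V = V and v = v])
    show "(\<Sum>a\<in>V. marked_weight lam U a * (x a)\<^sup>2) \<le> edge_weight V (part_rel p) x"
      using W p(2) D by linarith
  qed (use V p(1) Dpos v xv in auto)
  note le = char_sum_chord[where p = p and q = q and V = V and r = r, OF V(1) p(1) lam U]
  show "1 \<le> bound" using ge le(1) by (simp add: bound_def)
  assume "bound = 1"
  then have eq: "char_sum V p (marked_weight lam U) r = 1"
    "char_sum V p (marked_weight lam U) r = bound"
    using ge le(1) by (auto simp: bound_def)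
  have "edge_weight V (part_rel p) x \<le> (\<Sum>a\<in>V. marked_weight lam U a * (x a)\<^sup>2)"
    by (rule edge_weight_le_if_char_sum_eq_1[where r = r]) (use V p(1) Dpos eq(1) in auto)
  then have "edge_weight V E x = edge_weight V (part_rel p) x"
    "edge_weight V E x = lam * (\<Sum>a\<in>V. (x a)\<^sup>2) + (\<Sum>a\<in>U. (x a)\<^sup>2)"
    using W p(2) D by linarith+
  then show "edge_weight V E x = lam * (\<Sum>a\<in>V. (x a)\<^sup>2) + (\<Sum>a\<in>U. (x a)\<^sup>2) \<and>
      (\<exists>p. balanced_partition V E q r p \<and> (\<forall>u\<in>U. card {a \<in> V. p a = p u} = q + 1))"
    using p(1) p(3) le(2)[folded bound_def] eq(2)
    by (intro conjI exI[of _ p]) (simp_all add: balanced_partition_def)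
qed

text \<open>Intermediate value theorem. At \<open>lam = 1\<close> an unmarked vertex gives each part
  mass at least 1, so there are \<open>r \<ge> 2\<close> terms of at least 1/2. At
  \<open>lam = card V\<close> all masses together are at most 1.\<close>

lemma char_sum_root:
  assumes V: "finite V" "\<And>a. a \<in> V \<Longrightarrow> p a < r" and r: "2 \<le> r"
    and unmarked: "\<And>i. i < r \<Longrightarrow> \<exists>a\<in>V - U. p a = i"
  shows "\<exists>lam>0. char_sum V p (marked_weight lam U) r = 1"
proof -
  let ?f = "\<lambda>lam. char_sum V p (marked_weight lam U) r"
  have t0: "0 \<le> part_mass V p (marked_weight lam U) i" if "0 < lam" for lam i
    unfolding part_mass_def using that by (intro sum_nonneg) auto
  have "V \<noteq> {}" using unmarked[of 0] r by auto
  then have cV: "1 \<le> real (card V)" using V(1) by (simp add: Suc_le_eq card_gt_0_iff)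
  have "?f (real (card V)) \<le> (\<Sum>i<r. part_mass V p (marked_weight (real (card V)) U) i)"
    unfolding char_sum_def
  proof (rule sum_mono)
    fix i
    have "0 \<le> part_mass V p (marked_weight (real (card V)) U) i" using t0 cV by simp
    then show "part_mass V p (marked_weight (real (card V)) U) i /
        (1 + part_mass V p (marked_weight (real (card V)) U) i)
      \<le> part_mass V p (marked_weight (real (card V)) U) i"
      by (simp add: divide_le_eq distrib_left)
  qed
  also have "\<dots> = (\<Sum>a\<in>V. 1 / marked_weight (real (card V)) U a)"
    unfolding part_mass_def by (rule sum_by_parts[where p = p, OF V])
  also have "\<dots> \<le> (\<Sum>a\<in>V. 1 / real (card V))"
    using cV by (intro sum_mono divide_left_mono) auto
  also have "\<dots> = 1" using cV by simp
  finally have 1: "?f (real (card V)) \<le> 1" .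
  have "1 \<le> real r * (1 / 2)" using r by simp
  also have "\<dots> = (\<Sum>i<r. 1 / 2)" by simp
  also have "\<dots> \<le> ?f 1"
    unfolding char_sum_def
  proof (rule sum_mono)
    fix i assume "i \<in> {..<r}"
    then obtain a where a: "a \<in> V" "a \<notin> U" "p a = i" using unmarked by auto
    have "1 / marked_weight 1 U a \<le> part_mass V p (marked_weight 1 U) i"
      unfolding part_mass_def
      by (rule member_le_sum) (use a V in auto)
    then have "1 \<le> part_mass V p (marked_weight 1 U) i" using a by simp
    then show "1 / 2 \<le> part_mass V p (marked_weight 1 U) i / (1 + part_mass V p (marked_weight 1 U) i)"
      by (simp add: divide_simps)
  qed
  finally have 2: "1 \<le> ?f 1" .
  have "continuous_on {1..real (card V)} (\<lambda>lam. part_mass V p (marked_weight lam U) i)" for i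
    unfolding part_mass_def
    by (intro continuous_on_sum continuous_on_divide continuous_on_add continuous_on_const
        continuous_on_id) auto
  moreover have "1 + part_mass V p (marked_weight lam U) i \<noteq> 0" if "lam \<in> {1..real (card V)}" for lam i
    using t0[of lam i] that by auto
  ultimately have "continuous_on {1..real (card V)} ?f"
    unfolding char_sum_def
    by (intro continuous_on_sum continuous_on_divide continuous_on_add continuous_on_const) auto
  then have "\<exists>lam\<ge>1. lam \<le> real (card V) \<and> ?f lam = 1"
    using 1 2 cV by (intro IVT2') auto
  then obtain lam where "1 \<le> lam" "?f lam = 1" by auto
  then show ?thesis by (intro exI[of _ lam]) simp
qed

section \<open>Uniqueness of balanced complete multipartite graphs with a marked vertex\<close>

lemma finite_bij_betw_pointed:
  assumes "finite A" "finite B" "card A = card B" "a \<in> A" "b \<in> B"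
  shows "\<exists>f. bij_betw f A B \<and> f a = b"
proof -
  have "card (A - {a}) = card (B - {b})" using assms by simp
  then obtain g where g: "bij_betw g (A - {a}) (B - {b})"
    using finite_same_card_bij[of "A - {a}" "B - {b}"] assms by auto
  have "bij_betw (g(a := b)) (insert a (A - {a})) (insert b (B - {b}))"
    using g by (auto simp: bij_betw_def inj_on_def)
  then have "bij_betw (g(a := b)) A B" using assms by (simp add: insert_absorb)
  then show ?thesis by (intro exI[of _ "g(a := b)"]) simp
qed

text \<open>The total size determines how many parts have size \<open>q + 1\<close>. Hence large
  parts can be matched with large ones and small with small, the part of \<open>u\<close> going to
  that of \<open>u'\<close>, and matched parts are mapped bijectively.\<close>

lemma balanced_partitions_isomorphic:
  fixes p :: "'a \<Rightarrow> nat" and p' :: "'b \<Rightarrow> nat"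
  assumes V: "finite V" "\<And>a. a \<in> V \<Longrightarrow> p a < r" and V': "finite V'" "\<And>a. a \<in> V' \<Longrightarrow> p' a < r"
    and card: "card V = card V'"
    and sz: "\<And>i. i < r \<Longrightarrow> card {a \<in> V. p a = i} = q \<or> card {a \<in> V. p a = i} = q + 1"
    and sz': "\<And>i. i < r \<Longrightarrow> card {a \<in> V'. p' a = i} = q \<or> card {a \<in> V'. p' a = i} = q + 1"
    and u: "u \<in> V" "card {a \<in> V. p a = p u} = q + 1"
    and u': "u' \<in> V'" "card {a \<in> V'. p' a = p' u'} = q + 1"
  shows "\<exists>f. bij_betw f V V' \<and> f u = u' \<and> (\<forall>a\<in>V. \<forall>b\<in>V. p a = p b \<longleftrightarrow> p' (f a) = p' (f b))"
proof -
  define A where "A = {i \<in> {..<r}. card {a \<in> V. p a = i} = q + 1}"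
  define A' where "A' = {i \<in> {..<r}. card {a \<in> V'. p' a = i} = q + 1}"
  have count: "real (card X) = real r * real q + real (card {i \<in> {..<r}. card {a \<in> X. f a = i} = q + 1})"
    if "finite X" "\<And>a. a \<in> X \<Longrightarrow> f a < r"
      "\<And>i. i < r \<Longrightarrow> card {a \<in> X. f a = i} = q \<or> card {a \<in> X. f a = i} = q + 1"
    for X :: "'c set" and f
  proof -
    have "real (card X) = (\<Sum>i<r. real (card {a \<in> X. f a = i}))"
      using sum_by_parts[where p = f and f = "\<lambda>_. 1", OF that(1,2)] by simp
    also have "\<dots> = (\<Sum>i<r. real q + of_bool (card {a \<in> X. f a = i} = q + 1))"
      by (rule sum.cong[OF refl]) (use that(3) in force)
    also have "\<dots> = real r * real q + real (card ({..<r} \<inter> {i. card {a \<in> X. f a = i} = q + 1}))"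
      by (simp add: sum.distrib)
    also have "{..<r} \<inter> {i. card {a \<in> X. f a = i} = q + 1} =
        {i \<in> {..<r}. card {a \<in> X. f a = i} = q + 1}" by auto
    finally show ?thesis .
  qed
  have "card A = card A'"
    using count[OF V sz] count[OF V' sz'] card by (simp add: A_def A'_def)
  then obtain s1 where s1: "bij_betw s1 A A'" "s1 (p u) = p' u'"
    using finite_bij_betw_pointed[of A A' "p u" "p' u'"] u u' V V' by (auto simp: A_def A'_def)
  have "card ({..<r} - A) = card ({..<r} - A')"
    using \<open>card A = card A'\<close> by (subst (1 2) card_Diff_subset) (auto simp: A_def A'_def)
  then obtain s2 where s2: "bij_betw s2 ({..<r} - A) ({..<r} - A')"
    using finite_same_card_bij[of "{..<r} - A" "{..<r} - A'"] by auto
  define s where "s i = (if i \<in> A then s1 i else s2 i)" for i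
  have "bij_betw s (A \<union> ({..<r} - A)) (A' \<union> ({..<r} - A'))"
    unfolding s_def by (rule bij_betw_disjoint_Un[OF s1(1) s2]) auto
  moreover have "A \<union> ({..<r} - A) = {..<r}" "A' \<union> ({..<r} - A') = {..<r}"
    by (auto simp: A_def A'_def)
  ultimately have s: "bij_betw s {..<r} {..<r}" by simp
  have su: "s (p u) = p' u'" using s1 u V by (simp add: s_def A_def)
  have "\<exists>f. bij_betw f {a \<in> V. p a = i} {a \<in> V'. p' a = s i} \<and> (i = p u \<longrightarrow> f u = u')"
    if i: "i < r" for i
  proof -
    have eq: "card {a \<in> V. p a = i} = card {a \<in> V'. p' a = s i}"
    proof (cases "i \<in> A")
      case True
      then have "s i \<in> A'" using s1 by (auto simp: s_def bij_betw_def)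
      then show ?thesis using True by (simp add: A_def A'_def)
    next
      case False
      then have "s i \<in> {..<r} - A'" using s2 i by (auto simp: s_def bij_betw_def)
      then show ?thesis using False i sz sz' by (auto simp: A_def A'_def)
    qed
    show ?thesis
    proof (cases "i = p u")
      case True
      then show ?thesis
        using finite_bij_betw_pointed[of "{a \<in> V. p a = i}" "{a \<in> V'. p' a = s i}" u u'] eq V V' u u' su
        by auto
    next
      case False
      then show ?thesis
        using finite_same_card_bij[of "{a \<in> V. p a = i}" "{a \<in> V'. p' a = s i}"] eq V V' by auto
    qed
  qed
  then obtain F where F: "\<And>i. i < r \<Longrightarrow> bij_betw (F i) {a \<in> V. p a = i} {a \<in> V'. p' a = s i}"
    "\<And>i. i < r \<Longrightarrow> i = p u \<Longrightarrow> F i u = u'" by metis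
  define f where "f a = F (p a) a" for a
  have fa: "f a \<in> V'" "p' (f a) = s (p a)" if "a \<in> V" for a
    using F(1)[OF V(2)[OF that]] that by (auto simp: f_def bij_betw_def)
  have rel: "p a = p b \<longleftrightarrow> p' (f a) = p' (f b)" if "a \<in> V" "b \<in> V" for a b
    using s V(2) that by (auto simp: fa bij_betw_def inj_on_def)
  have inj: "inj_on f V"
  proof (rule inj_onI)
    fix a b assume ab: "a \<in> V" "b \<in> V" "f a = f b"
    then have "p a = p b" using rel by simp
    then show "a = b" using F(1)[OF V(2)[OF ab(1)]] ab by (auto simp: f_def bij_betw_def inj_on_def)
  qed
  moreover have "f ` V = V'"
    using fa V'(1) card inj by (intro card_subset_eq) (auto simp: card_image)
  ultimately have "bij_betw f V V'" by (simp add: bij_betw_def)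
  moreover have "f u = u'" using F(2) V u by (simp add: f_def)
  ultimately show ?thesis using rel by blast
qed

section \<open>Isomorphism, connectedness and eigenvalue bounds\<close>

lemma pair_graph_arcs:
  assumes "pair_graph G"
  shows "finite (pverts G)" "parcs G \<subseteq> pverts G \<times> pverts G" "sym (parcs G)" "irrefl (parcs G)"
proof -
  interpret pair_graph G by fact
  show "finite (pverts G)" by (rule pair_finite_verts)
  show "parcs G \<subseteq> pverts G \<times> pverts G" using in_arcsD1 in_arcsD2 by auto
  show "sym (parcs G)" using pair_sym_arcs by (simp add: symmetric_def)
  show "irrefl (parcs G)" using pair_no_loops by (force simp: irrefl_def)
qed

lemma pair_graphI:
  assumes "finite (pverts G)" "parcs G \<subseteq> pverts G \<times> pverts G" "sym (parcs G)" "irrefl (parcs G)"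
  shows "pair_graph G"
proof unfold_locales
  show "finite (parcs G)" using assms(1,2) finite_subset by blast
  show "symmetric (with_proj G)" using assms(3) by (simp add: symmetric_def)
qed (use assms in \<open>auto simp: irrefl_def\<close>)

lemma isomorphicI:
  assumes G: "pair_graph G" and H: "pair_graph H" and f: "bij_betw f (pverts G) (pverts H)"
    and arcs: "\<And>a b. a \<in> pverts G \<Longrightarrow> b \<in> pverts G \<Longrightarrow> (a, b) \<in> parcs G \<longleftrightarrow> (f a, f b) \<in> parcs H"
  shows "isomorphic G H"
proof -
  interpret pair_graph G by fact
  define hom where "hom = \<lparr>iso_verts = f, iso_arcs = map_prod f f, iso_head = snd, iso_tail = fst\<rparr>"
  note arcsG = pair_graph_arcs(2)[OF G] and arcsH = pair_graph_arcs(2)[OF H]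
  have inj: "inj_on f (pverts G)" and im: "f ` pverts G = pverts H"
    using f by (auto simp: bij_betw_def)
  have "inj_on (map_prod f f) (parcs G)"
    using map_prod_inj_on[OF inj inj] arcsG by (rule inj_on_subset)
  then have 1: "pre_digraph.digraph_isomorphism (with_proj G) hom"
    using inj wf_digraph_axioms
    by (auto simp: pre_digraph.digraph_isomorphism_def hom_def)
  have "map_prod f f ` parcs G = parcs H"
  proof
    show "map_prod f f ` parcs G \<subseteq> parcs H" using arcs arcsG by auto
    show "parcs H \<subseteq> map_prod f f ` parcs G"
    proof
      fix e assume e: "e \<in> parcs H"
      then have "e \<in> (f ` pverts G) \<times> (f ` pverts G)" using arcsH im by auto
      then obtain a b where "e = (f a, f b)" "a \<in> pverts G" "b \<in> pverts G" by auto
      then show "e \<in> map_prod f f ` parcs G" using e arcs by force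
    qed
  qed
  then have 2: "with_proj H = app_iso hom (with_proj G)"
    using im by (simp add: app_iso_def with_proj_def hom_def)
  show ?thesis unfolding digraph_iso_def using 1 2 by blast
qed

lemma isomorphicE:
  assumes G: "pair_graph G" and iso: "isomorphic G H"
  obtains f where "bij_betw f (pverts G) (pverts H)" "parcs H = map_prod f f ` parcs G"
    "\<And>a b. a \<in> pverts G \<Longrightarrow> b \<in> pverts G \<Longrightarrow> (a, b) \<in> parcs G \<longleftrightarrow> (f a, f b) \<in> parcs H"
proof -
  obtain hom where hom: "pre_digraph.digraph_isomorphism (with_proj G) hom"
    "with_proj H = app_iso hom (with_proj G)"
    using iso unfolding digraph_iso_def by blast
  define f where "f = iso_verts hom"
  have eqs: "pverts H = f ` pverts G" "parcs H = iso_arcs hom ` parcs G" "iso_tail hom = fst" "iso_head hom = snd"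
    using hom(2) by (auto simp: app_iso_def with_proj_def f_def)
  have inj: "inj_on f (pverts G)"
    using hom(1) by (auto simp: pre_digraph.digraph_isomorphism_def f_def)
  have "iso_arcs hom e = map_prod f f e" if "e \<in> parcs G" for e
    using hom(1) that eqs unfolding pre_digraph.digraph_isomorphism_def
    by (cases e) (auto simp: f_def intro: prod_eqI)
  then have arcs: "parcs H = map_prod f f ` parcs G" using eqs by auto
  show thesis
  proof (rule that[of f])
    show "bij_betw f (pverts G) (pverts H)" using inj eqs by (simp add: bij_betw_def)
    show "parcs H = map_prod f f ` parcs G" by fact
    fix a b assume ab: "a \<in> pverts G" "b \<in> pverts G"
    show "(a, b) \<in> parcs G \<longleftrightarrow> (f a, f b) \<in> parcs H"
    proof
      assume "(a, b) \<in> parcs G"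
      then have "map_prod f f (a, b) \<in> map_prod f f ` parcs G" by (rule imageI)
      then show "(f a, f b) \<in> parcs H" by (simp add: arcs)
    next
      assume "(f a, f b) \<in> parcs H"
      then obtain c d where "(c, d) \<in> parcs G" "f c = f a" "f d = f b" unfolding arcs by auto
      moreover have "c = a" "d = b"
        using calculation ab pair_graph_arcs(2)[OF G] inj_onD[OF inj] by auto
      ultimately show "(a, b) \<in> parcs G" by simp
    qed
  qed
qed

lemma graph_eigenvalue_isomorphic:
  assumes G: "pair_graph G" and iso: "isomorphic G H"
  shows "graph_eigenvalue k G = graph_eigenvalue k H"
proof -
  obtain f where f: "bij_betw f (pverts G) (pverts H)"
    and arcs: "\<And>a b. a \<in> pverts G \<Longrightarrow> b \<in> pverts G \<Longrightarrow> (a, b) \<in> parcs G \<longleftrightarrow> (f a, f b) \<in> parcs H"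
    using isomorphicE[OF G iso] by metis
  have enum: "adjacency_char_poly K = char_poly (adjacency_mat vs K)"
    if "distinct vs" "set vs = pverts K" for K :: "'c pair_pre_digraph" and vs
  proof -
    have "\<exists>vs. distinct vs \<and> set vs = pverts K" using that by blast
    then have "distinct (SOME vs. distinct vs \<and> set vs = pverts K) \<and>
        set (SOME vs. distinct vs \<and> set vs = pverts K) = pverts K" by (rule someI_ex)
    then show ?thesis
      unfolding adjacency_char_poly_def using that by (intro char_poly_adjacency_mat_enum) auto
  qed
  obtain vs where vs: "distinct vs" "set vs = pverts G"
    using finite_distinct_list[OF pair_graph_arcs(1)[OF G]] by blast
  have ws: "distinct (map f vs)" "set (map f vs) = pverts H"
    using vs f by (auto simp: distinct_map bij_betw_def)
  have "vs ! i \<in> pverts G" if "i < length vs" for i using that vs(2) nth_mem by blast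
  then have "adjacency_mat vs G = adjacency_mat (map f vs) H"
    by (intro eq_matI) (simp_all add: adjacency_mat_def arcs)
  then have "adjacency_char_poly G = adjacency_char_poly H"
    using enum[OF vs] enum[OF ws] by simp
  then show ?thesis by (simp add: graph_eigenvalue_def eigenvalue_list_def)
qed

lemma connected_crossing_arc:
  assumes conn: "Digraph_Component.connected (with_proj G)" and sym: "sym (parcs G)"
    and S: "S \<subseteq> pverts G" "S \<noteq> {}" "S \<noteq> pverts G"
  shows "\<exists>a\<in>S. \<exists>b\<in>pverts G - S. (a, b) \<in> parcs G"
proof (rule ccontr)
  assume no: "\<not> ?thesis"
  obtain u v where uv: "u \<in> S" "v \<in> pverts G - S" using S by auto
  have scl: "symcl (parcs G) = parcs G" using sym by (auto simp: symcl_def dest: symD)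
  have "(u, v) \<in> rtrancl_on (pverts G) (parcs G)"
    using conn uv S unfolding connected_conv by (auto simp: scl)
  then have "v \<in> S"
  proof (induction rule: rtrancl_on_induct)
    case (step y z)
    then show ?case using no by blast
  qed (use uv in simp)
  then show False using uv by simp
qed

lemma clique_freeD:
  assumes "clique_free k G" and G: "pair_graph G" and K: "K \<subseteq> pverts G" "card K = k"
  shows "\<exists>a\<in>K. \<exists>b\<in>K. a \<noteq> b \<and> (a, b) \<notin> parcs G"
proof (rule ccontr)
  assume no: "\<not> ?thesis"
  interpret pair_graph G by fact
  define H where "H = \<lparr>pverts = K, parcs = {(u, v). (u, v) \<in> K \<times> K \<and> u \<noteq> v}\<rparr>"
  have fin: "finite K" using K pair_finite_verts finite_subset by blast
  have compl: "complete_digraph k (with_proj H)"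
    unfolding complete_digraph_pair_def using K fin by (simp add: H_def)
  then have "wf_digraph (with_proj H)"
    unfolding complete_digraph_def by (auto simp: graph_def digraph_def fin_digraph_def)
  then have "subgraph (with_proj H) (with_proj G)"
    unfolding subgraph_def using K no wf_digraph_axioms compatibleI_with_proj by (auto simp: H_def)
  with compl have "\<exists>H. subgraph H (with_proj G) \<and> complete_digraph k H" by (intro exI conjI)
  then show False using assms(1) by (simp add: clique_free_def)
qed

section \<open>Variational bounds for the two largest eigenvalues\<close>

lemma rho_lower_bound:
  assumes G: "pair_graph G" and pos: "0 < (\<Sum>a\<in>pverts G. (x a)\<^sup>2)"
    and Q: "t * (\<Sum>a\<in>pverts G. (x a)\<^sup>2) \<le> edge_weight (pverts G) (parcs G) x"
  shows "t \<le> rho G"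
proof -
  obtain \<phi> where phi: "spectral_basis G \<phi>"
    using spectral_basis_exists[OF G] by blast
  note norm = spectral_basisD(3)[OF phi] and qf = spectral_basisD(4)[OF phi]
    and ord = spectral_basisD(5)[OF phi]
  have "edge_weight (pverts G) (parcs G) x \<le>
      (\<Sum>i<card (pverts G). rho G * (\<Sum>a\<in>pverts G. \<phi> i a * x a)\<^sup>2)"
    unfolding qf by (intro sum_mono mult_right_mono) (use ord[of 0] in auto)
  also have "\<dots> = rho G * (\<Sum>a\<in>pverts G. (x a)\<^sup>2)"
    unfolding norm by (simp add: sum_distrib_left)
  finally show ?thesis using Q pos by (meson mult_le_cancel_right_pos order_trans)
qed

lemma rho_attained:
  assumes G: "pair_graph G" and ne: "pverts G \<noteq> {}"
  obtains x where "0 < (\<Sum>a\<in>pverts G. (x a)\<^sup>2)"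
    "edge_weight (pverts G) (parcs G) x = rho G * (\<Sum>a\<in>pverts G. (x a)\<^sup>2)"
proof -
  have n: "0 < card (pverts G)" using ne pair_graph_arcs(1)[OF G] by (simp add: card_gt_0_iff)
  obtain \<phi> where phi: "spectral_basis G \<phi>"
    using spectral_basis_exists[OF G] by blast
  note orth = spectral_basisD(1)[OF phi] and qf = spectral_basisD(4)[OF phi]
  have norm: "(\<Sum>a\<in>pverts G. (\<phi> 0 a)\<^sup>2) = 1"
    using orth[of 0 0] n by (simp add: power2_eq_square)
  have "edge_weight (pverts G) (parcs G) (\<phi> 0) =
      (\<Sum>i<card (pverts G). if i = 0 then rho G else 0)"
    unfolding qf by (rule sum.cong[OF refl]) (use n in \<open>simp add: orth\<close>)
  also have "\<dots> = rho G" using n by simp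
  finally show thesis using that[of "\<phi> 0"] norm by simp
qed

text \<open>Courant-Fischer: the plane spanned by \<open>f\<close> and \<open>g\<close> contains a
  nonzero vector orthogonal to \<open>\<phi> 0\<close>, on which the form is at most
  \<open>lambda2 G\<close> times the squared norm. Disjoint supports ensure that the chosen
  combination does not vanish.\<close>

lemma lambda2_lower_bound:
  assumes G: "pair_graph G" and n: "2 \<le> card (pverts G)"
    and disj: "\<And>a. a \<in> pverts G \<Longrightarrow> f a * g a = 0"
    and pos: "0 < (\<Sum>a\<in>pverts G. (f a)\<^sup>2)" "0 < (\<Sum>a\<in>pverts G. (g a)\<^sup>2)"
    and Q: "\<And>\<alpha> \<beta>. t * (\<Sum>a\<in>pverts G. (\<alpha> * f a + \<beta> * g a)\<^sup>2)
      \<le> edge_weight (pverts G) (parcs G) (\<lambda>a. \<alpha> * f a + \<beta> * g a)"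
  shows "t \<le> lambda2 G"
proof -
  let ?n = "card (pverts G)"
  obtain \<phi> where phi: "spectral_basis G \<phi>"
    using spectral_basis_exists[OF G] by blast
  note norm = spectral_basisD(3)[OF phi] and qf = spectral_basisD(4)[OF phi]
    and ord = spectral_basisD(5)[OF phi]
  define cf cg where "cf = (\<Sum>a\<in>pverts G. \<phi> 0 a * f a)" and "cg = (\<Sum>a\<in>pverts G. \<phi> 0 a * g a)"
  obtain \<alpha> \<beta> where ab: "\<alpha> * cf + \<beta> * cg = 0" "\<alpha> \<noteq> 0 \<or> \<beta> \<noteq> 0"
  proof (cases "cf = 0 \<and> cg = 0")
    case True
    then show thesis using that[of 1 0] by simp
  next
    case False
    then show thesis using that[of cg "- cf"] by auto
  qed
  define z where "z a = \<alpha> * f a + \<beta> * g a" for a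
  have c0: "(\<Sum>a\<in>pverts G. \<phi> 0 a * z a) = 0"
    using ab(1) by (simp add: z_def cf_def cg_def sum_distrib_left algebra_simps sum.distrib)
  have "(\<Sum>a\<in>pverts G. (z a)\<^sup>2) = (\<Sum>a\<in>pverts G. \<alpha>\<^sup>2 * (f a)\<^sup>2 + \<beta>\<^sup>2 * (g a)\<^sup>2)"
  proof (rule sum.cong[OF refl])
    fix a assume "a \<in> pverts G"
    then show "(z a)\<^sup>2 = \<alpha>\<^sup>2 * (f a)\<^sup>2 + \<beta>\<^sup>2 * (g a)\<^sup>2"
      using disj[of a] by (auto simp: z_def power_mult_distrib)
  qed
  then have "(\<Sum>a\<in>pverts G. (z a)\<^sup>2) =
      \<alpha>\<^sup>2 * (\<Sum>a\<in>pverts G. (f a)\<^sup>2) + \<beta>\<^sup>2 * (\<Sum>a\<in>pverts G. (g a)\<^sup>2)"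
    by (simp add: sum.distrib sum_distrib_left)
  moreover have "0 < \<alpha>\<^sup>2 * (\<Sum>a\<in>pverts G. (f a)\<^sup>2) + \<beta>\<^sup>2 * (\<Sum>a\<in>pverts G. (g a)\<^sup>2)"
    using ab(2) pos
    by (cases "\<alpha> = 0") (auto intro!: add_pos_nonneg mult_pos_pos mult_nonneg_nonneg)
  ultimately have zpos: "0 < (\<Sum>a\<in>pverts G. (z a)\<^sup>2)" by simp
  have "edge_weight (pverts G) (parcs G) z \<le>
      (\<Sum>i<?n. lambda2 G * (\<Sum>a\<in>pverts G. \<phi> i a * z a)\<^sup>2)"
    unfolding qf
  proof (rule sum_mono)
    fix i assume i: "i \<in> {..<?n}"
    show "graph_eigenvalue (Suc i) G * (\<Sum>a\<in>pverts G. \<phi> i a * z a)\<^sup>2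
        \<le> lambda2 G * (\<Sum>a\<in>pverts G. \<phi> i a * z a)\<^sup>2"
    proof (cases "i = 0")
      case False
      then have "graph_eigenvalue (Suc i) G \<le> lambda2 G"
        using ord[of 1 i] i by (simp add: numeral_2_eq_2)
      then show ?thesis by (intro mult_right_mono) auto
    qed (simp add: c0)
  qed
  also have "\<dots> = lambda2 G * (\<Sum>a\<in>pverts G. (z a)\<^sup>2)"
    unfolding norm by (simp add: sum_distrib_left)
  finally show ?thesis
    using Q[of \<alpha> \<beta>] zpos unfolding z_def by (meson mult_le_cancel_right_pos order_trans)
qed

text \<open>If the eigenvector for \<open>lambda2\<close> has no sign change, connectedness makes it
  nowhere zero, and \<open>\<phi> 0\<close>, being orthogonal to it, must have entries of both
  signs. This takes the place of the Perron-Frobenius theorem; in this case \<open>\<mu>\<close> is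
  the largest eigenvalue.\<close>

lemma sign_changing_eigenvector:
  assumes G: "pair_graph G" and conn: "Digraph_Component.connected (with_proj G)"
    and n: "2 \<le> card (pverts G)"
  obtains x \<mu> where "lambda2 G \<le> \<mu>"
    "\<And>a. a \<in> pverts G \<Longrightarrow> (\<Sum>b\<in>pverts G. of_bool ((a, b) \<in> parcs G) * x b) = \<mu> * x a"
    "\<exists>a\<in>pverts G. 0 < x a" "\<exists>a\<in>pverts G. x a < 0"
proof -
  let ?V = "pverts G" and ?n = "card (pverts G)"
  note fin = pair_graph_arcs(1)[OF G] and symG = pair_graph_arcs(3)[OF G]
  obtain \<phi> where phi: "spectral_basis G \<phi>"
    using spectral_basis_exists[OF G] by blast
  note orth = spectral_basisD(1)[OF phi] and eig = spectral_basisD(2)[OF phi]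
    and ord = spectral_basisD(5)[OF phi]
  have n01: "0 < ?n" "1 < ?n" using n by auto
  have l2: "graph_eigenvalue (Suc 1) G = lambda2 G" by (simp add: numeral_2_eq_2)
  show thesis
  proof (cases "(\<exists>a\<in>?V. 0 < \<phi> 1 a) \<and> (\<exists>a\<in>?V. \<phi> 1 a < 0)")
    case True
    then show thesis using that[of "lambda2 G" "\<phi> 1"] eig[OF n01(2)] l2 by simp
  next
    case False
    define s :: real where "s = (if \<exists>a\<in>?V. \<phi> 1 a < 0 then - 1 else 1)"
    define y where "y a = s * \<phi> 1 a" for a
    have y0: "0 \<le> y a" if "a \<in> ?V" for a
      using False that by (auto simp: y_def s_def not_less)
    have ynz: "\<exists>a\<in>?V. y a \<noteq> 0"
    proof (rule ccontr)
      assume "\<not> ?thesis"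
      then have "\<And>a. a \<in> ?V \<Longrightarrow> \<phi> 1 a = 0" by (auto simp: y_def s_def split: if_splits)
      then have "(\<Sum>a\<in>?V. \<phi> 1 a * \<phi> 1 a) = 0" by (intro sum.neutral) auto
      then show False using orth[OF n01(2) n01(2)] by simp
    qed
    have yeig: "(\<Sum>b\<in>?V. of_bool ((a, b) \<in> parcs G) * y b) = lambda2 G * y a" if "a \<in> ?V" for a
    proof -
      have "(\<Sum>b\<in>?V. of_bool ((a, b) \<in> parcs G) * y b) =
          s * (\<Sum>b\<in>?V. of_bool ((a, b) \<in> parcs G) * \<phi> 1 b)"
        unfolding sum_distrib_left y_def by (intro sum.cong refl) simp
      also have "\<dots> = s * (lambda2 G * \<phi> 1 a)" using eig[OF n01(2) that] l2 by simp
      finally show ?thesis by (simp add: y_def)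
    qed
    define Z where "Z = {a \<in> ?V. y a = 0}"
    \<comment> \<open>At a zero of the nonnegative eigenvector \<open>y\<close> the eigenvector
      equation makes the sum over the neighbours zero, so no arc can leave the zero set.\<close>
    have "Z = {}"
    proof (rule ccontr)
      assume "Z \<noteq> {}"
      moreover have "Z \<subseteq> ?V" "Z \<noteq> ?V" using ynz by (auto simp: Z_def)
      ultimately obtain a b where ab: "a \<in> Z" "b \<in> ?V - Z" "(a, b) \<in> parcs G"
        using connected_crossing_arc[OF conn symG, of Z] by blast
      have "0 < (\<Sum>b\<in>?V. of_bool ((a, b) \<in> parcs G) * y b)"
        by (rule sum_pos2[OF fin, of b]) (use ab y0 in \<open>force simp: Z_def less_le\<close>)+
      then show False using yeig[of a] ab by (simp add: Z_def)
    qed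
    then have ypos: "0 < y a" if "a \<in> ?V" for a using y0[OF that] that by (force simp: Z_def less_le)
    have "(\<Sum>a\<in>?V. \<phi> 0 a * y a) = s * (\<Sum>a\<in>?V. \<phi> 0 a * \<phi> 1 a)"
      unfolding sum_distrib_left y_def by (intro sum.cong refl) simp
    then have sum0: "(\<Sum>a\<in>?V. \<phi> 0 a * y a) = 0" using orth[OF n01] by simp
    have nz: "\<exists>a\<in>?V. \<phi> 0 a \<noteq> 0"
    proof (rule ccontr)
      assume "\<not> ?thesis"
      then have "(\<Sum>a\<in>?V. \<phi> 0 a * \<phi> 0 a) = 0" by (intro sum.neutral) auto
      then show False using orth[OF n01(1) n01(1)] by simp
    qed
    have ex: "\<exists>a\<in>?V. c * \<phi> 0 a < 0" if c: "c = 1 \<or> c = - 1" for c :: real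
    proof (rule ccontr)
      assume "\<not> ?thesis"
      then have nn: "0 \<le> c * \<phi> 0 a" if "a \<in> ?V" for a using that by force
      obtain a where a: "a \<in> ?V" "\<phi> 0 a \<noteq> 0" using nz by blast
      have "0 < (\<Sum>a\<in>?V. c * \<phi> 0 a * y a)"
      proof (rule sum_pos2[OF fin a(1)])
        have "c * \<phi> 0 a \<noteq> 0" using a(2) c by auto
        then have "0 < c * \<phi> 0 a" using nn[OF a(1)] by linarith
        then show "0 < c * \<phi> 0 a * y a" using ypos[OF a(1)] by (rule mult_pos_pos)
        show "0 \<le> c * \<phi> 0 i * y i" if "i \<in> ?V" for i using nn[OF that] ypos[OF that] by simp
      qed
      also have "(\<Sum>a\<in>?V. c * \<phi> 0 a * y a) = c * (\<Sum>a\<in>?V. \<phi> 0 a * y a)"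
        by (simp add: sum_distrib_left mult.assoc)
      finally show False using sum0 by simp
    qed
    show thesis
    proof (rule that[of "graph_eigenvalue (Suc 0) G" "\<phi> 0"])
      show "lambda2 G \<le> graph_eigenvalue (Suc 0) G" using ord[of 0 1] n01 l2 by simp
      show "(\<Sum>b\<in>?V. of_bool ((a, b) \<in> parcs G) * \<phi> 0 b) = graph_eigenvalue (Suc 0) G * \<phi> 0 a"
        if "a \<in> ?V" for a using eig[OF n01(1) that] .
      show "\<exists>a\<in>?V. 0 < \<phi> 0 a" using ex[of "- 1"] by auto
      show "\<exists>a\<in>?V. \<phi> 0 a < 0" using ex[of 1] by auto
    qed
  qed
qed

section \<open>Turan graphs\<close>

text \<open>The smaller part size is taken as \<open>(m - 1) div r\<close>, one less than the
  ceiling of \<open>m / r\<close>, rather than \<open>m div r\<close>. Then a part with one more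
  vertex exists even if \<open>r\<close> divides \<open>m\<close>, so the marked vertex always finds
  a place.\<close>

lemma pred_div_eq:
  fixes m r :: nat
  assumes "0 < m" "0 < r"
  shows "(m - 1) div r = (if m mod r = 0 then m div r - 1 else m div r)"
  using assms by (cases m) (simp_all add: div_Suc)

lemma card_turan_part_cases:
  assumes "0 < m" "i < r"
  shows "card (turan_part m r i) = (m - 1) div r \<or> card (turan_part m r i) = (m - 1) div r + 1"
proof -
  have "m div r \<noteq> 0" if "m mod r = 0" using assms that by (auto simp: div_eq_0_iff)
  moreover have "(m - 1) div r = (if m mod r = 0 then m div r - 1 else m div r)"
    using assms by (intro pred_div_eq) auto
  ultimately show ?thesis
    using assms by (auto simp: card_turan_part)
qed

lemma card_turan_part_last:
  assumes "0 < m" "0 < r"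
  shows "card (turan_part m r ((m - 1) mod r)) = (m - 1) div r + 1"
proof -
  obtain k where k: "m = Suc k" using assms by (cases m) auto
  have "turan_part (Suc k) r (k mod r) = insert k (turan_part k r (k mod r))"
    by (auto simp: turan_part_def less_Suc_eq)
  moreover have "finite (turan_part k r (k mod r))" "k \<notin> turan_part k r (k mod r)"
    by (auto simp: turan_part_def)
  moreover have "card (turan_part k r (k mod r)) = k div r"
    using assms by (simp add: card_turan_part)
  ultimately show ?thesis by (simp add: k)
qed

lemma ceiling_double_quotient:
  assumes "0 < m" "0 < r"
  shows "\<lceil>real (2 * m) / real (2 * r)\<rceil> = int ((m - 1) div r + 1)"
proof -
  define q where "q = (m - 1) div r"
  have "m - 1 = r * q + (m - 1) mod r" by (simp add: q_def)
  moreover have "(m - 1) mod r < r" using assms by simp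
  ultimately have "r * q < m" "m \<le> r * q + r" using assms by linarith+
  then have "real r * real q < real m" "real m \<le> real r * (real q + 1)"
    by (simp_all add: distrib_left flip: of_nat_mult of_nat_add)
  then have "real q < real m / real r" "real m / real r \<le> real q + 1"
    using assms by (simp_all add: pos_less_divide_eq pos_divide_le_eq mult.commute)
  moreover have "real (2 * m) / real (2 * r) = real m / real r" by simp
  ultimately show ?thesis unfolding q_def[symmetric] by (intro ceiling_unique) auto
qed

lemma turan_graph_simps:
  "pverts (turan_graph m r) = {..<m}"
  "(a, b) \<in> parcs (turan_graph m r) \<longleftrightarrow> a < m \<and> b < m \<and> a mod r \<noteq> b mod r"
  by (auto simp: turan_graph_def)

lemma pair_graph_turan_graph: "pair_graph (turan_graph m r)"
  by (rule pair_graphI) (auto simp: turan_graph_simps sym_def irrefl_def)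

lemma turan_part_eq: "{a \<in> {..<m}. a mod r = i} = turan_part m r i"
  by (auto simp: turan_part_def)

lemma turan_char_sum:
  assumes "0 < m" "0 < r" "0 < lam" and U: "U = {} \<or> (\<exists>u<m. U = {u})"
    and Up: "\<And>u. u \<in> U \<Longrightarrow> card (turan_part m r (u mod r)) = (m - 1) div r + 1"
  shows "char_sum {..<m} (\<lambda>x. x mod r) (marked_weight lam U) r =
    chord_bound lam ((m - 1) div r) r m + of_bool (U \<noteq> {}) * mark_correction lam ((m - 1) div r)"
proof -
  have "U = {} \<or> (\<exists>u\<in>{..<m}. U = {u})" using U by auto
  from char_sum_chord(2)[where V = "{..<m}" and p = "\<lambda>x. x mod r" and r = r and q = "(m - 1) div r",
      OF _ _ assms(3) this]
  show ?thesis
    using assms(1,2) Up card_turan_part_cases[of m _ r] unfolding turan_part_eq by simp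
qed

lemma turan_parameter_exists:
  assumes "2 \<le> r" "r \<le> m" and U: "U = {} \<or> (\<exists>u<m. U = {u})"
    and Up: "\<And>u. u \<in> U \<Longrightarrow> card (turan_part m r (u mod r)) = (m - 1) div r + 1"
    and big: "U \<noteq> {} \<Longrightarrow> 2 * r \<le> m"
  shows "\<exists>lam>0. chord_bound lam ((m - 1) div r) r m +
    of_bool (U \<noteq> {}) * mark_correction lam ((m - 1) div r) = 1"
proof -
  have "\<exists>a\<in>{..<m} - U. a mod r = i" if i: "i < r" for i
  proof (cases "i \<in> U")
    case False
    then show ?thesis using i assms(2) by (intro bexI[of _ i]) auto
  next
    case True
    then have "U = {i}" "2 * r \<le> m" using U big by auto
    \<comment> \<open>The residue class of the marked vertex \<open>i\<close> needs an unmarked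
      vertex too; \<open>i + r\<close> is one, as it is below \<open>m\<close>.\<close>
    then show ?thesis using i assms(1) by (intro bexI[of _ "i + r"]) auto
  qed
  then obtain lam where "0 < lam" "char_sum {..<m} (\<lambda>x. x mod r) (marked_weight lam U) r = 1"
    using char_sum_root[of "{..<m}" "\<lambda>x. x mod r" r U] assms(1) by auto
  then show ?thesis
    using turan_char_sum[OF _ _ _ U Up] assms(1,2) by (intro exI[of _ lam]) simp
qed

lemma turan_weight_attained:
  assumes "0 < m" "0 < r" "0 < lam" and U: "U = {} \<or> (\<exists>u<m. U = {u})"
    and Up: "\<And>u. u \<in> U \<Longrightarrow> card (turan_part m r (u mod r)) = (m - 1) div r + 1"
    and bound: "chord_bound lam ((m - 1) div r) r m +
      of_bool (U \<noteq> {}) * mark_correction lam ((m - 1) div r) = 1"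
  shows "\<exists>y. (\<forall>a<m. 0 < y a) \<and> edge_weight {..<m} (parcs (turan_graph m r)) y =
    lam * (\<Sum>a<m. (y a)\<^sup>2) + (\<Sum>a\<in>U. (y a)\<^sup>2)"
proof -
  have "char_sum {..<m} (\<lambda>x. x mod r) (marked_weight lam U) r = 1"
    using turan_char_sum[OF assms(1-3) U Up] bound by simp
  then obtain y where y: "\<forall>a\<in>{..<m}. 0 < y a"
    "edge_weight {..<m} (part_rel (\<lambda>x. x mod r)) y = (\<Sum>a<m. marked_weight lam U a * (y a)\<^sup>2)"
    using edge_weight_attained[of "{..<m}" "\<lambda>x. x mod r" r "marked_weight lam U"] assms(2,3)
    by (auto simp: add_pos_nonneg)
  have "edge_weight {..<m} (parcs (turan_graph m r)) y = edge_weight {..<m} (part_rel (\<lambda>x. x mod r)) y"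
    unfolding edge_weight_def by (intro sum.cong refl) (auto simp: turan_graph_simps)
  moreover have "(\<Sum>a<m. marked_weight lam U a * (y a)\<^sup>2) =
      lam * (\<Sum>a<m. (y a)\<^sup>2) + (\<Sum>a\<in>{..<m} \<inter> U. (y a)\<^sup>2)"
    unfolding distrib_right sum.distrib sum_distrib_left by simp
  moreover have "{..<m} \<inter> U = U" using U by auto
  ultimately show ?thesis using y by (intro exI[of _ y]) simp
qed

lemma balanced_partition_turan_bij:
  assumes P: "finite P" "card P = m" "0 < m" "0 < r"
    and p: "balanced_partition P E ((m - 1) div r) r p"
    and u: "u \<in> P" "card {a \<in> P. p a = p u} = (m - 1) div r + 1"
    and u': "u' < m" "card (turan_part m r (u' mod r)) = (m - 1) div r + 1"
  shows "\<exists>f. bij_betw f P {..<m} \<and> f u = u' \<and>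
    (\<forall>a\<in>P. \<forall>b\<in>P. (a, b) \<in> E \<longleftrightarrow> (f a, f b) \<in> parcs (turan_graph m r))"
proof -
  have "\<exists>f. bij_betw f P {..<m} \<and> f u = u' \<and>
      (\<forall>a\<in>P. \<forall>b\<in>P. p a = p b \<longleftrightarrow> f a mod r = f b mod r)"
  proof (rule balanced_partitions_isomorphic[where q = "(m - 1) div r" and r = r])
    fix i assume "i < r"
    then show "card {a \<in> {..<m}. a mod r = i} = (m - 1) div r \<or>
        card {a \<in> {..<m}. a mod r = i} = (m - 1) div r + 1"
      unfolding turan_part_eq using card_turan_part_cases P by blast
  qed (use assms in \<open>auto simp: balanced_partition_def turan_part_eq[simplified]\<close>)
  then obtain f where f: "bij_betw f P {..<m}" "f u = u'"
    "\<And>a b. a \<in> P \<Longrightarrow> b \<in> P \<Longrightarrow> p a = p b \<longleftrightarrow> f a mod r = f b mod r" by blast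
  have "f a < m" if "a \<in> P" for a using f(1) that by (auto simp: bij_betw_def)
  then show ?thesis
    using f p by (intro exI[of _ f]) (auto simp: balanced_partition_def turan_graph_simps)
qed

text \<open>Otherwise \<open>m \<le> r * ((m - 1) div r) \<le> m - 1\<close>.\<close>

lemma balanced_partition_large_part:
  assumes P: "finite P" "card P = m" "0 < m" "0 < r"
    and p: "balanced_partition P E ((m - 1) div r) r p"
  shows "\<exists>u\<in>P. card {a \<in> P. p a = p u} = (m - 1) div r + 1"
proof (rule ccontr)
  let ?q = "(m - 1) div r"
  assume no: "\<not> ?thesis"
  have "card {a \<in> P. p a = i} \<le> ?q" if "i < r" for i
  proof (rule ccontr)
    assume "\<not> ?thesis"
    then have i: "card {a \<in> P. p a = i} = ?q + 1"
      using p that by (auto simp: balanced_partition_def)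
    then have "{a \<in> P. p a = i} \<noteq> {}" by (metis add_is_0 card.empty one_neq_zero)
    then obtain u where "u \<in> P" "p u = i" by blast
    then show False using no i by blast
  qed
  then have "(\<Sum>i<r. real (card {a \<in> P. p a = i})) \<le> (\<Sum>i<r. real ?q)"
    by (intro sum_mono) simp
  moreover have "(\<Sum>i<r. real (card {a \<in> P. p a = i})) = real m"
    using sum_by_parts[of P p r "\<lambda>_. 1"] p P by (simp add: balanced_partition_def)
  ultimately have "real m \<le> real (r * ?q)" by simp
  then have "m \<le> r * ?q" by (simp only: of_nat_le_iff)
  moreover have "r * ?q \<le> m - 1" by simp
  ultimately show False using P by linarith
qed

section \<open>Test vectors on two disjoint pieces\<close>

lemma edge_weight_image:
  assumes "inj_on h A" and "\<And>a b. a \<in> A \<Longrightarrow> b \<in> A \<Longrightarrow> (h a, h b) \<in> R \<longleftrightarrow> (a, b) \<in> E"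
    and "\<And>a. a \<in> A \<Longrightarrow> z (h a) = c * y a"
  shows "edge_weight (h ` A) R z = c\<^sup>2 * edge_weight A E y"
  unfolding edge_weight_def sum.reindex[OF assms(1)] sum_distrib_left o_def
proof (rule sum.cong[OF refl], rule sum.cong[OF refl])
  fix a b assume "a \<in> A" "b \<in> A"
  then show "of_bool ((h a, h b) \<in> R) * z (h a) * z (h b) = c\<^sup>2 * (of_bool ((a, b) \<in> E) * y a * y b)"
    by (simp add: assms(2,3) power2_eq_square)
qed

lemma edge_weight_two_blocks:
  assumes W: "finite W" "A \<subseteq> W" "B \<subseteq> W" "A \<inter> B = {}" and R: "sym R"
    and z: "\<And>a. a \<in> W \<Longrightarrow> a \<notin> A \<Longrightarrow> a \<notin> B \<Longrightarrow> z a = 0"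
  shows "edge_weight W R z = edge_weight A R z + edge_weight B R z +
    2 * (\<Sum>a\<in>A. \<Sum>b\<in>B. of_bool ((a, b) \<in> R) * z a * z b)"
proof -
  let ?w = "\<lambda>a b. of_bool ((a, b) \<in> R) * z a * z b"
  have fin: "finite A" "finite B" using W finite_subset by blast+
  have restr: "(\<Sum>a\<in>W. f a) = (\<Sum>a\<in>A. f a) + (\<Sum>a\<in>B. f a)"
    if "\<And>a. a \<in> W \<Longrightarrow> a \<notin> A \<Longrightarrow> a \<notin> B \<Longrightarrow> f a = 0" for f :: "'a \<Rightarrow> real"
  proof -
    have "(\<Sum>a\<in>W. f a) = (\<Sum>a\<in>A \<union> B. f a)"
      by (rule sum.mono_neutral_right) (use W that in auto)
    then show ?thesis using fin W(4) by (simp add: sum.union_disjoint)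
  qed
  have "edge_weight W R z = (\<Sum>a\<in>W. (\<Sum>b\<in>A. ?w a b) + (\<Sum>b\<in>B. ?w a b))"
    unfolding edge_weight_def by (rule sum.cong[OF refl], rule restr) (simp add: z)
  also have "\<dots> = (\<Sum>a\<in>A. (\<Sum>b\<in>A. ?w a b) + (\<Sum>b\<in>B. ?w a b)) +
      (\<Sum>a\<in>B. (\<Sum>b\<in>A. ?w a b) + (\<Sum>b\<in>B. ?w a b))"
    by (rule restr) (simp add: z)
  also have "(\<Sum>a\<in>B. (\<Sum>b\<in>A. ?w a b) + (\<Sum>b\<in>B. ?w a b)) =
      (\<Sum>a\<in>A. \<Sum>b\<in>B. ?w a b) + edge_weight B R z"
  proof -
    have "(\<Sum>a\<in>B. \<Sum>b\<in>A. ?w a b) = (\<Sum>b\<in>A. \<Sum>a\<in>B. ?w a b)" by (rule sum.swap)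
    also have "\<dots> = (\<Sum>a\<in>A. \<Sum>b\<in>B. ?w a b)"
    proof (intro sum.cong refl)
      fix a b
      have "(b, a) \<in> R \<longleftrightarrow> (a, b) \<in> R" using R by (blast dest: symD)
      then show "?w b a = ?w a b" by simp
    qed
    finally show ?thesis by (simp only: sum.distrib edge_weight_def)
  qed
  finally show ?thesis unfolding sum.distrib edge_weight_def by linarith
qed

text \<open>The test plane is spanned by \<open>y1\<close> on one piece and \<open>y2\<close> on the
  other. The excesses \<open>c1\<close> and \<open>c2\<close> over \<open>t\<close>, together with
  the arcs between the pieces, form a quadratic form in the coefficients, and \<open>cross\<close>
  asks that it be nonnegative.\<close>

lemma lambda2_two_pieces:
  assumes H: "pair_graph H"
    and h1: "inj_on h1 V1" "h1 ` V1 \<subseteq> pverts H" and h2: "inj_on h2 V2" "h2 ` V2 \<subseteq> pverts H"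
    and disj: "h1 ` V1 \<inter> h2 ` V2 = {}"
    and E1: "\<And>a b. a \<in> V1 \<Longrightarrow> b \<in> V1 \<Longrightarrow> (h1 a, h1 b) \<in> parcs H \<longleftrightarrow> (a, b) \<in> E1"
    and E2: "\<And>a b. a \<in> V2 \<Longrightarrow> b \<in> V2 \<Longrightarrow> (h2 a, h2 b) \<in> parcs H \<longleftrightarrow> (a, b) \<in> E2"
    and pos: "0 < (\<Sum>a\<in>V1. (y1 a)\<^sup>2)" "0 < (\<Sum>a\<in>V2. (y2 a)\<^sup>2)"
    and w1: "edge_weight V1 E1 y1 = t * (\<Sum>a\<in>V1. (y1 a)\<^sup>2) + c1"
    and w2: "edge_weight V2 E2 y2 = t * (\<Sum>a\<in>V2. (y2 a)\<^sup>2) + c2"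
    and cross: "\<And>\<alpha> \<beta>. 0 \<le> \<alpha>\<^sup>2 * c1 + \<beta>\<^sup>2 * c2 +
      2 * (\<alpha> * \<beta> * (\<Sum>a\<in>V1. \<Sum>b\<in>V2. of_bool ((h1 a, h2 b) \<in> parcs H) * y1 a * y2 b))"
  shows "t \<le> lambda2 H"
proof -
  note fin = pair_graph_arcs(1)[OF H]
  have finI: "finite (h1 ` V1)" "finite (h2 ` V2)" using h1(2) h2(2) fin finite_subset by blast+
  define f where "f w = (if w \<in> h1 ` V1 then y1 (inv_into V1 h1 w) else 0)" for w
  define g where "g w = (if w \<in> h2 ` V2 then y2 (inv_into V2 h2 w) else 0)" for w
  have f1: "f (h1 a) = y1 a" "g (h1 a) = 0" if "a \<in> V1" for a
    using that h1(1) disj by (auto simp: f_def g_def inv_into_f_f)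
  have g2: "g (h2 a) = y2 a" "f (h2 a) = 0" if "a \<in> V2" for a
    using that h2(1) disj by (auto simp: f_def g_def inv_into_f_f)
  have fg: "f w * g w = 0" for w using disj by (auto simp: f_def g_def)
  have sf: "(\<Sum>w\<in>pverts H. (f w)\<^sup>2) = (\<Sum>a\<in>V1. (y1 a)\<^sup>2)"
  proof -
    have "(\<Sum>w\<in>pverts H. (f w)\<^sup>2) = (\<Sum>w\<in>h1 ` V1. (f w)\<^sup>2)"
      by (rule sum.mono_neutral_right) (use fin h1 in \<open>auto simp: f_def\<close>)
    then show ?thesis by (simp add: sum.reindex[OF h1(1)] f1)
  qed
  have sg: "(\<Sum>w\<in>pverts H. (g w)\<^sup>2) = (\<Sum>a\<in>V2. (y2 a)\<^sup>2)"
  proof -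
    have "(\<Sum>w\<in>pverts H. (g w)\<^sup>2) = (\<Sum>w\<in>h2 ` V2. (g w)\<^sup>2)"
      by (rule sum.mono_neutral_right) (use fin h2 in \<open>auto simp: g_def\<close>)
    then show ?thesis by (simp add: sum.reindex[OF h2(1)] g2)
  qed
  show ?thesis
  proof (rule lambda2_lower_bound[OF H, of f g])
    have "V1 \<noteq> {}" "V2 \<noteq> {}" using pos by auto
    then have "1 \<le> card (h1 ` V1)" "1 \<le> card (h2 ` V2)"
      using finI by (simp_all add: Suc_le_eq card_gt_0_iff)
    moreover have "card (h1 ` V1) + card (h2 ` V2) = card (h1 ` V1 \<union> h2 ` V2)"
      using card_Un_disjoint[OF finI disj] by simp
    moreover have "\<dots> \<le> card (pverts H)" using fin h1(2) h2(2) by (intro card_mono) auto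
    ultimately show "2 \<le> card (pverts H)" by linarith
    show "f a * g a = 0" for a by (rule fg)
    show "0 < (\<Sum>a\<in>pverts H. (f a)\<^sup>2)" "0 < (\<Sum>a\<in>pverts H. (g a)\<^sup>2)"
      using pos sf sg by simp_all
    fix \<alpha> \<beta>
    let ?z = "\<lambda>a. \<alpha> * f a + \<beta> * g a"
    have "(\<Sum>a\<in>pverts H. (?z a)\<^sup>2) = (\<Sum>a\<in>pverts H. \<alpha>\<^sup>2 * (f a)\<^sup>2 + \<beta>\<^sup>2 * (g a)\<^sup>2)"
    proof (rule sum.cong[OF refl])
      fix a
      show "(?z a)\<^sup>2 = \<alpha>\<^sup>2 * (f a)\<^sup>2 + \<beta>\<^sup>2 * (g a)\<^sup>2"
        using fg[of a] by (auto simp: power_mult_distrib)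
    qed
    then have norm: "(\<Sum>a\<in>pverts H. (?z a)\<^sup>2) = \<alpha>\<^sup>2 * (\<Sum>a\<in>V1. (y1 a)\<^sup>2) + \<beta>\<^sup>2 * (\<Sum>a\<in>V2. (y2 a)\<^sup>2)"
      by (simp add: sum.distrib sf sg flip: sum_distrib_left)
    have "edge_weight (pverts H) (parcs H) ?z =
        edge_weight (h1 ` V1) (parcs H) ?z + edge_weight (h2 ` V2) (parcs H) ?z +
        2 * (\<Sum>a\<in>h1 ` V1. \<Sum>b\<in>h2 ` V2. of_bool ((a, b) \<in> parcs H) * ?z a * ?z b)"
      by (rule edge_weight_two_blocks)
        (use fin h1 h2 disj pair_graph_arcs(3)[OF H] in \<open>auto simp: f_def g_def\<close>)
    also have "edge_weight (h1 ` V1) (parcs H) ?z = \<alpha>\<^sup>2 * edge_weight V1 E1 y1"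
      by (rule edge_weight_image[OF h1(1) E1]) (simp_all add: f1)
    also have "edge_weight (h2 ` V2) (parcs H) ?z = \<beta>\<^sup>2 * edge_weight V2 E2 y2"
      by (rule edge_weight_image[OF h2(1) E2]) (simp_all add: g2)
    also have "(\<Sum>a\<in>h1 ` V1. \<Sum>b\<in>h2 ` V2. of_bool ((a, b) \<in> parcs H) * ?z a * ?z b) =
        \<alpha> * \<beta> * (\<Sum>a\<in>V1. \<Sum>b\<in>V2. of_bool ((h1 a, h2 b) \<in> parcs H) * y1 a * y2 b)"
      unfolding sum.reindex[OF h1(1)] sum.reindex[OF h2(1)] sum_distrib_left o_def
      by (rule sum.cong[OF refl], rule sum.cong[OF refl]) (simp add: f1 g2)
    finally show "t * (\<Sum>a\<in>pverts H. (?z a)\<^sup>2) \<le> edge_weight (pverts H) (parcs H) ?z"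
      unfolding norm w1 w2 using cross[of \<alpha> \<beta>] by (simp add: algebra_simps)
  qed
qed

section \<open>Nodal domains\<close>

lemma chord_bound_step:
  "chord_bound lam q r k = chord_bound lam q r m +
    (real k - real m) * (lam / ((lam + real q) * (lam + real q + 1)))"
  unfolding chord_bound_def left_diff_distrib by linarith

lemma card_le_of_chord_bound:
  assumes lam: "0 < lam" and k: "1 \<le> chord_bound lam q r k"
    and m: "chord_bound lam q r m + of_bool marked * mark_correction lam q = 1"
  shows "m \<le> k"
proof (rule ccontr)
  \<comment> \<open>The drop of the chord bound per missing vertex, which is more than the loss that
    a mark can cause.\<close>
  define s where "s = lam / ((lam + real q) * (lam + real q + 1))"
  assume "\<not> m \<le> k"
  then have "real k - real m \<le> - 1" by simp
  moreover have "0 < s" using lam by (simp add: s_def)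
  ultimately have "(real k - real m) * s \<le> - 1 * s" by (intro mult_right_mono) auto
  moreover have "- s < mark_correction lam q"
    unfolding s_def by (rule mark_correction_lower[OF lam])
  then have "- s < of_bool marked * mark_correction lam q"
    using \<open>0 < s\<close> by (cases marked) auto
  ultimately show False
    using chord_bound_step[of lam q r k m, folded s_def] k m by linarith
qed

text \<open>Each arc counts in one direction only. The minus sign sits on the second factor so that
  all terms are nonnegative for the positive set \<open>P\<close> and the negative set
  \<open>N\<close>.\<close>

definition cross_weight :: "('a \<times> 'a) set \<Rightarrow> ('a \<Rightarrow> real) \<Rightarrow> 'a set \<Rightarrow> 'a set \<Rightarrow> real" where
  "cross_weight E x P N = (\<Sum>(a, b)\<in>P \<times> N. of_bool ((a, b) \<in> E) * (x a * - x b))"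

lemma cross_weight_commute:
  assumes "sym E"
  shows "cross_weight E (\<lambda>a. - x a) N P = cross_weight E x P N"
proof -
  have sw: "bij_betw prod.swap (P \<times> N) (N \<times> P)" by (auto simp: bij_betw_def inj_on_def)
  show ?thesis
    unfolding cross_weight_def sum.reindex_bij_betw[OF sw, symmetric]
    using assms by (intro sum.cong refl) (auto dest: symD)
qed

text \<open>Multiply the eigenvector equation at each vertex of \<open>P\<close> by
  \<open>x a\<close> and sum over \<open>P\<close>. Zeros of \<open>x\<close> drop out, and the
  negative neighbours, moved to the other side, give the cross term.\<close>

lemma positive_part_weight:
  assumes V: "finite V"
    and eig: "\<And>a. a \<in> V \<Longrightarrow> (\<Sum>b\<in>V. of_bool ((a, b) \<in> E) * x b) = \<mu> * x a"
  defines "P \<equiv> {a \<in> V. 0 < x a}" and "N \<equiv> {a \<in> V. x a < 0}"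
  shows "edge_weight P E x = \<mu> * (\<Sum>a\<in>P. (x a)\<^sup>2) + cross_weight E x P N"
proof -
  have fin: "finite P" "finite N" using V by (auto simp: P_def N_def)
  have row: "(\<Sum>b\<in>P. of_bool ((a, b) \<in> E) * x a * x b) =
      \<mu> * (x a)\<^sup>2 + (\<Sum>b\<in>N. of_bool ((a, b) \<in> E) * (x a * - x b))" if a: "a \<in> P" for a
  proof -
    have "(\<Sum>b\<in>V. of_bool ((a, b) \<in> E) * x b) = (\<Sum>b\<in>P \<union> N. of_bool ((a, b) \<in> E) * x b)"
      by (rule sum.mono_neutral_right) (use V in \<open>auto simp: P_def N_def\<close>)
    also have "\<dots> = (\<Sum>b\<in>P. of_bool ((a, b) \<in> E) * x b) + (\<Sum>b\<in>N. of_bool ((a, b) \<in> E) * x b)"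
      by (rule sum.union_disjoint[OF fin]) (auto simp: P_def N_def)
    finally have "\<mu> * x a = (\<Sum>b\<in>P. of_bool ((a, b) \<in> E) * x b) + (\<Sum>b\<in>N. of_bool ((a, b) \<in> E) * x b)"
      using eig a by (simp add: P_def)
    then have "x a * (\<mu> * x a) = (\<Sum>b\<in>P. x a * (of_bool ((a, b) \<in> E) * x b)) +
        (\<Sum>b\<in>N. x a * (of_bool ((a, b) \<in> E) * x b))"
      by (simp only: distrib_left sum_distrib_left)
    moreover have "(\<Sum>b\<in>P. x a * (of_bool ((a, b) \<in> E) * x b)) =
        (\<Sum>b\<in>P. of_bool ((a, b) \<in> E) * x a * x b)"
      by (intro sum.cong refl) simp
    moreover have "(\<Sum>b\<in>N. x a * (of_bool ((a, b) \<in> E) * x b)) =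
        - (\<Sum>b\<in>N. of_bool ((a, b) \<in> E) * (x a * - x b))"
      unfolding sum_negf[symmetric] by (intro sum.cong refl) simp
    ultimately show ?thesis by (simp add: power2_eq_square algebra_simps)
  qed
  have "edge_weight P E x = (\<Sum>a\<in>P. \<mu> * (x a)\<^sup>2 + (\<Sum>b\<in>N. of_bool ((a, b) \<in> E) * (x a * - x b)))"
    unfolding edge_weight_def by (rule sum.cong[OF refl]) (rule row)
  then show ?thesis
    unfolding cross_weight_def sum.distrib sum_distrib_left sum.cartesian_product[symmetric] by simp
qed

lemma cross_weight_term_nonneg:
  fixes x :: "'a \<Rightarrow> real"
  assumes "\<And>a. a \<in> P \<Longrightarrow> 0 < x a" "\<And>a. a \<in> N \<Longrightarrow> x a < 0" "e \<in> P \<times> N"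
  shows "0 \<le> (case e of (a, b) \<Rightarrow> of_bool ((a, b) \<in> E) * (x a * - x b))"
  using assms by (cases e) (auto simp: mult_nonneg_nonpos less_imp_le)

lemma cross_weight_ge:
  assumes fin: "finite P" "finite N" and sgn: "\<And>a. a \<in> P \<Longrightarrow> 0 < x a" "\<And>a. a \<in> N \<Longrightarrow> x a < 0"
    and F: "F \<subseteq> P \<times> N" "F \<subseteq> E"
  shows "(\<Sum>(a, b)\<in>F. x a * - x b) \<le> cross_weight E x P N"
proof -
  have "(\<Sum>(a, b)\<in>F. x a * - x b) = (\<Sum>(a, b)\<in>F. of_bool ((a, b) \<in> E) * (x a * - x b))"
    by (rule sum.cong[OF refl]) (use F in auto)
  also have "\<dots> \<le> cross_weight E x P N"
    unfolding cross_weight_def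
    by (rule sum_mono2) (use fin F cross_weight_term_nonneg[of P x N _ E, OF sgn] in auto)
  finally show ?thesis .
qed

section \<open>Size and structure of the positive and negative vertex sets\<close>

locale nodal_domains =
  fixes G :: "'a pair_pre_digraph" and r :: nat and x :: "'a \<Rightarrow> real" and \<mu> :: real
  assumes G: "pair_graph G" and conn: "Digraph_Component.connected (with_proj G)"
    and clique: "clique_free (r + 1) G"
    and eig: "\<And>a. a \<in> pverts G \<Longrightarrow> (\<Sum>b\<in>pverts G. of_bool ((a, b) \<in> parcs G) * x b) = \<mu> * x a"
    and signs: "\<exists>a\<in>pverts G. 0 < x a" "\<exists>a\<in>pverts G. x a < 0"
begin

definition "P = {a \<in> pverts G. 0 < x a}"
definition "N = {a \<in> pverts G. x a < 0}"

abbreviation "cross \<equiv> cross_weight (parcs G) x P N"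

lemma parts:
  "finite P" "finite N" "P \<noteq> {}" "N \<noteq> {}" "P \<subseteq> pverts G" "N \<subseteq> pverts G" "P \<inter> N = {}"
  using signs pair_graph_arcs(1)[OF G] by (auto simp: P_def N_def)

lemma weight_P: "edge_weight P (parcs G) x = \<mu> * (\<Sum>a\<in>P. (x a)\<^sup>2) + cross"
  unfolding P_def N_def by (rule positive_part_weight[OF pair_graph_arcs(1)[OF G] eig])

text \<open>Negating \<open>x\<close> exchanges \<open>P\<close> and \<open>N\<close> and leaves
  \<open>cross\<close> unchanged, so statements are proved for \<open>P\<close> and transferred to
  \<open>N\<close>.\<close>

lemma swap: "nodal_domains G r (\<lambda>a. - x a) \<mu>"
proof (rule nodal_domains.intro)
  fix a assume "a \<in> pverts G"
  then show "(\<Sum>b\<in>pverts G. of_bool ((a, b) \<in> parcs G) * - x b) = \<mu> * - x a"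
    using eig[of a] by (simp only: mult_minus_right sum_negf)
qed (use G conn clique signs in auto)

lemma swap_parts:
  "nodal_domains.P G (\<lambda>a. - x a) = N" "nodal_domains.N G (\<lambda>a. - x a) = P"
  by (simp_all add: nodal_domains.P_def[OF swap] nodal_domains.N_def[OF swap] P_def N_def)

lemma cross_ge: "F \<subseteq> P \<times> N \<Longrightarrow> F \<subseteq> parcs G \<Longrightarrow> (\<Sum>(a, b)\<in>F. x a * - x b) \<le> cross"
  using parts(1,2) by (rule cross_weight_ge) (auto simp: P_def N_def)

lemma cross_nonneg: "0 \<le> cross"
  using cross_ge[of "{}"] by simp

lemma no_large_clique:
  "K \<subseteq> pverts G \<Longrightarrow> card K = Suc r \<Longrightarrow> \<exists>a\<in>K. \<exists>b\<in>K. a \<noteq> b \<and> (a, b) \<notin> parcs G"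
  using clique_freeD[OF clique G] by simp

lemma square_sum_pos: "0 < (\<Sum>a\<in>P. (x a)\<^sup>2)"
  using parts(1,3) by (intro sum_pos) (auto simp: P_def)

lemma P_turan:
  assumes lam: "0 < lam" and U: "U = {} \<or> (\<exists>u\<in>P. U = {u})"
    and W: "lam * (\<Sum>a\<in>P. (x a)\<^sup>2) + (\<Sum>a\<in>U. (x a)\<^sup>2) \<le> \<mu> * (\<Sum>a\<in>P. (x a)\<^sup>2) + cross"
  defines "bound \<equiv> \<lambda>q. chord_bound lam q r (card P) + of_bool (U \<noteq> {}) * mark_correction lam q"
  shows "1 \<le> bound q"
    and "bound q = 1 \<Longrightarrow>
      \<mu> * (\<Sum>a\<in>P. (x a)\<^sup>2) + cross = lam * (\<Sum>a\<in>P. (x a)\<^sup>2) + (\<Sum>a\<in>U. (x a)\<^sup>2) \<and>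
      (\<exists>p. balanced_partition P (parcs G) q r p \<and> (\<forall>u\<in>U. card {a \<in> P. p a = p u} = q + 1))"
proof -
  have "\<exists>a\<in>K. \<exists>b\<in>K. a \<noteq> b \<and> (a, b) \<notin> parcs G" if "K \<subseteq> P" "card K = Suc r" for K
    using no_large_clique[of K] that parts(5) by blast
  note turan = weighted_turan[where V = P and x = x and E = "parcs G" and r = r and lam = lam and U = U
      and q = q, OF parts(1,3) _ pair_graph_arcs(3,4)[OF G] this lam U]
  show "1 \<le> bound q"
    unfolding bound_def using W weight_P by (intro turan(1)) (auto simp: P_def)
  assume "bound q = 1"
  then show "\<mu> * (\<Sum>a\<in>P. (x a)\<^sup>2) + cross = lam * (\<Sum>a\<in>P. (x a)\<^sup>2) + (\<Sum>a\<in>U. (x a)\<^sup>2) \<and>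
      (\<exists>p. balanced_partition P (parcs G) q r p \<and> (\<forall>u\<in>U. card {a \<in> P. p a = p u} = q + 1))"
    unfolding bound_def weight_P[symmetric] using W weight_P by (intro turan(2)) (auto simp: P_def)
qed

text \<open>The marked and unmarked equations for \<open>lam\<close> are both met with the unmarked
  Turan bound: at this point \<open>cross\<close> is only known to be nonnegative.\<close>

lemma P_large:
  assumes "0 < lam" "lam \<le> \<mu>"
    and "chord_bound lam q r m + of_bool marked * mark_correction lam q = 1"
  shows "m \<le> card P"
proof (rule card_le_of_chord_bound[OF assms(1) _ assms(3)])
  have "lam * (\<Sum>a\<in>P. (x a)\<^sup>2) \<le> \<mu> * (\<Sum>a\<in>P. (x a)\<^sup>2)"
    using assms(2) by (intro mult_right_mono sum_nonneg) auto
  then show "1 \<le> chord_bound lam q r (card P)"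
    using P_turan(1)[where U = "{}" and lam = lam and q = q] assms(1) cross_nonneg by simp
qed

lemma P_exact:
  assumes "0 < lam" "lam \<le> \<mu>" "chord_bound lam q r (card P) = 1"
  shows "\<mu> = lam \<and> cross = 0 \<and> (\<exists>p. balanced_partition P (parcs G) q r p)"
proof -
  let ?s = "\<Sum>a\<in>P. (x a)\<^sup>2"
  have le: "lam * ?s \<le> \<mu> * ?s"
    using assms(2) by (intro mult_right_mono sum_nonneg) auto
  have *: "\<mu> * ?s + cross = lam * ?s" "\<exists>p. balanced_partition P (parcs G) q r p"
    using P_turan(2)[where U = "{}" and lam = lam and q = q] assms(1,3) le cross_nonneg by auto
  then have "cross = 0" "\<mu> * ?s = lam * ?s" using le cross_nonneg by linarith+
  then show ?thesis using *(2) square_sum_pos by simp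
qed

text \<open>Marking the endpoint with the smaller absolute value keeps \<open>(x u)\<^sup>2\<close>
  within the single term \<open>x u * - x v\<close> of \<open>cross\<close>. Tightness then forces
  equal absolute values at both ends.\<close>

lemma P_exact_marked:
  assumes "0 < lam" "lam \<le> \<mu>" "chord_bound lam q r (card P) + mark_correction lam q = 1"
    and u: "u \<in> P" "v \<in> N" "(u, v) \<in> parcs G" "x u \<le> - x v"
  shows "\<mu> = lam \<and> cross = (x u)\<^sup>2 \<and> x u = - x v \<and>
    (\<exists>p. balanced_partition P (parcs G) q r p \<and> card {a \<in> P. p a = p u} = q + 1)"
proof -
  let ?s = "\<Sum>a\<in>P. (x a)\<^sup>2"
  have le: "lam * ?s \<le> \<mu> * ?s"
    using assms(2) by (intro mult_right_mono sum_nonneg) auto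
  have xu: "0 < x u" using u by (simp add: P_def)
  have c: "x u * - x v \<le> cross" using cross_ge[of "{(u, v)}"] u by simp
  have sq: "(x u)\<^sup>2 \<le> x u * - x v"
    using xu u(4) unfolding power2_eq_square by (intro mult_left_mono) auto
  have *: "\<mu> * ?s + cross = lam * ?s + (x u)\<^sup>2"
    "\<exists>p. balanced_partition P (parcs G) q r p \<and> card {a \<in> P. p a = p u} = q + 1"
    using P_turan(2)[where U = "{u}" and lam = lam and q = q] assms(1,3) u(1) le c sq by auto
  then have "cross = (x u)\<^sup>2" "\<mu> * ?s = lam * ?s" "(x u)\<^sup>2 = x u * - x v"
    using le c sq by linarith+
  moreover from this(3) have "x u = - x v"
    using xu unfolding power2_eq_square mult_cancel_left by linarith
  ultimately show ?thesis using *(2) square_sum_pos by simp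
qed

lemmas N_large = nodal_domains.P_large[OF swap, unfolded swap_parts]
lemmas N_exact = nodal_domains.P_exact[OF swap, unfolded swap_parts
    cross_weight_commute[OF pair_graph_arcs(3)[OF G]]]
lemmas N_exact_marked = nodal_domains.P_exact_marked[OF swap, unfolded swap_parts
    cross_weight_commute[OF pair_graph_arcs(3)[OF G]]]

text \<open>Both sign sets have at least \<open>m\<close> of the \<open>2 * m + 1\<close> vertices,
  so one of them has exactly \<open>m\<close>. Exactness there gives \<open>cross = 0\<close>, which
  concerns both sides at once.\<close>

lemma odd_structure:
  assumes lam: "0 < lam" "lam \<le> \<mu>" and bound: "chord_bound lam q r m = 1"
    and card: "card (pverts G) = 2 * m + 1"
  shows "\<mu> = lam \<and> card P = m \<and> card N = m \<and>
    (\<exists>w. pverts G = P \<union> N \<union> {w} \<and> w \<notin> P \<union> N) \<and>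
    (\<forall>a\<in>P. \<forall>b\<in>N. (a, b) \<notin> parcs G) \<and>
    (\<exists>p. balanced_partition P (parcs G) q r p) \<and> (\<exists>p. balanced_partition N (parcs G) q r p)"
proof -
  have ge: "m \<le> card P" "m \<le> card N"
    using P_large[of lam q m False] N_large[of lam q m False] lam bound by auto
  have un: "card (P \<union> N) = card P + card N" by (rule card_Un_disjoint[OF parts(1,2,7)])
  have fin: "finite (pverts G)" by (rule pair_graph_arcs(1)[OF G])
  have le: "card (P \<union> N) \<le> 2 * m + 1"
    using card_mono[OF fin, of "P \<union> N"] parts card by simp
  have cr: "\<mu> = lam" "cross = 0"
  proof -
    have "card P = m \<or> card N = m" using ge un le by linarith
    then have "\<mu> = lam \<and> cross = 0"
      using P_exact[of lam q] N_exact[of lam q] lam bound by auto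
    then show "\<mu> = lam" "cross = 0" by auto
  qed
  have no: "(a, b) \<notin> parcs G" if "a \<in> P" "b \<in> N" for a b
  proof
    assume "(a, b) \<in> parcs G"
    then have "x a * - x b \<le> 0" using cross_ge[of "{(a, b)}"] that cr by simp
    moreover have "0 < x a * - x b" using that by (intro mult_pos_pos) (auto simp: P_def N_def)
    ultimately show False by simp
  qed
  \<comment> \<open>As no arc joins \<open>P\<close> and \<open>N\<close>, connectedness needs a
    vertex outside both. This leaves exactly \<open>m\<close> vertices for each set and a single
    zero of \<open>x\<close>.\<close>
  have "P \<union> N \<noteq> pverts G"
  proof
    assume eq: "P \<union> N = pverts G"
    then have "P \<noteq> pverts G" using parts by auto
    then obtain a b where "a \<in> P" "b \<in> pverts G - P" "(a, b) \<in> parcs G"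
      using connected_crossing_arc[OF conn pair_graph_arcs(3)[OF G] parts(5,3)] by blast
    then show False using eq no by blast
  qed
  then have "P \<union> N \<subset> pverts G" using parts by auto
  then have "card (P \<union> N) < 2 * m + 1"
    using psubset_card_mono[OF fin] card by metis
  then have cards: "card P = m" "card N = m" using ge un by linarith+
  have "card (pverts G - (P \<union> N)) = 1"
    using card_Diff_subset[of "P \<union> N" "pverts G"] parts cards un card by simp
  then obtain w where "pverts G - (P \<union> N) = {w}" by (rule card_1_singletonE)
  then have "pverts G = P \<union> N \<union> {w} \<and> w \<notin> P \<union> N" using parts(5,6) by blast
  then show ?thesis
    using cards cr no P_exact[of lam q] N_exact[of lam q] lam bound by auto
qed

lemma even_structure:
  assumes lam: "0 < lam" "lam \<le> \<mu>" and bound: "chord_bound lam q r m + mark_correction lam q = 1"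
    and card: "card (pverts G) = 2 * m"
  shows "\<mu> = lam \<and> card P = m \<and> card N = m \<and> pverts G = P \<union> N \<and>
    (\<exists>u\<in>P. \<exists>v\<in>N. (\<forall>a\<in>P. \<forall>b\<in>N. (a, b) \<in> parcs G \<longleftrightarrow> a = u \<and> b = v) \<and>
      (\<exists>p. balanced_partition P (parcs G) q r p \<and> card {a \<in> P. p a = p u} = q + 1) \<and>
      (\<exists>p. balanced_partition N (parcs G) q r p \<and> card {a \<in> N. p a = p v} = q + 1))"
proof -
  have ge: "m \<le> card P" "m \<le> card N"
    using P_large[of lam q m True] N_large[of lam q m True] lam bound by auto
  have un: "card (P \<union> N) = card P + card N" by (rule card_Un_disjoint[OF parts(1,2,7)])
  have fin: "finite (pverts G)" by (rule pair_graph_arcs(1)[OF G])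
  have le: "card (P \<union> N) \<le> 2 * m"
    using card_mono[OF fin, of "P \<union> N"] parts card by simp
  have cards: "card P = m" "card N = m" using ge un le by linarith+
  then have eq: "pverts G = P \<union> N"
    using card_subset_eq[OF fin, of "P \<union> N"] parts un card by auto
  then have "P \<noteq> pverts G" using parts by auto
  then obtain u v where "u \<in> P" "v \<in> pverts G - P" and arc: "(u, v) \<in> parcs G"
    using connected_crossing_arc[OF conn pair_graph_arcs(3)[OF G] parts(5,3)] by blast
  then have uv: "u \<in> P" "v \<in> N" using eq by auto
  have rev: "(v, u) \<in> parcs G" using arc pair_graph_arcs(3)[OF G] by (rule symD[rotated])
  \<comment> \<open>The case distinction picks the endpoint that can be marked. Either way the
    entries turn out equal in absolute value, so afterwards the marked bound applies on both
    sides.\<close>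
  have key: "\<mu> = lam \<and> cross = (x u)\<^sup>2 \<and> x u = - x v"
  proof (cases "x u \<le> - x v")
    case True
    then show ?thesis using P_exact_marked[of lam q u v] lam bound cards uv arc by auto
  next
    case False
    then show ?thesis using N_exact_marked[of lam q v u] lam bound cards uv rev by auto
  qed
  \<comment> \<open>The arc \<open>(u, v)\<close> alone accounts for all of \<open>cross\<close>; a
    second arc between the sets would exceed it.\<close>
  have only: "a = u \<and> b = v" if ab: "a \<in> P" "b \<in> N" "(a, b) \<in> parcs G" for a b
  proof (rule ccontr)
    assume "\<not> (a = u \<and> b = v)"
    then have "(\<Sum>(a, b)\<in>{(u, v), (a, b)}. x a * - x b) = x u * - x v + x a * - x b" by auto
    then have "x u * - x v + x a * - x b \<le> cross"
      using cross_ge[of "{(u, v), (a, b)}"] ab uv arc by auto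
    moreover have "cross = x u * - x v" using key by (simp add: power2_eq_square)
    moreover have "0 < x a * - x b" using ab by (intro mult_pos_pos) (auto simp: P_def N_def)
    ultimately show False by linarith
  qed
  have "\<exists>p. balanced_partition P (parcs G) q r p \<and> card {a \<in> P. p a = p u} = q + 1"
    using P_exact_marked[of lam q u v] lam bound cards uv arc key by auto
  moreover have "\<exists>p. balanced_partition N (parcs G) q r p \<and> card {a \<in> N. p a = p v} = q + 1"
    using N_exact_marked[of lam q v u] lam bound cards uv rev key by auto
  ultimately show ?thesis using key cards eq uv arc only by blast
qed

end

section \<open>Joins of two Turan graphs\<close>

lemma connected_isomorphic:
  assumes "Digraph_Component.connected (with_proj G)" "isomorphic G H"
  shows "Digraph_Component.connected (with_proj H)"
proof -
  obtain hom where hom: "pre_digraph.digraph_isomorphism (with_proj G) hom"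
    "with_proj H = app_iso hom (with_proj G)"
    using assms(2) unfolding digraph_iso_def by blast
  then have "wf_digraph (with_proj G)" by (simp add: pre_digraph.digraph_isomorphism_def)
  then show ?thesis unfolding hom(2) using assms(1) hom(1) by (rule wf_digraph.connectedI_app_iso)
qed

lemma disjoint_union_simps [simp]:
  "pverts (disjoint_union A B) = pverts A <+> pverts B"
  "(Inl a, Inl b) \<in> parcs (disjoint_union A B) \<longleftrightarrow> (a, b) \<in> parcs A"
  "(Inr c, Inr d) \<in> parcs (disjoint_union A B) \<longleftrightarrow> (c, d) \<in> parcs B"
  "(Inl a, Inr d) \<notin> parcs (disjoint_union A B)"
  "(Inr c, Inl b) \<notin> parcs (disjoint_union A B)"
  by (auto simp: disjoint_union_def)

lemma add_vertex_simps [simp]: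
  "pverts (add_vertex S G) = insert None (Some ` pverts G)"
  "(Some a, Some b) \<in> parcs (add_vertex S G) \<longleftrightarrow> (a, b) \<in> parcs G"
  "(None, Some b) \<in> parcs (add_vertex S G) \<longleftrightarrow> b \<in> S"
  "(Some a, None) \<in> parcs (add_vertex S G) \<longleftrightarrow> a \<in> S"
  "(None, None) \<notin> parcs (add_vertex S G)"
  by (auto simp: add_vertex_def)

lemma edge_join_simps [simp]:
  "pverts (edge_join A u v B) = pverts A <+> pverts B"
  "(Inl a, Inl b) \<in> parcs (edge_join A u v B) \<longleftrightarrow> (a, b) \<in> parcs A"
  "(Inr c, Inr d) \<in> parcs (edge_join A u v B) \<longleftrightarrow> (c, d) \<in> parcs B"
  "(Inl a, Inr d) \<in> parcs (edge_join A u v B) \<longleftrightarrow> a = u \<and> d = v"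
  "(Inr c, Inl b) \<in> parcs (edge_join A u v B) \<longleftrightarrow> b = u \<and> c = v"
  by (auto simp: edge_join_def add_edge_def)

lemma pair_graph_disjoint_union:
  assumes "pair_graph A" "pair_graph B"
  shows "pair_graph (disjoint_union A B)"
proof (rule pair_graphI)
  note A = pair_graph_arcs[OF assms(1)] and B = pair_graph_arcs[OF assms(2)]
  show "finite (pverts (disjoint_union A B))" using A B by simp
  show "parcs (disjoint_union A B) \<subseteq> pverts (disjoint_union A B) \<times> pverts (disjoint_union A B)"
    using A(2) B(2) by (auto simp: disjoint_union_def)
  show "sym (parcs (disjoint_union A B))"
    using A(3) B(3) by (force simp: disjoint_union_def sym_def)
  show "irrefl (parcs (disjoint_union A B))"
    using A(4) B(4) by (auto simp: disjoint_union_def irrefl_def)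
qed

lemma pair_graph_add_vertex:
  assumes "pair_graph G" "S \<subseteq> pverts G"
  shows "pair_graph (add_vertex S G)"
proof (rule pair_graphI)
  note G = pair_graph_arcs[OF assms(1)]
  show "finite (pverts (add_vertex S G))" using G by simp
  show "parcs (add_vertex S G) \<subseteq> pverts (add_vertex S G) \<times> pverts (add_vertex S G)"
    using G(2) assms(2) by (auto simp: add_vertex_def)
  show "sym (parcs (add_vertex S G))"
    using G(3) by (force simp: add_vertex_def sym_def)
  show "irrefl (parcs (add_vertex S G))"
    using G(4) by (auto simp: add_vertex_def irrefl_def)
qed

lemma pair_graph_edge_join:
  assumes "pair_graph A" "pair_graph B" "u \<in> pverts A" "v \<in> pverts B"
  shows "pair_graph (edge_join A u v B)"
proof (rule pair_graphI)
  note D = pair_graph_arcs[OF pair_graph_disjoint_union[OF assms(1,2)]]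
  show "finite (pverts (edge_join A u v B))" using D(1) by simp
  show "parcs (edge_join A u v B) \<subseteq> pverts (edge_join A u v B) \<times> pverts (edge_join A u v B)"
    using D(2) assms(3,4) by (auto simp: edge_join_def add_edge_def)
  show "sym (parcs (edge_join A u v B))"
    using D(3) by (auto simp: edge_join_def add_edge_def sym_def)
  show "irrefl (parcs (edge_join A u v B))"
    using D(4) by (auto simp: edge_join_def add_edge_def irrefl_def)
qed

text \<open>Put a vector attaining \<open>rho A\<close> on each copy and zero at
  \<open>None\<close>. No arc joins the copies, so neither excess nor cross term appears.\<close>

lemma vertex_join_lambda2_ge_rho:
  assumes A: "pair_graph A" "pverts A \<noteq> {}" and H: "H \<in> vertex_joins A A"
  shows "pair_graph H \<and> rho A \<le> lambda2 H"
proof -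
  obtain S T where ST: "S \<subseteq> pverts A" "T \<subseteq> pverts A" and H: "H = add_vertex (S <+> T) (disjoint_union A A)"
    using H unfolding vertex_joins_def by blast
  have "S <+> T \<subseteq> pverts (disjoint_union A A)" using ST by auto
  then have pg: "pair_graph H"
    unfolding H by (rule pair_graph_add_vertex[OF pair_graph_disjoint_union[OF A(1) A(1)]])
  obtain y where y: "0 < (\<Sum>a\<in>pverts A. (y a)\<^sup>2)"
    "edge_weight (pverts A) (parcs A) y = rho A * (\<Sum>a\<in>pverts A. (y a)\<^sup>2)"
    using rho_attained[OF A] by blast
  have "rho A \<le> lambda2 H"
    by (rule lambda2_two_pieces[OF pg, where ?h1.0 = "\<lambda>a. Some (Inl a)" and ?h2.0 = "\<lambda>a. Some (Inr a)"
        and ?V1.0 = "pverts A" and ?V2.0 = "pverts A" and ?E1.0 = "parcs A" and ?E2.0 = "parcs A"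
        and ?y1.0 = y and ?y2.0 = y and ?c1.0 = 0 and ?c2.0 = 0])
      (use y in \<open>auto simp: H inj_on_def\<close>)
  then show ?thesis using pg by simp
qed

text \<open>The two excesses and the contribution of the joining edge combine to the square of
  \<open>\<alpha> * y u + \<beta> * z v\<close>.\<close>

lemma edge_join_lambda2_ge:
  assumes A: "pair_graph A" and B: "pair_graph B" and uv: "u \<in> pverts A" "v \<in> pverts B"
    and y: "0 < (\<Sum>a\<in>pverts A. (y a)\<^sup>2)"
      "edge_weight (pverts A) (parcs A) y = t * (\<Sum>a\<in>pverts A. (y a)\<^sup>2) + (y u)\<^sup>2"
    and z: "0 < (\<Sum>b\<in>pverts B. (z b)\<^sup>2)"
      "edge_weight (pverts B) (parcs B) z = t * (\<Sum>b\<in>pverts B. (z b)\<^sup>2) + (z v)\<^sup>2"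
  shows "t \<le> lambda2 (edge_join A u v B)"
proof (rule lambda2_two_pieces[OF pair_graph_edge_join[OF A B uv], where ?h1.0 = Inl and ?h2.0 = Inr
      and ?V1.0 = "pverts A" and ?V2.0 = "pverts B" and ?E1.0 = "parcs A" and ?E2.0 = "parcs B"
      and ?y1.0 = y and ?y2.0 = z])
  fix \<alpha> \<beta> :: real
  have "(\<Sum>a\<in>pverts A. \<Sum>b\<in>pverts B. of_bool ((Inl a, Inr b) \<in> parcs (edge_join A u v B)) * y a * z b) =
      (\<Sum>a\<in>pverts A. \<Sum>b\<in>pverts B. if a = u then (if b = v then y u * z v else 0) else 0)"
    by (rule sum.cong[OF refl], rule sum.cong[OF refl]) auto
  also have "\<dots> = (\<Sum>a\<in>pverts A. if a = u then y u * z v else 0)"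
    using uv pair_graph_arcs(1)[OF B] by (intro sum.cong refl) auto
  also have "\<dots> = y u * z v" using uv pair_graph_arcs(1)[OF A] by simp
  finally have "\<alpha>\<^sup>2 * (y u)\<^sup>2 + \<beta>\<^sup>2 * (z v)\<^sup>2 + 2 * (\<alpha> * \<beta> *
      (\<Sum>a\<in>pverts A. \<Sum>b\<in>pverts B. of_bool ((Inl a, Inr b) \<in> parcs (edge_join A u v B)) * y a * z b)) =
      (\<alpha> * y u + \<beta> * z v)\<^sup>2"
    by (simp only:) (simp add: power2_eq_square algebra_simps)
  then show "0 \<le> \<alpha>\<^sup>2 * (y u)\<^sup>2 + \<beta>\<^sup>2 * (z v)\<^sup>2 + 2 * (\<alpha> * \<beta> *
      (\<Sum>a\<in>pverts A. \<Sum>b\<in>pverts B. of_bool ((Inl a, Inr b) \<in> parcs (edge_join A u v B)) * y a * z b))"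
    by simp
qed (use y z in auto)

context nodal_domains
begin

lemma odd_isomorphic_vertex_join:
  assumes m: "0 < m" "0 < r" and cards: "card P = m" "card N = m"
    and w: "pverts G = P \<union> N \<union> {w}" "w \<notin> P \<union> N"
    and no: "\<And>a b. a \<in> P \<Longrightarrow> b \<in> N \<Longrightarrow> (a, b) \<notin> parcs G"
    and p: "balanced_partition P (parcs G) ((m - 1) div r) r p"
    and p': "balanced_partition N (parcs G) ((m - 1) div r) r p'"
  shows "\<exists>H\<in>vertex_joins (turan_graph m r) (turan_graph m r). isomorphic G H"
proof -
  let ?T = "turan_graph m r"
  note symG = pair_graph_arcs(3)[OF G] and irr = pair_graph_arcs(4)[OF G]
  \<comment> \<open>The bijection onto the Turan graph is pointed and needs a target in a larger
    part; \<open>m - 1\<close> always lies in one.\<close>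
  have last: "(m - 1) mod r mod r = (m - 1) mod r" "m - 1 < m" using m by auto
  obtain c where "c \<in> P" "card {a \<in> P. p a = p c} = (m - 1) div r + 1"
    using balanced_partition_large_part[OF parts(1) cards(1) m p] by blast
  then obtain f1 where f1: "bij_betw f1 P {..<m}"
    "\<And>a b. a \<in> P \<Longrightarrow> b \<in> P \<Longrightarrow> (a, b) \<in> parcs G \<longleftrightarrow> (f1 a, f1 b) \<in> parcs ?T"
    using balanced_partition_turan_bij[OF parts(1) cards(1) m p, of c "m - 1"]
      card_turan_part_last[OF m] last by auto
  obtain c' where "c' \<in> N" "card {a \<in> N. p' a = p' c'} = (m - 1) div r + 1"
    using balanced_partition_large_part[OF parts(2) cards(2) m p'] by blast
  then obtain f2 where f2: "bij_betw f2 N {..<m}"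
    "\<And>a b. a \<in> N \<Longrightarrow> b \<in> N \<Longrightarrow> (a, b) \<in> parcs G \<longleftrightarrow> (f2 a, f2 b) \<in> parcs ?T"
    using balanced_partition_turan_bij[OF parts(2) cards(2) m p', of c' "m - 1"]
      card_turan_part_last[OF m] last by auto
  have im: "f1 ` P = {..<m}" "f2 ` N = {..<m}" "inj_on f1 P" "inj_on f2 N"
    using f1(1) f2(1) by (auto simp: bij_betw_def)
  define S where "S = f1 ` {a \<in> P. (w, a) \<in> parcs G}"
  define T where "T = f2 ` {a \<in> N. (w, a) \<in> parcs G}"
  define H where "H = add_vertex (S <+> T) (disjoint_union ?T ?T)"
  have ST: "S \<subseteq> pverts ?T" "T \<subseteq> pverts ?T"
    using im by (auto simp: S_def T_def turan_graph_simps)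
  \<comment> \<open>An arc leaving \<open>P\<close> or \<open>N\<close>, which connectedness
    provides, can only end in \<open>w\<close>. Hence \<open>w\<close> has neighbours on both
    sides.\<close>
  have nb: "\<exists>a\<in>X. (w, a) \<in> parcs G" if X: "X = P \<or> X = N" for X
  proof -
    have "X \<subseteq> pverts G" "X \<noteq> {}" "X \<noteq> pverts G" using X parts w by auto
    then obtain a b where ab: "a \<in> X" "b \<in> pverts G - X" "(a, b) \<in> parcs G"
      using connected_crossing_arc[OF conn symG] by blast
    then have ba: "(b, a) \<in> parcs G" using symG by (auto dest: symD)
    then have "b = w" using ab X w(1) no[of a b] no[of b a] by blast
    then show ?thesis using ab ba by blast
  qed
  then have ne: "S \<noteq> {}" "T \<noteq> {}" by (auto simp: S_def T_def)
  have pgT: "pair_graph ?T" by (rule pair_graph_turan_graph)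
  have pgH: "pair_graph H"
    unfolding H_def using ST
    by (intro pair_graph_add_vertex pair_graph_disjoint_union pgT) auto
  define f where "f a = (if a = w then None else if a \<in> P then Some (Inl (f1 a)) else Some (Inr (f2 a)))" for a
  have fP: "f a = Some (Inl (f1 a))" if "a \<in> P" for a using that w by (auto simp: f_def)
  have fN: "f a = Some (Inr (f2 a))" if "a \<in> N" for a using that w parts(7) by (auto simp: f_def)
  have fw: "f w = None" by (simp add: f_def)
  have S_iff: "f1 a \<in> S \<longleftrightarrow> (w, a) \<in> parcs G" if "a \<in> P" for a
    using that im(3) by (auto simp: S_def inj_on_def)
  have T_iff: "f2 a \<in> T \<longleftrightarrow> (w, a) \<in> parcs G" if "a \<in> N" for a
    using that im(4) by (auto simp: T_def inj_on_def)
  have sym_iff: "(a, b) \<in> parcs G \<longleftrightarrow> (b, a) \<in> parcs G" for a b using symG by (blast dest: symD)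
  have iso: "isomorphic G H"
  proof (rule isomorphicI[OF G pgH])
    have "inj_on f (pverts G)"
      unfolding w(1) using im(3,4) by (auto simp: inj_on_def fP fN fw)
    moreover have "f ` pverts G = insert None (f ` P \<union> f ` N)"
      unfolding w(1) using fw by auto
    moreover have "f ` P = (\<lambda>a. Some (Inl a)) ` {..<m}"
      unfolding im(1)[symmetric] image_image by (intro image_cong refl) (rule fP)
    moreover have "f ` N = (\<lambda>a. Some (Inr a)) ` {..<m}"
      unfolding im(2)[symmetric] image_image by (intro image_cong refl) (rule fN)
    ultimately show "bij_betw f (pverts G) (pverts H)"
      by (auto simp: bij_betw_def H_def turan_graph_simps Plus_def)
    fix a b assume ab: "a \<in> pverts G" "b \<in> pverts G"
    consider "a \<in> P" | "a \<in> N" | "a = w" using ab(1) w(1) by blast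
    then show "(a, b) \<in> parcs G \<longleftrightarrow> (f a, f b) \<in> parcs H"
    proof cases
      case 1
      consider "b \<in> P" | "b \<in> N" | "b = w" using ab(2) w(1) by blast
      then show ?thesis
        by cases (use 1 f1 no S_iff sym_iff[of a b] in \<open>auto simp: fP fN fw H_def\<close>)
    next
      case 2
      consider "b \<in> P" | "b \<in> N" | "b = w" using ab(2) w(1) by blast
      then show ?thesis
        by cases (use 2 f2 no T_iff sym_iff[of a b] in \<open>auto simp: fP fN fw H_def\<close>)
    next
      case 3
      consider "b \<in> P" | "b \<in> N" | "b = w" using ab(2) w(1) by blast
      then show ?thesis
        by cases (use 3 S_iff T_iff irr in \<open>auto simp: fP fN fw H_def irrefl_def\<close>)
    qed
  qed
  have "H \<in> vertex_joins ?T ?T"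
    unfolding vertex_joins_def using ST ne connected_isomorphic[OF conn iso] H_def by blast
  then show ?thesis using iso by blast
qed

lemma even_isomorphic_edge_join:
  assumes m: "0 < m" "0 < r" and cards: "card P = m" "card N = m" and eq: "pverts G = P \<union> N"
    and uv: "u \<in> P" "v \<in> N" and cross: "\<And>a b. a \<in> P \<Longrightarrow> b \<in> N \<Longrightarrow> (a, b) \<in> parcs G \<longleftrightarrow> a = u \<and> b = v"
    and p: "balanced_partition P (parcs G) ((m - 1) div r) r p"
      "card {a \<in> P. p a = p u} = (m - 1) div r + 1"
    and p': "balanced_partition N (parcs G) ((m - 1) div r) r p'"
      "card {a \<in> N. p' a = p' v} = (m - 1) div r + 1"
    and u': "u' < m" "card (turan_part m r (u' mod r)) = (m - 1) div r + 1"
    and v': "v' < m" "card (turan_part m r (v' mod r)) = (m - 1) div r + 1"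
  shows "isomorphic G (edge_join (turan_graph m r) u' v' (turan_graph m r))"
proof -
  let ?T = "turan_graph m r"
  let ?H = "edge_join ?T u' v' ?T"
  obtain f1 where f1: "bij_betw f1 P {..<m}" "f1 u = u'"
    "\<And>a b. a \<in> P \<Longrightarrow> b \<in> P \<Longrightarrow> (a, b) \<in> parcs G \<longleftrightarrow> (f1 a, f1 b) \<in> parcs ?T"
    using balanced_partition_turan_bij[OF parts(1) cards(1) m p(1) uv(1) p(2) u'] by blast
  obtain f2 where f2: "bij_betw f2 N {..<m}" "f2 v = v'"
    "\<And>a b. a \<in> N \<Longrightarrow> b \<in> N \<Longrightarrow> (a, b) \<in> parcs G \<longleftrightarrow> (f2 a, f2 b) \<in> parcs ?T"
    using balanced_partition_turan_bij[OF parts(2) cards(2) m p'(1) uv(2) p'(2) v'] by blast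
  have im: "f1 ` P = {..<m}" "f2 ` N = {..<m}" "inj_on f1 P" "inj_on f2 N"
    using f1(1) f2(1) by (auto simp: bij_betw_def)
  have pgT: "pair_graph ?T" by (rule pair_graph_turan_graph)
  have pgH: "pair_graph ?H"
    using u' v' by (intro pair_graph_edge_join pgT) (auto simp: turan_graph_simps)
  define f where "f a = (if a \<in> P then Inl (f1 a) else Inr (f2 a))" for a
  have fP: "f a = Inl (f1 a)" if "a \<in> P" for a using that by (simp add: f_def)
  have fN: "f a = Inr (f2 a)" if "a \<in> N" for a using that parts(7) by (auto simp: f_def)
  have u_iff: "f1 a = u' \<longleftrightarrow> a = u" if "a \<in> P" for a
    using that im(3) uv(1) f1(2) by (auto simp: inj_on_def)
  have v_iff: "f2 a = v' \<longleftrightarrow> a = v" if "a \<in> N" for a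
    using that im(4) uv(2) f2(2) by (auto simp: inj_on_def)
  have sym_iff: "(a, b) \<in> parcs G \<longleftrightarrow> (b, a) \<in> parcs G" for a b
    using pair_graph_arcs(3)[OF G] by (blast dest: symD)
  show ?thesis
  proof (rule isomorphicI[OF G pgH])
    have "inj_on f (pverts G)"
    proof (rule inj_onI)
      fix a b assume ab: "a \<in> pverts G" "b \<in> pverts G" "f a = f b"
      consider "a \<in> P" "b \<in> P" | "a \<in> P" "b \<in> N" | "a \<in> N" "b \<in> P" | "a \<in> N" "b \<in> N"
        using ab(1,2) eq by blast
      then show "a = b"
        by cases (use ab(3) inj_onD[OF im(3)] inj_onD[OF im(4)] in \<open>simp_all add: fP fN\<close>)
    qed
    moreover have "f ` pverts G = f ` P \<union> f ` N" unfolding eq by (rule image_Un)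
    moreover have "f ` P = Inl ` {..<m}"
      unfolding im(1)[symmetric] image_image by (intro image_cong refl) (rule fP)
    moreover have "f ` N = Inr ` {..<m}"
      unfolding im(2)[symmetric] image_image by (intro image_cong refl) (rule fN)
    ultimately show "bij_betw f (pverts G) (pverts ?H)"
      by (simp add: bij_betw_def turan_graph_simps Plus_def)
    fix a b assume ab: "a \<in> pverts G" "b \<in> pverts G"
    consider "a \<in> P" "b \<in> P" | "a \<in> P" "b \<in> N" | "a \<in> N" "b \<in> P" | "a \<in> N" "b \<in> N"
      using ab eq by blast
    then show "(a, b) \<in> parcs G \<longleftrightarrow> (f a, f b) \<in> parcs ?H"
    proof cases
      case 1
      then show ?thesis by (simp add: fP f1(3))
    next
      case 2
      then show ?thesis by (simp add: fP fN cross u_iff v_iff)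
    next
      case 3
      then show ?thesis using sym_iff[of a b] cross[of b a] by (simp add: fP fN u_iff v_iff)
    next
      case 4
      then show ?thesis by (simp add: fN f2(3))
    qed
  qed
qed

end

section \<open>The two parities\<close>

theorem odd_order_lambda2:
  fixes G :: "'a pair_pre_digraph"
  assumes r: "2 \<le> r" and G: "pair_graph G" and conn: "Digraph_Component.connected (with_proj G)"
    and clique: "clique_free (r + 1) G" and card: "card (pverts G) = 2 * m + 1" and m: "r \<le> m"
  shows "lambda2 G \<le> rho (turan_graph m r)"
    and "lambda2 G = rho (turan_graph m r) \<longleftrightarrow>
      (\<exists>H\<in>vertex_joins (turan_graph m r) (turan_graph m r). isomorphic G H)"
proof -
  let ?T = "turan_graph m r"
  have pos: "0 < m" "0 < r" using r m by auto
  obtain lam where lam: "0 < lam" and bound: "chord_bound lam ((m - 1) div r) r m = 1"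
    using turan_parameter_exists[OF r m, of "{}"] by auto
  obtain y where y: "\<forall>a<m. 0 < y a" "edge_weight {..<m} (parcs ?T) y = lam * (\<Sum>a<m. (y a)\<^sup>2)"
    using turan_weight_attained[OF pos lam, of "{}"] bound by auto
  have "0 < (\<Sum>a<m. (y a)\<^sup>2)" using y(1) pos by (intro sum_pos) auto
  then have lam_rho: "lam \<le> rho ?T"
    using y(2) by (intro rho_lower_bound[OF pair_graph_turan_graph, of y]) (simp_all add: turan_graph_simps)
  have "2 \<le> card (pverts G)" using card pos by simp
  then obtain \<mu> x where mu: "lambda2 G \<le> \<mu>" and
    eig: "\<And>a. a \<in> pverts G \<Longrightarrow> (\<Sum>b\<in>pverts G. of_bool ((a, b) \<in> parcs G) * x b) = \<mu> * x a"
    and signs: "\<exists>a\<in>pverts G. 0 < x a" "\<exists>a\<in>pverts G. x a < 0"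
    by (rule sign_changing_eigenvector[OF G conn]) (rule that)
  interpret nodal_domains G r x \<mu>
    by (rule nodal_domains.intro[OF G conn clique eig signs])
  \<comment> \<open>If \<open>lam < lambda2 G\<close>, then \<open>lam \<le> \<mu>\<close>, and the
    structure lemma yields \<open>\<mu> = lam\<close>, contradicting
    \<open>lambda2 G \<le> \<mu>\<close>.\<close>
  have le: "lambda2 G \<le> lam"
    using odd_structure[OF lam _ bound card] mu by linarith
  then show "lambda2 G \<le> rho ?T" using lam_rho by simp
  show "lambda2 G = rho ?T \<longleftrightarrow> (\<exists>H\<in>vertex_joins ?T ?T. isomorphic G H)"
  proof
    assume "lambda2 G = rho ?T"
    then have "lam \<le> \<mu>" using lam_rho mu by simp
    then show "\<exists>H\<in>vertex_joins ?T ?T. isomorphic G H"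
      using odd_structure[OF lam _ bound card] odd_isomorphic_vertex_join[OF pos] by blast
  next
    assume "\<exists>H\<in>vertex_joins ?T ?T. isomorphic G H"
    then obtain H where H: "H \<in> vertex_joins ?T ?T" "isomorphic G H" by blast
    \<comment> \<open>This closes the chain from \<open>rho ?T\<close> through
      \<open>lambda2 H = lambda2 G\<close> and \<open>lam\<close> back to
      \<open>rho ?T\<close>.\<close>
    have "rho ?T \<le> lambda2 H"
      using vertex_join_lambda2_ge_rho[OF pair_graph_turan_graph _ H(1)] pos
      by (auto simp: turan_graph_simps)
    then show "lambda2 G = rho ?T"
      using graph_eigenvalue_isomorphic[OF G H(2), of 2] le lam_rho by linarith
  qed
qed

theorem even_order_lambda2:
  fixes G :: "'a pair_pre_digraph"
  assumes r: "2 \<le> r" and G: "pair_graph G" and conn: "Digraph_Component.connected (with_proj G)"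
    and clique: "clique_free (r + 1) G" and card: "card (pverts G) = 2 * m" and m: "2 * r \<le> m"
    and u: "u < m" "card (turan_part m r (u mod r)) = (m - 1) div r + 1"
    and v: "v < m" "card (turan_part m r (v mod r)) = (m - 1) div r + 1"
  defines "K \<equiv> edge_join (turan_graph m r) u v (turan_graph m r)"
  shows "lambda2 G \<le> lambda2 K" and "lambda2 G = lambda2 K \<longleftrightarrow> isomorphic G K"
proof -
  let ?T = "turan_graph m r" and ?q = "(m - 1) div r"
  have pos: "0 < m" "0 < r" "r \<le> m" using r m by auto
  obtain lam where lam: "0 < lam" and bound: "chord_bound lam ?q r m + mark_correction lam ?q = 1"
    using turan_parameter_exists[OF r pos(3), of "{u}"] u m by auto
  \<comment> \<open>The equation for \<open>lam\<close> involves only \<open>m\<close> and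
    \<open>r\<close>, so one \<open>lam\<close> has test vectors for both \<open>u\<close> and
    \<open>v\<close>, even if their parts carry different labels.\<close>
  have att: "\<exists>y. (\<forall>a<m. 0 < y a) \<and>
      edge_weight {..<m} (parcs ?T) y = lam * (\<Sum>a<m. (y a)\<^sup>2) + (y c)\<^sup>2"
    if "c < m" "card (turan_part m r (c mod r)) = ?q + 1" for c
    using turan_weight_attained[OF pos(1,2) lam, of "{c}"] bound that by auto
  obtain y where y: "\<forall>a<m. 0 < y a"
    "edge_weight {..<m} (parcs ?T) y = lam * (\<Sum>a<m. (y a)\<^sup>2) + (y u)\<^sup>2"
    using att[OF u] by blast
  obtain z where z: "\<forall>a<m. 0 < z a"
    "edge_weight {..<m} (parcs ?T) z = lam * (\<Sum>a<m. (z a)\<^sup>2) + (z v)\<^sup>2"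
    using att[OF v] by blast
  have "0 < (\<Sum>a<m. (y a)\<^sup>2)" "0 < (\<Sum>a<m. (z a)\<^sup>2)"
    using y(1) z(1) pos(1) by (intro sum_pos; force)+
  then have lam_K: "lam \<le> lambda2 K"
    unfolding K_def using y(2) z(2) u(1) v(1)
    by (intro edge_join_lambda2_ge[OF pair_graph_turan_graph pair_graph_turan_graph, where y = y and z = z])
      (simp_all add: turan_graph_simps)
  have "2 \<le> card (pverts G)" using card pos by simp
  then obtain \<mu> x where mu: "lambda2 G \<le> \<mu>" and
    eig: "\<And>a. a \<in> pverts G \<Longrightarrow> (\<Sum>b\<in>pverts G. of_bool ((a, b) \<in> parcs G) * x b) = \<mu> * x a"
    and signs: "\<exists>a\<in>pverts G. 0 < x a" "\<exists>a\<in>pverts G. x a < 0"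
    by (rule sign_changing_eigenvector[OF G conn]) (rule that)
  interpret nodal_domains G r x \<mu>
    by (rule nodal_domains.intro[OF G conn clique eig signs])
  have le: "lambda2 G \<le> lam"
    using even_structure[OF lam _ bound card] mu by linarith
  then show "lambda2 G \<le> lambda2 K" using lam_K by simp
  show "lambda2 G = lambda2 K \<longleftrightarrow> isomorphic G K"
  proof
    assume "lambda2 G = lambda2 K"
    then have "lam \<le> \<mu>" using lam_K mu by simp
    then show "isomorphic G K"
      unfolding K_def using even_structure[OF lam _ bound card]
        even_isomorphic_edge_join[OF pos(1,2) _ _ _ _ _ _ _ _ _ _ u v] by blast
  next
    assume "isomorphic G K"
    then show "lambda2 G = lambda2 K" by (rule graph_eigenvalue_isomorphic[OF G])
  qed
qed

theorem theorem3p9: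
  fixes G :: "'a pair_pre_digraph" and n r :: nat
  assumes "r \<ge> 2"
    and "pair_graph G"
    and "Digraph_Component.connected (with_proj G)"
    and "clique_free (r + 1) G"
    and "card (pverts G) = n"
  shows
    "(odd n \<and> n \<ge> 2 * r + 1 \<longrightarrow>
        lambda2 G \<le> rho (turan_graph ((n - 1) div 2) r) \<and>
        (lambda2 G = rho (turan_graph ((n - 1) div 2) r) \<longleftrightarrow>
          (\<exists>H \<in> vertex_joins (turan_graph ((n - 1) div 2) r) (turan_graph ((n - 1) div 2) r).
            isomorphic G H) \<and>
          clique_free (r + 1) G)) \<and>
     (even n \<and> n \<ge> 10 * r \<longrightarrow>
        (\<forall>i j u v. i < r \<and> u \<in> turan_part (n div 2) r i \<and>
            int (card (turan_part (n div 2) r i)) = \<lceil>real n / real (2 * r)\<rceil> \<and>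
            j < r \<and> v \<in> turan_part (n div 2) r j \<and>
            int (card (turan_part (n div 2) r j)) = \<lceil>real n / real (2 * r)\<rceil> \<longrightarrow>
          lambda2 G \<le> lambda2 (edge_join (turan_graph (n div 2) r) u v (turan_graph (n div 2) r)) \<and>
          (lambda2 G = lambda2 (edge_join (turan_graph (n div 2) r) u v (turan_graph (n div 2) r)) \<longleftrightarrow>
            isomorphic G (edge_join (turan_graph (n div 2) r) u v (turan_graph (n div 2) r)))))"
proof (intro conjI impI allI)
  assume "odd n \<and> n \<ge> 2 * r + 1"
  then have n: "card (pverts G) = 2 * ((n - 1) div 2) + 1" "r \<le> (n - 1) div 2"
    using assms(5) by auto
  note odd = odd_order_lambda2[OF assms(1-4) n]
  show "lambda2 G \<le> rho (turan_graph ((n - 1) div 2) r)" by (rule odd(1))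
  show "lambda2 G = rho (turan_graph ((n - 1) div 2) r) \<longleftrightarrow>
      (\<exists>H \<in> vertex_joins (turan_graph ((n - 1) div 2) r) (turan_graph ((n - 1) div 2) r).
        isomorphic G H) \<and> clique_free (r + 1) G"
    using odd(2) assms(4) by blast
next
  fix i j u v
  assume n: "even n \<and> n \<ge> 10 * r"
    and uv: "i < r \<and> u \<in> turan_part (n div 2) r i \<and>
            int (card (turan_part (n div 2) r i)) = \<lceil>real n / real (2 * r)\<rceil> \<and>
            j < r \<and> v \<in> turan_part (n div 2) r j \<and>
            int (card (turan_part (n div 2) r j)) = \<lceil>real n / real (2 * r)\<rceil>"
  define m where "m = n div 2"
  have m: "n = 2 * m" "2 * r \<le> m" "0 < m" "0 < r" using n assms(1) by (auto simp: m_def)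
  \<comment> \<open>The rounded-up part size is \<open>q + 1\<close> for
    \<open>q = (m - 1) div r\<close>, the size at which the marked chord inequality is
    sharp.\<close>
  have "\<lceil>real n / real (2 * r)\<rceil> = int ((m - 1) div r + 1)"
    unfolding m(1) by (rule ceiling_double_quotient[OF m(3,4)])
  then have uv': "u < m" "card (turan_part m r (u mod r)) = (m - 1) div r + 1"
    "v < m" "card (turan_part m r (v mod r)) = (m - 1) div r + 1"
    using uv unfolding m_def[symmetric] by (auto simp: turan_part_def)
  have "card (pverts G) = 2 * m" using assms(5) m(1) by simp
  note even = even_order_lambda2[OF assms(1-4) this m(2) uv', folded m_def]
  show "lambda2 G \<le> lambda2 (edge_join (turan_graph (n div 2) r) u v (turan_graph (n div 2) r))"
    unfolding m_def[symmetric] by (rule even(1))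
  show "lambda2 G = lambda2 (edge_join (turan_graph (n div 2) r) u v (turan_graph (n div 2) r)) \<longleftrightarrow>
      isomorphic G (edge_join (turan_graph (n div 2) r) u v (turan_graph (n div 2) r))"
    unfolding m_def[symmetric] by (rule even(2))
qed

end
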